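(* Let $r\in\mathbb{R}$ (riskless rate), $\sigma>0$, $T>0$, $K>0$, $\tau\in\mathbb{R}$ and $C_\tau\ge 0$ be constants, and put $I^{(\aleph_\tau)}:=C_\tau\tau$. Suppose that the informed trader's risk-neutral stock price dynamics are given by $$dS_t^{(\aleph_\tau)}=(r-C_\tau\tau)\,S_t^{(\aleph_\tau)}\,dt+\sigma S_t^{(\aleph_\tau)}\,dB(t),\qquad t\in[0,T],$$ where $B$ is a standard Brownian motion and the initial value $S_0^{(\aleph_\tau)}>0$ is deterministic. Then for every $t\in[0,T)$ the trader's value $C^{(\aleph_\tau)}(S_t^{(\aleph_\tau)},t)$ of a European call contract with maturity price $C^{(\aleph_\tau)}(S_T^{(\aleph_\tau)},T)=\max(0,S_T^{(\aleph_\tau)}-K)$ is $$C^{(\aleph_\tau)}\big(S_t^{(\aleph_\tau)},t\big)=e^{-I^{(\aleph_\tau)}(T-t)}S_t^{(\aleph_\tau)}N(d_1)-Ke^{-r(T-t)}N(d_2),$$ where $$d_1=\frac{\ln\big(S_t^{(\aleph_\tau)}/K\big)+\big(r-I^{(\aleph_\tau)}+\frac{\sigma^2}{2}\big)(T-t)}{\sigma\sqrt{T-t}},\qquad d_2=d_1-\sigma\sqrt{T-t}.$$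
   Context: $N$ denotes the cumulative distribution function of the standard normal law. $\aleph_\tau$ is a label for a trader with information parameter $\tau$ ($\tau>0$ informed, $\tau=0$ uninformed, $\tau<0$ misinformed). The trader's value at time $t$ of a European contract with payoff $g(S_T^{(\aleph_\tau)})$ at maturity $T$ is the riskless-rate-discounted conditional expectation under the trader's risk-neutral dynamics: $e^{-r(T-t)}\,\mathbb{E}\big[g(S_T^{(\aleph_\tau)})\,\big|\,\mathcal{F}_t\big]$, where $(\mathcal{F}_t)$ is the filtration generated by $B$. *)

theory Defs
  imports "HOL-Probability.Probability"
begin

section \<open>Brownian motion and its filtration\<close>

definition natural_filtration :: "'a measure \<Rightarrow> (real \<Rightarrow> 'a \<Rightarrow> real) \<Rightarrow> real \<Rightarrow> 'a measure" where
  "natural_filtration M X t =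
     sigma (space M) (\<Union>s\<in>{0..t}. {X s -` A \<inter> space M | A. A \<in> sets borel})"

definition augmented_filtration :: "'a measure \<Rightarrow> (real \<Rightarrow> 'a measure) \<Rightarrow> real \<Rightarrow> 'a measure" where
  "augmented_filtration M F t = sigma (space M) (sets (F t) \<union> null_sets M)"

definition standard_brownian_motion :: "'a measure \<Rightarrow> (real \<Rightarrow> 'a \<Rightarrow> real) \<Rightarrow> bool" where
  "standard_brownian_motion M B \<longleftrightarrow>
     (\<forall>t\<ge>0. B t \<in> borel_measurable M) \<and>
     (AE \<omega> in M. B 0 \<omega> = 0) \<and>
     (AE \<omega> in M. continuous_on {0..} (\<lambda>t. B t \<omega>)) \<and>
     (\<forall>s t. 0 \<le> s \<and> s < t \<longrightarrow>
        distributed M lborel (\<lambda>\<omega>. B t \<omega> - B s \<omega>) (normal_density 0 (sqrt (t - s))) \<and>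
        prob_space.indep_set M
          (sets (natural_filtration M B s))
          (sets (vimage_algebra (space M) (\<lambda>\<omega>. B t \<omega> - B s \<omega>) borel)))"


section \<open>The Ito integral\<close>

definition converges_in_probability ::
  "'a measure \<Rightarrow> (nat \<Rightarrow> 'a \<Rightarrow> real) \<Rightarrow> ('a \<Rightarrow> real) \<Rightarrow> bool" where
  "converges_in_probability M X Y \<longleftrightarrow>
     (\<forall>k. X k \<in> borel_measurable M) \<and> Y \<in> borel_measurable M \<and>
     (\<forall>\<epsilon>>0. (\<lambda>k. measure M {\<omega> \<in> space M. \<bar>X k \<omega> - Y \<omega>\<bar> > \<epsilon>}) \<longlonglongrightarrow> 0)"

text \<open>
  An elementary process on the time interval from 0 to \<open>t\<close> is given by a number \<open>n\<close> of steps,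
  a grid \<open>p 0 \<le> \<dots> \<le> p n\<close> and bounded values \<open>\<xi> i\<close>, where \<open>\<xi> i\<close> is known at time \<open>p i\<close>
  and is the value of the process from \<open>p i\<close> (inclusive) to \<open>p (i + 1)\<close> (exclusive).
\<close>

definition elementary_data ::
  "'a measure \<Rightarrow> (real \<Rightarrow> 'a measure) \<Rightarrow> real \<Rightarrow> nat \<Rightarrow> (nat \<Rightarrow> real) \<Rightarrow> (nat \<Rightarrow> 'a \<Rightarrow> real) \<Rightarrow> bool"
  where
  "elementary_data M F t n p \<xi> \<longleftrightarrow>
     p 0 = 0 \<and> p n = t \<and> (\<forall>i<n. p i \<le> p (Suc i)) \<and>
     (\<forall>i<n. \<xi> i \<in> borel_measurable (F (p i))) \<and>
     (\<exists>c. \<forall>i<n. \<forall>\<omega>\<in>space M. \<bar>\<xi> i \<omega>\<bar> \<le> c)"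

definition elementary_process ::
  "nat \<Rightarrow> (nat \<Rightarrow> real) \<Rightarrow> (nat \<Rightarrow> 'a \<Rightarrow> real) \<Rightarrow> real \<Rightarrow> 'a \<Rightarrow> real" where
  "elementary_process n p \<xi> s \<omega> = (\<Sum>i<n. \<xi> i \<omega> * indicator {p i..<p (Suc i)} s)"

definition elementary_integral ::
  "(real \<Rightarrow> 'a \<Rightarrow> real) \<Rightarrow> nat \<Rightarrow> (nat \<Rightarrow> real) \<Rightarrow> (nat \<Rightarrow> 'a \<Rightarrow> real) \<Rightarrow> 'a \<Rightarrow> real" where
  "elementary_integral B n p \<xi> \<omega> = (\<Sum>i<n. \<xi> i \<omega> * (B (p (Suc i)) \<omega> - B (p i) \<omega>))"

definition measurable_adapted ::
  "'a measure \<Rightarrow> (real \<Rightarrow> 'a measure) \<Rightarrow> real \<Rightarrow> (real \<Rightarrow> 'a \<Rightarrow> real) \<Rightarrow> bool" where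
  "measurable_adapted M F t H \<longleftrightarrow>
     (\<lambda>(s, \<omega>). H s \<omega>) \<in> borel_measurable (restrict_space borel {0..t} \<Otimes>\<^sub>M M) \<and>
     (\<forall>s\<in>{0..t}. H s \<in> borel_measurable (F s))"

text \<open>
  \<open>has_ito_integral M F B t H J\<close>: the random variable \<open>J\<close> is (a version of) the Ito integral
  of \<open>H\<close> with respect to \<open>B\<close> from 0 to \<open>t\<close>. The integrands are the measurable adapted processes
  whose paths are almost surely square integrable (no moment assumption), and the integral is the
  limit in probability of the integrals of elementary processes approximating \<open>H\<close>.
  The approximation distance is an \<open>ennreal\<close>-valued integral, so that it cannot vanish
  merely because an integral is undefined.
\<close>

definition has_ito_integral ::
  "'a measure \<Rightarrow> (real \<Rightarrow> 'a measure) \<Rightarrow> (real \<Rightarrow> 'a \<Rightarrow> real) \<Rightarrow> real \<Rightarrow>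
     (real \<Rightarrow> 'a \<Rightarrow> real) \<Rightarrow> ('a \<Rightarrow> real) \<Rightarrow> bool" where
  "has_ito_integral M F B t H J \<longleftrightarrow>
     measurable_adapted M F t H \<and>
     (AE \<omega> in M. (\<integral>\<^sup>+s\<in>{0..t}. ennreal ((H s \<omega>)\<^sup>2) \<partial>lborel) < \<infinity>) \<and>
     (\<exists>n p \<xi>.
        (\<forall>k. elementary_data M F t (n k) (p k) (\<xi> k)) \<and>
        (\<forall>\<epsilon>>0. (\<lambda>k. measure M {\<omega> \<in> space M.
           (\<integral>\<^sup>+s\<in>{0..t}. ennreal ((elementary_process (n k) (p k) (\<xi> k) s \<omega> - H s \<omega>)\<^sup>2) \<partial>lborel)
             > ennreal \<epsilon>}) \<longlonglongrightarrow> 0) \<and>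
        converges_in_probability M (\<lambda>k. elementary_integral B (n k) (p k) (\<xi> k)) J)"


section \<open>Stochastic differential equations\<close>

text \<open>
  Strong solutions on the time interval from 0 to \<open>T\<close> of
  \<open>dX(t) = b t (X t) dt + a t (X t) dB(t)\<close>: \<open>X\<close> is adapted to the filtration generated by \<open>B\<close>,
  completed by the null sets, and the equation holds in integrated form.
\<close>

definition sde_solution ::
  "'a measure \<Rightarrow> (real \<Rightarrow> 'a \<Rightarrow> real) \<Rightarrow> real \<Rightarrow> (real \<Rightarrow> real \<Rightarrow> real) \<Rightarrow> (real \<Rightarrow> real \<Rightarrow> real) \<Rightarrow>
     (real \<Rightarrow> 'a \<Rightarrow> real) \<Rightarrow> bool" where
  "sde_solution M B T b a X \<longleftrightarrow>
     (let F = augmented_filtration M (natural_filtration M B) in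
        measurable_adapted M F T X \<and>
        (AE \<omega> in M. continuous_on {0..T} (\<lambda>t. X t \<omega>)) \<and>
        (AE \<omega> in M. set_integrable lborel {0..T} (\<lambda>s. b s (X s \<omega>))) \<and>
        (\<exists>J. \<forall>t\<in>{0..T}.
           has_ito_integral M F B t (\<lambda>s \<omega>. a s (X s \<omega>)) (J t) \<and>
           (AE \<omega> in M. X t \<omega> = X 0 \<omega> + (LINT s:{0..t}|lborel. b s (X s \<omega>)) + J t \<omega>)))"


section \<open>Valuation\<close>

text \<open>
  The value at time \<open>t\<close> of the payoff \<open>g (S T)\<close> at maturity \<open>T\<close>: the conditional expectation given
  the filtration generated by \<open>B\<close>, discounted at the riskless rate \<open>r\<close>.
\<close>

definition european_value ::
  "'a measure \<Rightarrow> (real \<Rightarrow> 'a \<Rightarrow> real) \<Rightarrow> real \<Rightarrow> real \<Rightarrow> (real \<Rightarrow> real) \<Rightarrow>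
     (real \<Rightarrow> 'a \<Rightarrow> real) \<Rightarrow> real \<Rightarrow> 'a \<Rightarrow> real" where
  "european_value M B r T g S t \<omega> =
     exp (- r * (T - t)) * real_cond_exp M (natural_filtration M B t) (\<lambda>\<omega>'. g (S T \<omega>')) \<omega>"

abbreviation std_normal_cdf :: "real \<Rightarrow> real" where
  "std_normal_cdf \<equiv> cdf std_normal_distribution"

end

theory Submission
  imports Defs
begin

text \<open>
  Put \<open>\<mu> = r - I\<close>. The equation has no solution but \<open>S\<^sub>t = s\<^sub>0 exp (\<sigma> B\<^sub>t + (\<mu> - \<sigma>\<^sup>2 / 2) t)\<close>: with
  \<open>Z\<^sub>t = exp (- \<sigma> B\<^sub>t - (\<mu> - \<sigma>\<^sup>2 / 2) t)\<close> the product \<open>Z S\<close> is constant. Instead of appealing to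
  the Ito formula, \<open>S\<close> is replaced by a discrete process driven by an elementary approximant of
  the integrand \<open>\<sigma> S\<close>, and the increments of \<open>Z S\<close> are split into three sums \<open>\<Sum> h\<^sub>i v\<^sub>i\<close>, where \<open>h\<^sub>i\<close> is
  known at the beginning of the \<open>i\<close>-th step and \<open>v\<^sub>i\<close> is a function of the increment of \<open>B\<close> with first and
  second moments of the order of the step length. A stopping argument bounds such sums in
  probability by \<open>\<Sum> h\<^sub>i\<^sup>2 \<Delta>\<^sub>i\<close>, which tends to zero; no moments of \<open>S\<close> are needed.

  Hence \<open>S\<^sub>T = S\<^sub>t exp (\<sigma> (B\<^sub>T - B\<^sub>t) + (\<mu> - \<sigma>\<^sup>2 / 2) (T - t))\<close>, and since \<open>B\<^sub>T - B\<^sub>t\<close> is independent of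
  the past, the conditional expectation is an integral over a normal law.
\<close>

section \<open>Moments of the normal distribution\<close>

text \<open>The obstacle is that little is known about the Ito term: for each single time it is a
  limit in probability, with its own approximants and its own null set. Sampling \<open>S\<close>
  itself would leave increments of the Ito term about which nothing can be said. The discrete
  process has instead increments \<open>\<mu> * y * d + e * w\<close> with \<open>y\<close> and
  \<open>e\<close> known at the start of the step and \<open>w\<close> an exact Brownian increment,
  so that all estimates rest on independence and Gaussian moments. One of the three sums collects
  the defects of Euler steps against exact steps, the other two the errors of the drift and of the
  integrand.

  The order of choices matters. The accuracy \<rho> is fixed from bounds on the paths and the
  constants of the problem, then the approximant, and only then a grid that refines its partition
  and is fine enough for the paths. Hence the errors of the approximant must be controlled on finite
  sets of times chosen after it.

  The equation lives on the augmented filtration, the value on the natural one; the explicit formula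
  for \<open>S\<close> leads from one to the other.\<close>

lemma normal_density_exp_shift:
  assumes "s > 0"
  shows "normal_density 0 s x * exp (a * x) = exp (a\<^sup>2 * s\<^sup>2 / 2) * normal_density (a * s\<^sup>2) s x"
proof -
  have "- x\<^sup>2 / (2 * s\<^sup>2) + a * x = a\<^sup>2 * s\<^sup>2 / 2 + - (x - a * s\<^sup>2)\<^sup>2 / (2 * s\<^sup>2)"
    using assms by (simp add: field_simps power2_eq_square)
  then show ?thesis
    by (simp add: normal_density_def exp_add[symmetric])
qed

lemma normal_moment_two:
  assumes "s > 0"
  shows "has_bochner_integral lborel (\<lambda>x. normal_density m s x * x\<^sup>2) (m\<^sup>2 + s\<^sup>2)"
proof -
  have "has_bochner_integral lborel (\<lambda>x. normal_density m s x * (x - m) ^ (2 * 1)) (fact (2 * 1) / ((2 / s\<^sup>2) ^ 1 * fact 1))"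
    by (rule normal_moment_even[OF assms])
  then have A: "has_bochner_integral lborel (\<lambda>x. normal_density m s x * (x - m)\<^sup>2) (s\<^sup>2)"
    by (simp add: numeral_2_eq_2)
  have B: "has_bochner_integral lborel (\<lambda>x. normal_density m s x * x) m"
    by (rule normal_moment_nz_1[OF assms])
  have C: "has_bochner_integral lborel (\<lambda>x. normal_density m s x) 1"
    using assms by (simp add: has_bochner_integral_iff)
  have "has_bochner_integral lborel
      (\<lambda>x. normal_density m s x * (x - m)\<^sup>2 + (2 * m) * (normal_density m s x * x) - m\<^sup>2 * normal_density m s x)
      (s\<^sup>2 + 2 * m * m - m\<^sup>2 * 1)"
    by (intro has_bochner_integral_add has_bochner_integral_diff has_bochner_integral_mult_right A B C)
  also have "(\<lambda>x. normal_density m s x * (x - m)\<^sup>2 + (2 * m) * (normal_density m s x * x) - m\<^sup>2 * normal_density m s x)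
      = (\<lambda>x. normal_density m s x * x\<^sup>2)"
    by (auto simp: power2_eq_square algebra_simps)
  finally show ?thesis
    by (simp add: power2_eq_square algebra_simps)
qed

context prob_space
begin

text \<open>Weighting the centred normal law of variance \<open>d\<close> by
  \<open>exp (a * x)\<close> gives, up to the factor \<open>exp (a\<^sup>2 * d / 2)\<close>, the
  normal law with mean \<open>a * d\<close> and the same variance. The three values are its moments
  of order 0, 1 and 2 times this factor.\<close>

lemma normal_exp_moments:
  fixes W :: "'a \<Rightarrow> real"
  assumes W: "distributed M lborel W (normal_density 0 (sqrt d))" and d: "d > 0"
  shows "has_bochner_integral M (\<lambda>\<omega>. exp (a * W \<omega>)) (exp (a\<^sup>2 * d / 2))"
    and "has_bochner_integral M (\<lambda>\<omega>. W \<omega> * exp (a * W \<omega>)) (a * d * exp (a\<^sup>2 * d / 2))"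
    and "has_bochner_integral M (\<lambda>\<omega>. (W \<omega>)\<^sup>2 * exp (a * W \<omega>)) ((d + a\<^sup>2 * d\<^sup>2) * exp (a\<^sup>2 * d / 2))"
proof -
  have s: "sqrt d > 0" using d by simp
  have transfer: "has_bochner_integral M (\<lambda>\<omega>. g (W \<omega>)) x"
    if "has_bochner_integral lborel (\<lambda>x. normal_density 0 (sqrt d) x * g x) x" and [measurable]: "g \<in> borel_measurable borel"
    for g :: "real \<Rightarrow> real" and x
    using that distributed_integrable[OF W, of g] distributed_integral[OF W, of g]
    by (simp add: has_bochner_integral_iff)
  have shift: "normal_density 0 (sqrt d) x * exp (a * x) = exp (a\<^sup>2 * d / 2) * normal_density (a * d) (sqrt d) x" for x
    using normal_density_exp_shift[OF s, of x a] d by simp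
  have C: "has_bochner_integral lborel (\<lambda>x. normal_density (a * d) (sqrt d) x) 1"
    using s by (simp add: has_bochner_integral_iff)
  show "has_bochner_integral M (\<lambda>\<omega>. exp (a * W \<omega>)) (exp (a\<^sup>2 * d / 2))"
    using has_bochner_integral_mult_right[OF C, of "exp (a\<^sup>2 * d / 2)"]
    by (intro transfer) (simp_all add: shift)
  have "has_bochner_integral lborel (\<lambda>x. exp (a\<^sup>2 * d / 2) * (normal_density (a * d) (sqrt d) x * x)) (exp (a\<^sup>2 * d / 2) * (a * d))"
    by (intro has_bochner_integral_mult_right normal_moment_nz_1[OF s])
  also have "(\<lambda>x. exp (a\<^sup>2 * d / 2) * (normal_density (a * d) (sqrt d) x * x)) =
     (\<lambda>x. normal_density 0 (sqrt d) x * (x * exp (a * x)))"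
  proof
    fix x
    have "exp (a\<^sup>2 * d / 2) * (normal_density (a * d) (sqrt d) x * x) = (exp (a\<^sup>2 * d / 2) * normal_density (a * d) (sqrt d) x) * x"
      by simp
    also have "\<dots> = normal_density 0 (sqrt d) x * (x * exp (a * x))"
      by (simp add: shift[symmetric])
    finally show "exp (a\<^sup>2 * d / 2) * (normal_density (a * d) (sqrt d) x * x) = normal_density 0 (sqrt d) x * (x * exp (a * x))" .
  qed
  finally show "has_bochner_integral M (\<lambda>\<omega>. W \<omega> * exp (a * W \<omega>)) (a * d * exp (a\<^sup>2 * d / 2))"
    by (intro transfer) (simp_all add: mult_ac)
  have "has_bochner_integral lborel (\<lambda>x. exp (a\<^sup>2 * d / 2) * (normal_density (a * d) (sqrt d) x * x\<^sup>2)) (exp (a\<^sup>2 * d / 2) * ((a * d)\<^sup>2 + (sqrt d)\<^sup>2))"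
    by (intro has_bochner_integral_mult_right normal_moment_two[OF s])
  also have "(\<lambda>x. exp (a\<^sup>2 * d / 2) * (normal_density (a * d) (sqrt d) x * x\<^sup>2)) =
     (\<lambda>x. normal_density 0 (sqrt d) x * (x\<^sup>2 * exp (a * x)))"
  proof
    fix x
    have "exp (a\<^sup>2 * d / 2) * (normal_density (a * d) (sqrt d) x * x\<^sup>2) = (exp (a\<^sup>2 * d / 2) * normal_density (a * d) (sqrt d) x) * x\<^sup>2"
      by simp
    also have "\<dots> = normal_density 0 (sqrt d) x * (x\<^sup>2 * exp (a * x))"
      by (simp add: shift[symmetric])
    finally show "exp (a\<^sup>2 * d / 2) * (normal_density (a * d) (sqrt d) x * x\<^sup>2) = normal_density 0 (sqrt d) x * (x\<^sup>2 * exp (a * x))" .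
  qed
  finally show "has_bochner_integral M (\<lambda>\<omega>. (W \<omega>)\<^sup>2 * exp (a * W \<omega>)) ((d + a\<^sup>2 * d\<^sup>2) * exp (a\<^sup>2 * d / 2))"
    using d by (intro transfer) (simp_all add: power2_eq_square algebra_simps)
qed

end

text \<open>The linear terms of \<open>1 + x\<close> and \<open>exp (- x)\<close> cancel in the
  product, with a remainder constant uniform on \<open>\<bar>x\<bar> \<le> b\<close>. This is how
  exact exponential moments of a step are recognised as being of second order in its length.\<close>

lemma abs_one_plus_times_exp_minus_le:
  fixes x b :: real
  assumes "\<bar>x\<bar> \<le> b"
  shows "\<bar>(1 + x) * exp (- x) - 1\<bar> \<le> x\<^sup>2 * (1 + (1 + b) * exp b)"
proof -
  define R where "R = exp (- x) - (1 - x)"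
  have "{..Suc 0} = {0, Suc 0}" by auto
  then have R: "\<bar>R\<bar> \<le> exp \<bar>x\<bar> * x\<^sup>2"
    using Taylor_exp_field[of "-x" "Suc 0"] by (simp add: R_def power2_eq_square)
  have "(1 + x) * exp (- x) - 1 = - x\<^sup>2 + (1 + x) * R"
    by (simp add: R_def power2_eq_square algebra_simps)
  also have "\<bar>\<dots>\<bar> \<le> x\<^sup>2 + \<bar>1 + x\<bar> * \<bar>R\<bar>"
    by (metis abs_mult abs_triangle_ineq abs_minus_cancel abs_of_nonneg zero_le_power2)
  also have "\<bar>1 + x\<bar> * \<bar>R\<bar> \<le> (1 + b) * (exp b * x\<^sup>2)"
    using assms R
    by (intro mult_mono order.trans[OF R] mult_right_mono) auto
  finally show ?thesis by (simp add: algebra_simps)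
qed

text \<open>
  Here \<open>m\<close> is the relative increment over a step of length \<open>d\<close> of \<open>Z\<^sub>s = exp (- \<sigma> B\<^sub>s - (\<mu> - \<sigma>\<^sup>2 / 2) s)\<close>,
  the reciprocal of geometric Brownian motion. The drift of \<open>Z\<close> is what makes both moments of
  \<open>(1 + \<mu> d + \<sigma> W) m - 1\<close> of second order.
\<close>

lemma (in prob_space) gbm_step_moments:
  fixes W :: "'a \<Rightarrow> real" and \<sigma> \<mu> d :: real
  assumes W: "distributed M lborel W (normal_density 0 (sqrt d))" and d: "d > 0"
  defines "m \<equiv> (\<lambda>\<omega>. exp (- \<sigma> * W \<omega> - (\<mu> - \<sigma>\<^sup>2 / 2) * d))"
    and "b \<equiv> \<mu> - \<sigma>\<^sup>2" and "\<kappa> \<equiv> 3 * \<sigma>\<^sup>2 - 2 * \<mu>"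
  shows "has_bochner_integral M m (exp (- b * d))"
    and "has_bochner_integral M (\<lambda>\<omega>. (m \<omega>)\<^sup>2) (exp (\<kappa> * d))"
    and "has_bochner_integral M (\<lambda>\<omega>. m \<omega> * W \<omega>) (- \<sigma> * d * exp (- b * d))"
    and "has_bochner_integral M (\<lambda>\<omega>. (m \<omega> * W \<omega>)\<^sup>2) ((d + 4 * \<sigma>\<^sup>2 * d\<^sup>2) * exp (\<kappa> * d))"
    and "has_bochner_integral M (\<lambda>\<omega>. (1 + \<mu> * d + \<sigma> * W \<omega>) * m \<omega> - 1) ((1 + b * d) * exp (- (b * d)) - 1)"
    and "has_bochner_integral M (\<lambda>\<omega>. ((1 + \<mu> * d + \<sigma> * W \<omega>) * m \<omega> - 1)\<^sup>2)
      (((1 + (- \<kappa> * d)) * exp (- (- \<kappa> * d)) - 1) +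
        (\<mu>\<^sup>2 - 4 * \<sigma>\<^sup>2 * \<mu> + 4 * \<sigma>\<^sup>2 * \<sigma>\<^sup>2) * d\<^sup>2 * exp (\<kappa> * d) - 2 * ((1 + b * d) * exp (- (b * d)) - 1))"
proof -
  define c where "c = (\<mu> - \<sigma>\<^sup>2 / 2) * d"
  note E1 = normal_exp_moments[OF W d, of "- \<sigma>"]
  note E2 = normal_exp_moments[OF W d, of "- 2 * \<sigma>"]
  have m: "m \<omega> = exp (- c) * exp (- \<sigma> * W \<omega>)" for \<omega>
    by (simp add: m_def c_def exp_add[symmetric])
  have m2: "(m \<omega>)\<^sup>2 = exp (- 2 * c) * exp (- 2 * \<sigma> * W \<omega>)" for \<omega>
    by (simp add: m power_mult_distrib exp_double[symmetric] mult.assoc)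
  have x1: "exp (- c) * exp ((- \<sigma>)\<^sup>2 * d / 2) = exp (- b * d)"
    unfolding exp_add[symmetric] by (simp add: c_def b_def field_simps)
  have x2: "exp (- 2 * c) * exp ((- 2 * \<sigma>)\<^sup>2 * d / 2) = exp (\<kappa> * d)"
    unfolding exp_add[symmetric] by (simp add: c_def \<kappa>_def field_simps)
  show 1: "has_bochner_integral M m (exp (- b * d))"
    using has_bochner_integral_mult_right[OF E1(1), of "exp (- c)"]
    unfolding x1 m[symmetric] .
  show 2: "has_bochner_integral M (\<lambda>\<omega>. (m \<omega>)\<^sup>2) (exp (\<kappa> * d))"
    using has_bochner_integral_mult_right[OF E2(1), of "exp (- 2 * c)"]
    unfolding x2 m2[symmetric] .
  show 3: "has_bochner_integral M (\<lambda>\<omega>. m \<omega> * W \<omega>) (- \<sigma> * d * exp (- b * d))"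
    using has_bochner_integral_mult_right[OF E1(2), of "exp (- c)"]
    unfolding x1[symmetric] m by (simp add: mult_ac)
  have 4: "has_bochner_integral M (\<lambda>\<omega>. (m \<omega>)\<^sup>2 * W \<omega>) (- 2 * \<sigma> * d * exp (\<kappa> * d))"
    using has_bochner_integral_mult_right[OF E2(2), of "exp (- 2 * c)"]
    unfolding x2[symmetric] m2 by (simp add: mult_ac)
  have 5: "has_bochner_integral M (\<lambda>\<omega>. (m \<omega>)\<^sup>2 * (W \<omega>)\<^sup>2) ((d + 4 * \<sigma>\<^sup>2 * d\<^sup>2) * exp (\<kappa> * d))"
    using has_bochner_integral_mult_right[OF E2(3), of "exp (- 2 * c)"]
    unfolding x2[symmetric] m2 by (simp add: mult_ac power_mult_distrib)
  then show "has_bochner_integral M (\<lambda>\<omega>. (m \<omega> * W \<omega>)\<^sup>2) ((d + 4 * \<sigma>\<^sup>2 * d\<^sup>2) * exp (\<kappa> * d))"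
    by (simp add: power_mult_distrib)
  have 0: "has_bochner_integral M (\<lambda>\<omega>. 1::real) 1"
    by (simp add: has_bochner_integral_iff prob_space)
  have "has_bochner_integral M (\<lambda>\<omega>. (1 + \<mu> * d) * m \<omega> + \<sigma> * (m \<omega> * W \<omega>) - 1)
     ((1 + \<mu> * d) * exp (- b * d) + \<sigma> * (- \<sigma> * d * exp (- b * d)) - 1)"
    by (intro has_bochner_integral_add has_bochner_integral_diff has_bochner_integral_mult_right 1 3 0)
  then show "has_bochner_integral M (\<lambda>\<omega>. (1 + \<mu> * d + \<sigma> * W \<omega>) * m \<omega> - 1) ((1 + b * d) * exp (- (b * d)) - 1)"
    by (simp add: b_def algebra_simps power2_eq_square)
  have "has_bochner_integral M (\<lambda>\<omega>. (1 + \<mu> * d)\<^sup>2 * (m \<omega>)\<^sup>2 + 2 * (1 + \<mu> * d) * \<sigma> * ((m \<omega>)\<^sup>2 * W \<omega>)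
       + \<sigma>\<^sup>2 * ((m \<omega>)\<^sup>2 * (W \<omega>)\<^sup>2) - 2 * (1 + \<mu> * d) * m \<omega> - 2 * \<sigma> * (m \<omega> * W \<omega>) + 1)
     ((1 + \<mu> * d)\<^sup>2 * exp (\<kappa> * d) + 2 * (1 + \<mu> * d) * \<sigma> * (- 2 * \<sigma> * d * exp (\<kappa> * d))
       + \<sigma>\<^sup>2 * ((d + 4 * \<sigma>\<^sup>2 * d\<^sup>2) * exp (\<kappa> * d)) - 2 * (1 + \<mu> * d) * exp (- b * d)
       - 2 * \<sigma> * (- \<sigma> * d * exp (- b * d)) + 1)"
    by (intro has_bochner_integral_add has_bochner_integral_diff has_bochner_integral_mult_right 0 1 2 3 4 5)
  also have "(\<lambda>\<omega>. (1 + \<mu> * d)\<^sup>2 * (m \<omega>)\<^sup>2 + 2 * (1 + \<mu> * d) * \<sigma> * ((m \<omega>)\<^sup>2 * W \<omega>)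
       + \<sigma>\<^sup>2 * ((m \<omega>)\<^sup>2 * (W \<omega>)\<^sup>2) - 2 * (1 + \<mu> * d) * m \<omega> - 2 * \<sigma> * (m \<omega> * W \<omega>) + 1)
      = (\<lambda>\<omega>. ((1 + \<mu> * d + \<sigma> * W \<omega>) * m \<omega> - 1)\<^sup>2)"
    by (rule ext) (simp add: power2_eq_square algebra_simps)
  \<comment> \<open>The coefficients of \<open>exp (\<kappa> * d)\<close> add up to
    \<open>1 - \<kappa> * d\<close> plus a multiple of \<open>d\<^sup>2\<close>, those of
    \<open>exp (- b * d)\<close> to \<open>- 2 * (1 + b * d)\<close>. Writing the constant 1 as
    \<open>- 1 + 2\<close> then leaves two expressions of the form
    \<open>(1 + y) * exp (- y) - 1\<close>, both of second order.\<close>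
  also have "((1 + \<mu> * d)\<^sup>2 * exp (\<kappa> * d) + 2 * (1 + \<mu> * d) * \<sigma> * (- 2 * \<sigma> * d * exp (\<kappa> * d))
       + \<sigma>\<^sup>2 * ((d + 4 * \<sigma>\<^sup>2 * d\<^sup>2) * exp (\<kappa> * d)) - 2 * (1 + \<mu> * d) * exp (- b * d)
       - 2 * \<sigma> * (- \<sigma> * d * exp (- b * d)) + 1) =
      (((1 + (- \<kappa> * d)) * exp (- (- \<kappa> * d)) - 1) +
        (\<mu>\<^sup>2 - 4 * \<sigma>\<^sup>2 * \<mu> + 4 * \<sigma>\<^sup>2 * \<sigma>\<^sup>2) * d\<^sup>2 * exp (\<kappa> * d) - 2 * ((1 + b * d) * exp (- (b * d)) - 1))"
  proof -
    define p where "p = exp (\<kappa> * d)"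
    define q where "q = exp (- b * d)"
    have "exp (- (- \<kappa> * d)) = p" "exp (- (b * d)) = q" by (simp_all add: p_def q_def)
    then show ?thesis
      unfolding p_def[symmetric] q_def[symmetric] \<kappa>_def b_def by (simp add: power2_eq_square algebra_simps)
  qed
  finally show "has_bochner_integral M (\<lambda>\<omega>. ((1 + \<mu> * d + \<sigma> * W \<omega>) * m \<omega> - 1)\<^sup>2)
      (((1 + (- \<kappa> * d)) * exp (- (- \<kappa> * d)) - 1) +
        (\<mu>\<^sup>2 - 4 * \<sigma>\<^sup>2 * \<mu> + 4 * \<sigma>\<^sup>2 * \<sigma>\<^sup>2) * d\<^sup>2 * exp (\<kappa> * d) - 2 * ((1 + b * d) * exp (- (b * d)) - 1))" .
qed

section \<open>A maximal inequality for discrete transforms\<close>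

text \<open>
  \<open>P\<close> holds outside an event of probability at most \<open>q\<close>. No measurability of \<open>P\<close> is
  required, which \<^const>\<open>measure\<close> would silently need.
\<close>

definition probably :: "'a measure \<Rightarrow> real \<Rightarrow> ('a \<Rightarrow> bool) \<Rightarrow> bool" where
  "probably M q P \<longleftrightarrow> (\<exists>A\<in>sets M. {\<omega> \<in> space M. \<not> P \<omega>} \<subseteq> A \<and> measure M A \<le> q)"

lemma probably_mono:
  assumes "probably M q P" "\<And>\<omega>. \<omega> \<in> space M \<Longrightarrow> P \<omega> \<Longrightarrow> Q \<omega>" "q \<le> q'"
  shows "probably M q' Q"
proof -
  obtain A where "A \<in> sets M" "{\<omega> \<in> space M. \<not> P \<omega>} \<subseteq> A" "measure M A \<le> q"
    using assms(1) unfolding probably_def by blast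
  then show ?thesis
    unfolding probably_def using assms(2,3) by (intro bexI[of _ A]) auto
qed

lemma AE_imp_probably:
  assumes "AE \<omega> in M. P \<omega>"
  shows "probably M 0 P"
proof -
  from AE_E[OF assms] obtain A where "{\<omega> \<in> space M. \<not> P \<omega>} \<subseteq> A" "emeasure M A = 0" "A \<in> sets M" .
  then show ?thesis
    unfolding probably_def by (intro bexI[of _ A]) (auto simp: measure_def)
qed

section \<open>Events up to small probability, and independence\<close>

context prob_space
begin

lemma probably_conj:
  assumes "probably M a P" "probably M b Q"
  shows "probably M (a + b) (\<lambda>\<omega>. P \<omega> \<and> Q \<omega>)"
proof -
  obtain A B where A: "A \<in> sets M" "{\<omega> \<in> space M. \<not> P \<omega>} \<subseteq> A" "measure M A \<le> a"
    and B: "B \<in> sets M" "{\<omega> \<in> space M. \<not> Q \<omega>} \<subseteq> B" "measure M B \<le> b"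
    using assms unfolding probably_def by blast
  have "measure M (A \<union> B) \<le> a + b"
    using measure_Un_le[OF A(1) B(1)] A B by linarith
  then show ?thesis
    unfolding probably_def using A B by (intro bexI[of _ "A \<union> B"]) auto
qed

lemma probably_ball:
  assumes "finite I" "\<And>i. i \<in> I \<Longrightarrow> probably M q (P i)"
  shows "probably M (real (card I) * q) (\<lambda>\<omega>. \<forall>i\<in>I. P i \<omega>)"
  using assms
proof (induction I rule: finite_induct)
  case empty
  then show ?case by (auto simp: probably_def intro!: bexI[of _ "{}"])
next
  case (insert i I)
  have "probably M (q + real (card I) * q) (\<lambda>\<omega>. P i \<omega> \<and> (\<forall>i\<in>I. P i \<omega>))"
    using insert by (intro probably_conj) auto
  then show ?case
    by (rule probably_mono) (use insert in \<open>auto simp: algebra_simps\<close>)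
qed

lemma probably_measurable:
  assumes "{\<omega> \<in> space M. \<not> P \<omega>} \<in> sets M" "measure M {\<omega> \<in> space M. \<not> P \<omega>} \<le> q"
  shows "probably M q P"
  using assms unfolding probably_def by blast

lemma AE_if_probably:
  assumes "\<And>q. q > 0 \<Longrightarrow> probably M q P"
  shows "AE \<omega> in M. P \<omega>"
proof -
  have "\<exists>A. A \<in> sets M \<and> {\<omega> \<in> space M. \<not> P \<omega>} \<subseteq> A \<and> measure M A \<le> 1 / real (Suc n)" for n
    using assms[of "1 / real (Suc n)"] unfolding probably_def by auto
  then obtain A where A: "\<And>n. A n \<in> sets M" "\<And>n. {\<omega> \<in> space M. \<not> P \<omega>} \<subseteq> A n"
      "\<And>n. measure M (A n) \<le> 1 / real (Suc n)"
    by metis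
  have meas: "(\<Inter>n. A n) \<in> sets M" using A by auto
  have "measure M (\<Inter>n. A n) \<le> 1 / real (Suc n)" for n
    using finite_measure_mono[of "\<Inter>n. A n" "A n"] A[of n] by (auto intro: order.trans)
  then have "measure M (\<Inter>n. A n) \<le> 0"
    by (intro LIMSEQ_le_const[OF LIMSEQ_Suc[OF lim_1_over_n]]) auto
  then have "(\<Inter>n. A n) \<in> null_sets M"
    using meas by (auto simp: null_sets_def emeasure_eq_measure measure_le_0_iff)
  then show ?thesis
    by (rule AE_I') (use A in auto)
qed

text \<open>The way from estimates in probability to an almost sure identity: for fixed \<epsilon>
  the failure event is null because \<open>q\<close> is arbitrary, and countably many values of
  \<epsilon> suffice.\<close>

lemma AE_eq_if_probably_close:
  fixes X Y :: "'a \<Rightarrow> real"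
  assumes "\<And>q \<epsilon>. q > 0 \<Longrightarrow> \<epsilon> > 0 \<Longrightarrow> probably M q (\<lambda>\<omega>. \<bar>X \<omega> - Y \<omega>\<bar> \<le> \<epsilon>)"
  shows "AE \<omega> in M. X \<omega> = Y \<omega>"
proof -
  have "AE \<omega> in M. \<forall>n. \<bar>X \<omega> - Y \<omega>\<bar> \<le> 1 / real (Suc n)"
    unfolding AE_all_countable by (intro allI AE_if_probably assms) auto
  then show ?thesis
  proof (rule AE_mp, intro AE_I2 impI)
    fix \<omega> assume *: "\<forall>n. \<bar>X \<omega> - Y \<omega>\<bar> \<le> 1 / real (Suc n)"
    have "\<bar>X \<omega> - Y \<omega>\<bar> \<le> 0"
      by (intro LIMSEQ_le_const[OF LIMSEQ_Suc[OF lim_1_over_n]]) (use * in auto)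
    then show "X \<omega> = Y \<omega>" by simp
  qed
qed

text \<open>Continuity from above of the measure, applied to the decreasing failure events. It
  trades a random constant, finite on almost every path, for a deterministic one that works with
  probability at least \<open>1 - q\<close>.\<close>

lemma probably_eventually:
  assumes P: "AE \<omega> in M. \<exists>n::nat. P n \<omega>"
    and mono: "\<And>m n \<omega>. \<omega> \<in> space M \<Longrightarrow> m \<le> n \<Longrightarrow> P m \<omega> \<Longrightarrow> P n \<omega>"
    and [measurable]: "\<And>n. {\<omega> \<in> space M. P n \<omega>} \<in> sets M" and "q > 0"
  shows "\<exists>n. probably M q (P n)"
proof -
  define A where "A n = {\<omega> \<in> space M. \<not> P n \<omega>}" for n
  have A: "A n \<in> sets M" for n
  proof -
    have "A n = space M - {\<omega> \<in> space M. P n \<omega>}" by (auto simp: A_def)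
    then show ?thesis using assms(3) by auto
  qed
  have "decseq A"
    unfolding decseq_def A_def using mono by blast
  then have "(\<lambda>n. measure M (A n)) \<longlonglongrightarrow> measure M (\<Inter>n. A n)"
    using A by (intro finite_Lim_measure_decseq) auto
  moreover have "AE \<omega> in M. \<omega> \<notin> (\<Inter>n. A n)"
    using P by eventually_elim (auto simp: A_def)
  then have "measure M (\<Inter>n. A n) = 0"
    using A by (subst prob_eq_0) auto
  ultimately have "\<forall>\<^sub>F n in sequentially. measure M (A n) < q"
    using \<open>q > 0\<close> by (metis order_tendstoD(2))
  then obtain n where "measure M (A n) < q"
    by (auto simp: eventually_sequentially)
  then show ?thesis
    using A[of n] by (intro exI[of _ n] probably_measurable) (auto simp: A_def)
qed

lemma probably_le_markov:
  fixes X :: "'a \<Rightarrow> real"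
  assumes "integrable M (\<lambda>\<omega>. (X \<omega>)\<^sup>2)" and [measurable]: "X \<in> borel_measurable M"
    and "expectation (\<lambda>\<omega>. (X \<omega>)\<^sup>2) \<le> a" "\<epsilon> > 0"
  shows "probably M (a / \<epsilon>\<^sup>2) (\<lambda>\<omega>. \<bar>X \<omega>\<bar> \<le> \<epsilon>)"
proof -
  have "measure M {\<omega> \<in> space M. \<not> \<bar>X \<omega>\<bar> \<le> \<epsilon>} \<le> measure M {\<omega> \<in> space M. \<epsilon>\<^sup>2 \<le> (X \<omega>)\<^sup>2}"
  proof (intro finite_measure_mono, safe)
    fix \<omega> assume "\<not> \<bar>X \<omega>\<bar> \<le> \<epsilon>"
    then have "\<epsilon>\<^sup>2 \<le> \<bar>X \<omega>\<bar>\<^sup>2" using assms(4) by (intro power_mono) auto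
    then show "\<epsilon>\<^sup>2 \<le> (X \<omega>)\<^sup>2" by simp
  qed measurable
  also have "\<dots> \<le> expectation (\<lambda>\<omega>. (X \<omega>)\<^sup>2) / \<epsilon>\<^sup>2"
    using assms by (intro integral_Markov_inequality_measure[where A="{}"]) auto
  also have "\<dots> \<le> a / \<epsilon>\<^sup>2"
    using assms by (intro divide_right_mono) auto
  finally show ?thesis
    by (intro probably_measurable) auto
qed

text \<open>The sigma-algebra of \<open>X\<close> lies in \<open>F\<close> and that of
  \<open>f (W \<omega>)\<close> in the one generated by \<open>W\<close>; independence passes to
  smaller families. The targets are general because the argument for conditional expectations uses
  pair-valued variables.\<close>

lemma indep_var_if_indep_set:
  assumes ind: "indep_set (sets F) (sets (vimage_algebra (space M) W borel))"
    and X: "X \<in> measurable F N" and sp: "space F = space M" and W: "W \<in> borel_measurable M"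
    and f: "f \<in> measurable borel L"
  shows "indep_var N X L (\<lambda>\<omega>. f (W \<omega>))"
proof -
  have sub: "sets F \<subseteq> events" using ind indep_setD_ev1 by blast
  have XM: "random_variable N X"
    using X sub sp by (auto simp: measurable_def)
  have fM: "random_variable L (\<lambda>\<omega>. f (W \<omega>))" using f W by measurable
  have 1: "sigma_sets (space M) {X -` A \<inter> space M | A. A \<in> sets N} \<subseteq> sets F"
    unfolding sp[symmetric] by (intro sets.sigma_sets_subset) (use X in \<open>auto simp: measurable_def\<close>)
  let ?V = "vimage_algebra (space M) W borel"
  have "(\<lambda>\<omega>. f (W \<omega>)) \<in> measurable ?V L"
    by (intro measurable_compose[OF measurable_vimage_algebra1 f]) auto
  then have "sigma_sets (space ?V) {(\<lambda>\<omega>. f (W \<omega>)) -` A \<inter> space M | A. A \<in> sets L} \<subseteq> sets ?V"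
    by (intro sets.sigma_sets_subset) (auto simp: measurable_def)
  then have 2: "sigma_sets (space M) {(\<lambda>\<omega>. f (W \<omega>)) -` A \<inter> space M | A. A \<in> sets L} \<subseteq> sets ?V"
    by simp
  show ?thesis
    unfolding indep_var_eq
    unfolding indep_sets2_eq
  proof (intro conjI ballI XM fM)
    show "sigma_sets (space M) {X -` A \<inter> space M |A. A \<in> sets N} \<subseteq> events"
      using 1 sub by (rule order.trans)
    show "sigma_sets (space M) {(\<lambda>\<omega>. f (W \<omega>)) -` A \<inter> space M |A. A \<in> sets L} \<subseteq> events"
      using 2 indep_setD_ev2[OF ind] by (rule order.trans)
  qed (use 1 2 indep_setD[OF ind] in blast)
qed

end

text \<open>Noise with a drift: the mean of \<open>v i\<close> is not zero but, like the second
  moment, of the order of the step length \<open>D i\<close>. One setting thus covers the Brownian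
  increments, with \<open>C\<close> equal to 1, and the noises that involve the inverse of geometric
  Brownian motion.\<close>

locale independent_steps = prob_space M for M :: "'a measure" +
  fixes G :: "nat \<Rightarrow> 'a measure" and v :: "nat \<Rightarrow> 'a \<Rightarrow> real" and D :: "nat \<Rightarrow> real"
    and C u :: real and N :: nat
  assumes space_G: "\<And>i. space (G i) = space M"
    and G_Suc: "\<And>i. i < N \<Longrightarrow> sets (G i) \<subseteq> sets (G (Suc i))"
    and G_sub: "\<And>i. i \<le> N \<Longrightarrow> sets (G i) \<subseteq> sets M"
    and v_meas: "\<And>i. i < N \<Longrightarrow> v i \<in> borel_measurable (G (Suc i))"
    and v_indep: "\<And>i. i < N \<Longrightarrow> indep_set (sets (G i)) (sets (vimage_algebra (space M) (v i) borel))"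
    and v_integrable: "\<And>i. i < N \<Longrightarrow> integrable M (\<lambda>\<omega>. (v i \<omega>)\<^sup>2)"
    and v_mean: "\<And>i. i < N \<Longrightarrow> \<bar>expectation (v i)\<bar> \<le> C * D i"
    and v_square: "\<And>i. i < N \<Longrightarrow> expectation (\<lambda>\<omega>. (v i \<omega>)\<^sup>2) \<le> C * D i"
    and D_pos: "\<And>i. i < N \<Longrightarrow> D i > 0"
    and D_sum: "(\<Sum>i<N. D i) \<le> u"
begin

lemma G_mono: "i \<le> j \<Longrightarrow> j \<le> N \<Longrightarrow> sets (G i) \<subseteq> sets (G j)"
proof (induction j)
  case (Suc j)
  then show ?case using G_Suc[of j] by (cases "i = Suc j") auto
qed auto

lemma measurable_G_mono:
  "f \<in> borel_measurable (G i) \<Longrightarrow> i \<le> j \<Longrightarrow> j \<le> N \<Longrightarrow> f \<in> borel_measurable (G j)"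
  using G_mono[of i j] by (auto simp: measurable_def space_G)

lemma measurable_G_M:
  "f \<in> borel_measurable (G i) \<Longrightarrow> i \<le> N \<Longrightarrow> f \<in> borel_measurable M"
  using G_sub[of i] by (auto simp: measurable_def space_G)

lemma v_random_variable: "i < N \<Longrightarrow> random_variable borel (v i)"
  using measurable_G_M[OF v_meas, of i] by auto

lemma indep_var_step:
  assumes "X \<in> borel_measurable (G i)" "i < N" "f \<in> borel_measurable borel"
  shows "indep_var borel X borel (\<lambda>\<omega>. f (v i \<omega>))"
  using indep_var_if_indep_set[OF v_indep assms(1) space_G v_random_variable assms(3)] assms(2)
  by simp

text \<open>Each \<open>v i\<close> is split into its mean and a centred part. The centred parts are
  orthogonal increments and contribute at most \<open>C * \<delta>\<close> to the second moment; for
  the means, the Cauchy-Schwarz inequality gives the pathwise bound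
  \<open>C\<^sup>2 * u * \<delta>\<close>. The factor 2 in both terms of the constant is that of the
  square of a sum.\<close>

lemma transform_square_bound:
  fixes h :: "nat \<Rightarrow> 'a \<Rightarrow> real"
  assumes h: "\<And>i. i < N \<Longrightarrow> h i \<in> borel_measurable (G i)"
    and bdd: "\<And>i. i < N \<Longrightarrow> \<exists>c. \<forall>\<omega>\<in>space M. \<bar>h i \<omega>\<bar> \<le> c"
    and sq: "\<And>\<omega>. \<omega> \<in> space M \<Longrightarrow> (\<Sum>i<N. (h i \<omega>)\<^sup>2 * D i) \<le> \<delta>"
    and "C \<ge> 0"
  shows "integrable M (\<lambda>\<omega>. (\<Sum>i<N. h i \<omega> * v i \<omega>)\<^sup>2)"
    and "expectation (\<lambda>\<omega>. (\<Sum>i<N. h i \<omega> * v i \<omega>)\<^sup>2) \<le> (2 * C + 2 * C\<^sup>2 * u) * \<delta>"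
proof -
  define w where "w = (\<lambda>i \<omega>. v i \<omega> - expectation (v i))"
  define S where "S n \<omega> = (\<Sum>i<n. h i \<omega> * w i \<omega>)" for n \<omega>
  define A where "A \<omega> = (\<Sum>i<N. h i \<omega> * expectation (v i))" for \<omega>
  note [measurable] = v_random_variable measurable_G_M[OF h]
  have hM[measurable]: "h i \<in> borel_measurable M" if "i < N" for i
    using measurable_G_M[OF h] that by auto
  have v_int: "integrable M (v i)" if "i < N" for i
    using that by (intro square_integrable_imp_integrable[OF _ v_integrable]) auto
  have h_int: "integrable M (\<lambda>\<omega>. (h i \<omega>)\<^sup>2)" if i: "i < N" for i
  proof -
    obtain c where c: "\<forall>\<omega>\<in>space M. \<bar>h i \<omega>\<bar> \<le> c" using bdd[OF i] by blast
    have "(h i \<omega>)\<^sup>2 \<le> c\<^sup>2" if "\<omega> \<in> space M" for \<omega>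
      using c that by (metis abs_ge_zero power2_abs power_mono)
    then show ?thesis using i
      by (intro integrable_const_bound[where B="c\<^sup>2"]) auto
  qed
  have w_mean: "expectation (w i) = 0" if "i < N" for i
    using v_int[OF that] by (simp add: w_def prob_space)
  have w_int: "integrable M (w i)" if "i < N" for i
    using v_int[OF that] by (simp add: w_def)
  have w2_int: "integrable M (\<lambda>\<omega>. (w i \<omega>)\<^sup>2)" if "i < N" for i
    unfolding w_def power2_diff using v_int[OF that] v_integrable[OF that]
    by (intro Bochner_Integration.integrable_add Bochner_Integration.integrable_diff) auto
  have w2: "expectation (\<lambda>\<omega>. (w i \<omega>)\<^sup>2) \<le> C * D i" if "i < N" for i
  proof -
    have "expectation (\<lambda>\<omega>. (w i \<omega>)\<^sup>2) = expectation (\<lambda>\<omega>. (v i \<omega>)\<^sup>2) - (expectation (v i))\<^sup>2"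
      unfolding w_def by (rule variance_eq[OF v_int[OF that] v_integrable[OF that]])
    then show ?thesis using v_square[OF that] zero_le_power2[of "expectation (v i)"] by linarith
  qed
  have S_step: "S n \<in> borel_measurable (G n) \<and> integrable M (\<lambda>\<omega>. (S n \<omega>)\<^sup>2) \<and>
      expectation (\<lambda>\<omega>. (S n \<omega>)\<^sup>2) \<le> C * expectation (\<lambda>\<omega>. \<Sum>i<n. (h i \<omega>)\<^sup>2 * D i)" if "n \<le> N" for n
    using that
  proof (induction n)
    case 0
    then show ?case by (auto simp: S_def)
  next
    case (Suc n)
    then have n: "n < N" by simp
    have Sm: "S n \<in> borel_measurable (G n)" and S2: "integrable M (\<lambda>\<omega>. (S n \<omega>)\<^sup>2)"
      and le: "expectation (\<lambda>\<omega>. (S n \<omega>)\<^sup>2) \<le> C * expectation (\<lambda>\<omega>. \<Sum>i<n. (h i \<omega>)\<^sup>2 * D i)"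
      using Suc by auto
    have SM[measurable]: "S n \<in> borel_measurable M" using measurable_G_M[OF Sm] n by simp
    have S_int: "integrable M (S n)" by (rule square_integrable_imp_integrable[OF SM S2])
    have eq: "S (Suc n) \<omega> = S n \<omega> + h n \<omega> * w n \<omega>" for \<omega> by (simp add: S_def)
    have meas: "S (Suc n) \<in> borel_measurable (G (Suc n))"
    proof -
      have "S n \<in> borel_measurable (G (Suc n))" "h n \<in> borel_measurable (G (Suc n))" "v n \<in> borel_measurable (G (Suc n))"
        using Sm h[OF n] v_meas[OF n] measurable_G_mono[of _ n "Suc n"] Suc.prems by auto
      then show ?thesis unfolding eq[abs_def] w_def by measurable
    qed
    obtain c where c: "\<forall>\<omega>\<in>space M. \<bar>h n \<omega>\<bar> \<le> c" using bdd[OF n] by blast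
    have hS_int: "integrable M (\<lambda>\<omega>. h n \<omega> * S n \<omega>)"
    proof (rule Bochner_Integration.integrable_bound)
      show "integrable M (\<lambda>\<omega>. c * S n \<omega>)" using S_int by simp
      show "AE \<omega> in M. norm (h n \<omega> * S n \<omega>) \<le> norm (c * S n \<omega>)"
        using c by (intro AE_I2) (fastforce simp: abs_mult intro!: mult_right_mono)
    qed (use n in measurable)
    \<comment> \<open>The cross term in the square of \<open>S (Suc n)\<close> has mean zero:
      \<open>h n * S n\<close> is known before step \<open>n\<close>, and \<open>w n\<close> is
      independent of it and centred.\<close>
    have iv1: "indep_var borel (\<lambda>\<omega>. h n \<omega> * S n \<omega>) borel (w n)"
      using indep_var_step[of "\<lambda>\<omega>. h n \<omega> * S n \<omega>" n "\<lambda>x. x - expectation (v n)"] Sm h n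
      by (simp add: w_def)
    have iv2: "indep_var borel (\<lambda>\<omega>. (h n \<omega>)\<^sup>2) borel (\<lambda>\<omega>. (w n \<omega>)\<^sup>2)"
      using indep_var_step[of "\<lambda>\<omega>. (h n \<omega>)\<^sup>2" n "\<lambda>x. (x - expectation (v n))\<^sup>2"] h n
      by (simp add: w_def)
    note I1 = indep_var_integrable[OF iv1 hS_int w_int[OF n]]
      and I2 = indep_var_integrable[OF iv2 h_int[OF n] w2_int[OF n]]
    note E1 = indep_var_lebesgue_integral[OF iv1 hS_int w_int[OF n]]
      and E2 = indep_var_lebesgue_integral[OF iv2 h_int[OF n] w2_int[OF n]]
    have sq_eq: "(\<lambda>\<omega>. (S (Suc n) \<omega>)\<^sup>2) =
        (\<lambda>\<omega>. (S n \<omega>)\<^sup>2 + 2 * (h n \<omega> * S n \<omega> * w n \<omega>) + (h n \<omega>)\<^sup>2 * (w n \<omega>)\<^sup>2)"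
      unfolding eq by (rule ext) (simp add: power2_eq_square algebra_simps)
    have int: "integrable M (\<lambda>\<omega>. (S (Suc n) \<omega>)\<^sup>2)"
      unfolding sq_eq using S2 I1 I2 by auto
    have "expectation (\<lambda>\<omega>. (S (Suc n) \<omega>)\<^sup>2) = expectation (\<lambda>\<omega>. (S n \<omega>)\<^sup>2)
        + expectation (\<lambda>\<omega>. (h n \<omega>)\<^sup>2) * expectation (\<lambda>\<omega>. (w n \<omega>)\<^sup>2)"
      unfolding sq_eq using S2 I1 I2 E1 E2 w_mean[OF n] by simp
    also have "\<dots> \<le> C * expectation (\<lambda>\<omega>. \<Sum>i<n. (h i \<omega>)\<^sup>2 * D i) + expectation (\<lambda>\<omega>. (h n \<omega>)\<^sup>2) * (C * D n)"
      by (intro add_mono le mult_left_mono w2[OF n]) auto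
    also have "\<dots> = C * expectation (\<lambda>\<omega>. \<Sum>i<Suc n. (h i \<omega>)\<^sup>2 * D i)"
    proof -
      have "expectation (\<lambda>\<omega>. \<Sum>i<k. (h i \<omega>)\<^sup>2 * D i) = (\<Sum>i<k. expectation (\<lambda>\<omega>. (h i \<omega>)\<^sup>2) * D i)"
        if "k \<le> N" for k
        using h_int that by (subst Bochner_Integration.integral_sum) auto
      from this[of n] this[of "Suc n"] show ?thesis using n by (simp add: algebra_simps)
    qed
    finally show ?case using meas int by blast
  qed
  have SN[measurable]: "S N \<in> borel_measurable M" and SN_int: "integrable M (\<lambda>\<omega>. (S N \<omega>)\<^sup>2)"
    using S_step[of N] measurable_G_M by auto
  have sq_int: "integrable M (\<lambda>\<omega>. \<Sum>i<N. (h i \<omega>)\<^sup>2 * D i)"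
    using h_int by auto
  have "expectation (\<lambda>\<omega>. \<Sum>i<N. (h i \<omega>)\<^sup>2 * D i) \<le> expectation (\<lambda>\<omega>. \<delta>)"
    using sq by (intro integral_mono sq_int) auto
  then have SN_le: "expectation (\<lambda>\<omega>. (S N \<omega>)\<^sup>2) \<le> C * \<delta>"
    using S_step[of N] \<open>C \<ge> 0\<close> by (auto simp: prob_space intro: order.trans mult_left_mono)
  have A_le: "(A \<omega>)\<^sup>2 \<le> C\<^sup>2 * u * \<delta>" if "\<omega> \<in> space M" for \<omega>
  proof -
    have "\<bar>A \<omega>\<bar> \<le> (\<Sum>i<N. \<bar>h i \<omega>\<bar> * (C * D i))"
      unfolding A_def by (rule order.trans[OF sum_abs]) (auto simp: abs_mult intro!: sum_mono mult_left_mono v_mean)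
    \<comment> \<open>The weight \<open>D i\<close> is shared equally between the two factors to
      which the Cauchy-Schwarz inequality is applied below.\<close>
    also have "\<dots> = C * (\<Sum>i<N. (\<bar>h i \<omega>\<bar> * sqrt (D i)) * sqrt (D i))"
      unfolding sum_distrib_left
    proof (intro sum.cong refl)
      fix i assume "i \<in> {..<N}"
      then have "sqrt (D i) * sqrt (D i) = D i" using D_pos[of i] by simp
      then show "\<bar>h i \<omega>\<bar> * (C * D i) = C * (\<bar>h i \<omega>\<bar> * sqrt (D i) * sqrt (D i))"
        by (metis mult.assoc mult.left_commute)
    qed
    finally have "(A \<omega>)\<^sup>2 \<le> (C * (\<Sum>i<N. (\<bar>h i \<omega>\<bar> * sqrt (D i)) * sqrt (D i)))\<^sup>2"
      by (metis abs_ge_zero power2_abs power_mono)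
    also have "\<dots> \<le> C\<^sup>2 * ((\<Sum>i<N. (\<bar>h i \<omega>\<bar> * sqrt (D i))\<^sup>2) * (\<Sum>i<N. (sqrt (D i))\<^sup>2))"
      unfolding power_mult_distrib[of C] by (intro mult_left_mono Cauchy_Schwarz_ineq_sum) auto
    also have "\<dots> = C\<^sup>2 * ((\<Sum>i<N. (h i \<omega>)\<^sup>2 * D i) * (\<Sum>i<N. D i))"
      using D_pos by (auto simp: power_mult_distrib less_imp_le)
    also have "\<dots> \<le> C\<^sup>2 * (\<delta> * u)"
      using D_pos D_sum sq[OF that]
      by (intro mult_left_mono mult_mono sum_nonneg) (auto intro!: order.trans[OF sum_nonneg sq[OF that]] simp: less_imp_le)
    finally show ?thesis by (simp add: mult_ac)
  qed
  have [measurable]: "A \<in> borel_measurable M" unfolding A_def[abs_def] by measurable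
  have A_int: "integrable M (\<lambda>\<omega>. (A \<omega>)\<^sup>2)"
    using A_le by (intro integrable_const_bound[where B="C\<^sup>2 * u * \<delta>"]) auto
  have split: "(\<Sum>i<N. h i \<omega> * v i \<omega>) = S N \<omega> + A \<omega>" for \<omega>
    unfolding S_def A_def sum.distrib[symmetric] by (intro sum.cong) (auto simp: w_def algebra_simps)
  have bnd: "(S N \<omega> + A \<omega>)\<^sup>2 \<le> 2 * (S N \<omega>)\<^sup>2 + 2 * (A \<omega>)\<^sup>2" for \<omega>
    using sum_squares_bound[of "S N \<omega>" "A \<omega>"] by (simp add: power2_sum)
  show int: "integrable M (\<lambda>\<omega>. (\<Sum>i<N. h i \<omega> * v i \<omega>)\<^sup>2)"
    unfolding split
    by (rule Bochner_Integration.integrable_bound[where f="\<lambda>\<omega>. 2 * (S N \<omega>)\<^sup>2 + 2 * (A \<omega>)\<^sup>2"])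
       (use SN_int A_int bnd in auto)
  have "expectation (\<lambda>\<omega>. (\<Sum>i<N. h i \<omega> * v i \<omega>)\<^sup>2) \<le> expectation (\<lambda>\<omega>. 2 * (S N \<omega>)\<^sup>2 + 2 * (C\<^sup>2 * u * \<delta>))"
  proof (intro integral_mono int)
    fix \<omega> assume "\<omega> \<in> space M"
    then show "(\<Sum>i<N. h i \<omega> * v i \<omega>)\<^sup>2 \<le> 2 * (S N \<omega>)\<^sup>2 + 2 * (C\<^sup>2 * u * \<delta>)"
      unfolding split using bnd[of \<omega>] A_le[of \<omega>] by linarith
  qed (use SN_int in auto)
  also have "\<dots> = 2 * expectation (\<lambda>\<omega>. (S N \<omega>)\<^sup>2) + 2 * (C\<^sup>2 * u * \<delta>)"
    using SN_int by (simp add: prob_space)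
  also have "\<dots> \<le> (2 * C + 2 * C\<^sup>2 * u) * \<delta>"
    using SN_le by (simp add: algebra_simps)
  finally show "expectation (\<lambda>\<omega>. (\<Sum>i<N. h i \<omega> * v i \<omega>)\<^sup>2) \<le> (2 * C + 2 * C\<^sup>2 * u) * \<delta>" .
qed

text \<open>
  Stopping \<open>h\<close> as soon as its quadratic sum exceeds \<open>\<delta>\<close> or the transform exceeds \<open>\<epsilon>\<close> reduces
  the maximal inequality to the second moment bound: no integrability of \<open>h\<close> is needed.
\<close>

lemma transform_maximal_inequality:
  fixes h :: "nat \<Rightarrow> 'a \<Rightarrow> real"
  assumes h: "\<And>i. i < N \<Longrightarrow> h i \<in> borel_measurable (G i)"
    and sq: "probably M q (\<lambda>\<omega>. (\<Sum>i<N. (h i \<omega>)\<^sup>2 * D i) \<le> \<delta>)"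
    and "C \<ge> 0" "\<delta> \<ge> 0" "\<epsilon> > 0"
  shows "probably M (q + (2 * C + 2 * C\<^sup>2 * u) * \<delta> / \<epsilon>\<^sup>2)
    (\<lambda>\<omega>. \<forall>n\<le>N. \<bar>\<Sum>i<n. h i \<omega> * v i \<omega>\<bar> \<le> \<epsilon>)"
proof -
  define S where "S n \<omega> = (\<Sum>i<n. h i \<omega> * v i \<omega>)" for n \<omega>
  \<comment> \<open>The quadratic sum includes the term of step \<open>i\<close>, since
    \<open>h i\<close> is known when the step begins, whereas the transform is tested only up to
    \<open>S i\<close>, which does not involve \<open>v i\<close>. So \<open>Q i\<close> is an event
    of \<open>G i\<close>, and stopping keeps \<open>k\<close> adapted.\<close>
  define Q where "Q i \<omega> \<longleftrightarrow> (\<Sum>j<Suc i. (h j \<omega>)\<^sup>2 * D j) \<le> \<delta> \<and> (\<forall>n\<in>{..i}. \<bar>S n \<omega>\<bar> \<le> \<epsilon>)" for i \<omega>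
  define k where "k i \<omega> = (if Q i \<omega> then h i \<omega> else 0)" for i \<omega>
  have Q_anti: "Q i \<omega>" if "Q j \<omega>" "i \<le> j" "j < N" for i j \<omega>
  proof -
    have "(\<Sum>l<Suc i. (h l \<omega>)\<^sup>2 * D l) \<le> (\<Sum>l<Suc j. (h l \<omega>)\<^sup>2 * D l)"
      using that D_pos by (intro sum_mono2) (auto simp: less_imp_le)
    then show ?thesis using that unfolding Q_def by force
  qed
  have k_meas: "k i \<in> borel_measurable (G i)" if "i < N" for i
  proof -
    have hj: "h j \<in> borel_measurable (G i)" if "j \<le> i" for j
      using h measurable_G_mono[of "h j" j i] that \<open>i < N\<close> by auto
    have vj: "v j \<in> borel_measurable (G i)" if "j < i" for j
      using v_meas measurable_G_mono[of "v j" "Suc j" i] that \<open>i < N\<close> by auto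
    have [measurable]: "S n \<in> borel_measurable (G i)" if "n \<in> {..i}" for n
      unfolding S_def[abs_def] using hj vj that by (intro borel_measurable_sum borel_measurable_times) auto
    have [measurable]: "(\<lambda>\<omega>. \<Sum>j<Suc i. (h j \<omega>)\<^sup>2 * D j) \<in> borel_measurable (G i)"
      using hj by (intro borel_measurable_sum borel_measurable_times borel_measurable_power) auto
    have [measurable]: "Measurable.pred (G i) (Q i)"
      unfolding Q_def[abs_def] by measurable
    show ?thesis unfolding k_def[abs_def] using hj[of i] by measurable
  qed
  have k_sq: "(\<Sum>i<n. (k i \<omega>)\<^sup>2 * D i) \<le> \<delta>" if "n \<le> N" for n \<omega>
    using that
  proof (induction n)
    case 0
    then show ?case using \<open>\<delta> \<ge> 0\<close> by simp
  next
    case (Suc n)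
    show ?case
    proof (cases "Q n \<omega>")
      case True
      then have "k i \<omega> = h i \<omega>" if "i < Suc n" for i
        using that Q_anti[OF True, of i] Suc.prems by (simp add: k_def)
      then have "(\<Sum>i<Suc n. (k i \<omega>)\<^sup>2 * D i) = (\<Sum>i<Suc n. (h i \<omega>)\<^sup>2 * D i)" by simp
      then show ?thesis using True unfolding Q_def by simp
    next
      case False
      then have "k n \<omega> = 0" by (simp add: k_def)
      then show ?thesis using Suc by simp
    qed
  qed
  \<comment> \<open>Boundedness of each \<open>k i\<close> is a by-product of stopping: a single
    term of the quadratic sum is at most \<delta>, and \<open>D i\<close> is positive.\<close>
  have k_bdd: "\<exists>c. \<forall>\<omega>\<in>space M. \<bar>k i \<omega>\<bar> \<le> c" if "i < N" for i
  proof (intro exI ballI)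
    fix \<omega>
    have "(k i \<omega>)\<^sup>2 * D i \<le> (\<Sum>i<N. (k i \<omega>)\<^sup>2 * D i)"
      using that D_pos by (intro member_le_sum) (auto simp: less_imp_le)
    also note k_sq[OF order.refl]
    finally have "(k i \<omega>)\<^sup>2 \<le> \<delta> / D i" using D_pos[OF that] by (simp add: field_simps)
    then show "\<bar>k i \<omega>\<bar> \<le> sqrt (\<delta> / D i)"
      by (metis real_sqrt_abs real_sqrt_le_iff)
  qed
  define S' where "S' \<omega> = (\<Sum>i<N. k i \<omega> * v i \<omega>)" for \<omega>
  have k_M: "k i \<in> borel_measurable M" if "i < N" for i
    using measurable_G_M[OF k_meas] that by auto
  have [measurable]: "S' \<in> borel_measurable M"
    unfolding S'_def[abs_def] using k_M v_random_variable
    by (intro borel_measurable_sum borel_measurable_times) auto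
  have "probably M ((2 * C + 2 * C\<^sup>2 * u) * \<delta> / \<epsilon>\<^sup>2) (\<lambda>\<omega>. \<bar>S' \<omega>\<bar> \<le> \<epsilon>)"
    unfolding S'_def
    using transform_square_bound[OF k_meas k_bdd k_sq[OF order.refl] \<open>C \<ge> 0\<close>] \<open>\<epsilon> > 0\<close> \<open>S' \<in> borel_measurable M\<close>
    by (intro probably_le_markov) (auto simp: S'_def[abs_def])
  from probably_conj[OF sq this] show ?thesis
  proof (rule probably_mono)
    fix \<omega> assume *: "(\<Sum>i<N. (h i \<omega>)\<^sup>2 * D i) \<le> \<delta> \<and> \<bar>S' \<omega>\<bar> \<le> \<epsilon>"
    have "\<bar>S n \<omega>\<bar> \<le> \<epsilon>" if "n \<le> N" for n
    proof (rule ccontr)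
      assume neg: "\<not> \<bar>S n \<omega>\<bar> \<le> \<epsilon>"
      \<comment> \<open>At the first index where the transform exceeds \<epsilon> in absolute value
        the stopped transform freezes. Its final value \<open>S'\<close> is then \<open>S l\<close>
        and is too large as well.\<close>
      define l where "l = (LEAST n. \<not> \<bar>S n \<omega>\<bar> \<le> \<epsilon>)"
      have l: "\<not> \<bar>S l \<omega>\<bar> \<le> \<epsilon>" "l \<le> n" "\<And>i. i < l \<Longrightarrow> \<bar>S i \<omega>\<bar> \<le> \<epsilon>"
        unfolding l_def using neg by (rule LeastI, rule Least_le) (use not_less_Least in blast)
      have "Q i \<omega>" if "i < l" for i
      proof -
        have "(\<Sum>j<Suc i. (h j \<omega>)\<^sup>2 * D j) \<le> (\<Sum>j<N. (h j \<omega>)\<^sup>2 * D j)"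
          using that l \<open>n \<le> N\<close> D_pos by (intro sum_mono2) (auto simp: less_imp_le)
        then show ?thesis using * that l unfolding Q_def by auto
      qed
      moreover have "\<not> Q i \<omega>" if "l \<le> i" for i
        using l that unfolding Q_def by auto
      ultimately have "S' \<omega> = (\<Sum>i<N. if i < l then h i \<omega> * v i \<omega> else 0)"
        unfolding S'_def k_def by (intro sum.cong) auto
      also have "\<dots> = S l \<omega>"
        unfolding S_def using l \<open>n \<le> N\<close> by (intro sum.mono_neutral_cong_right) auto
      finally show False using * l by simp
    qed
    then show "\<forall>n\<le>N. \<bar>\<Sum>i<n. h i \<omega> * v i \<omega>\<bar> \<le> \<epsilon>" by (simp add: S_def)
  qed simp
qed

end

section \<open>Brownian motion with the augmented filtration\<close>

lemma (in prob_space) indep_set_mono_right: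
  assumes "B' \<subseteq> B" "indep_set A B"
  shows "indep_set A B'"
proof -
  have "A \<subseteq> events" "B \<subseteq> events"
    using indep_setD_ev1[OF assms(2)] indep_setD_ev2[OF assms(2)] by auto
  then show ?thesis
    unfolding indep_sets2_eq using assms(1) indep_setD[OF assms(2)] by (simp add: subset_iff)
qed

section \<open>Natural and augmented filtration\<close>

lemma space_natural_filtration: "space (natural_filtration M X t) = space M"
  unfolding natural_filtration_def by (rule space_measure_of) auto

lemma sets_natural_filtration:
  "sets (natural_filtration M X t) =
     sigma_sets (space M) (\<Union>s\<in>{0..t}. {X s -` A \<inter> space M | A. A \<in> sets borel})"
  unfolding natural_filtration_def by (rule sets_measure_of) auto

lemma natural_filtration_mono:
  "s \<le> t \<Longrightarrow> sets (natural_filtration M X s) \<subseteq> sets (natural_filtration M X t)"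
  unfolding sets_natural_filtration by (intro sigma_sets_mono' UN_mono) auto

lemma measurable_natural_filtration:
  assumes "0 \<le> s" "s \<le> t"
  shows "X s \<in> borel_measurable (natural_filtration M X t)"
proof (rule measurableI)
  fix A :: "real set" assume "A \<in> sets borel"
  then show "X s -` A \<inter> space (natural_filtration M X t) \<in> sets (natural_filtration M X t)"
    unfolding sets_natural_filtration space_natural_filtration
    using assms by (intro sigma_sets.Basic UN_I[of s]) auto
qed simp

lemma subalgebra_natural_filtration:
  assumes "\<And>s. 0 \<le> s \<Longrightarrow> s \<le> t \<Longrightarrow> X s \<in> borel_measurable M"
  shows "sets (natural_filtration M X t) \<subseteq> sets M"
  unfolding sets_natural_filtration
  by (intro sets.sigma_sets_subset) (use assms in \<open>auto simp: measurable_def\<close>)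

lemma space_augmented_filtration:
  assumes "sets (F t) \<subseteq> sets M"
  shows "space (augmented_filtration M F t) = space M"
  unfolding augmented_filtration_def
  by (rule space_measure_of) (use assms sets.space_closed[of M] in \<open>auto simp: null_sets_def\<close>)

lemma sets_augmented_filtration:
  assumes "sets (F t) \<subseteq> sets M"
  shows "sets (augmented_filtration M F t) = sigma_sets (space M) (sets (F t) \<union> null_sets M)"
  unfolding augmented_filtration_def
  by (rule sets_measure_of) (use assms sets.space_closed[of M] in \<open>auto simp: null_sets_def\<close>)

text \<open>The events that agree almost everywhere with an event of \<open>F t\<close> form a
  sigma-algebra that contains \<open>F t\<close> and the null sets, hence everything these
  generate.\<close>

lemma sets_augmented_filtration_AE_eq:
  assumes "sets (F t) \<subseteq> sets M" "space (F t) = space M"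
    and "A \<in> sets (augmented_filtration M F t)"
  shows "A \<in> sets M \<and> (\<exists>A'\<in>sets (F t). AE \<omega> in M. \<omega> \<in> A \<longleftrightarrow> \<omega> \<in> A')"
  using assms(3) unfolding sets_augmented_filtration[of F, OF assms(1)]
proof (induction rule: sigma_sets.induct)
  case (Basic a)
  then show ?case
  proof
    assume "a \<in> null_sets M"
    then have "AE \<omega> in M. \<omega> \<in> a \<longleftrightarrow> \<omega> \<in> {}" by (simp add: AE_not_in)
    then show ?thesis using \<open>a \<in> null_sets M\<close> by blast
  qed (use assms(1) in auto)
next
  case Empty
  then show ?case by (auto intro!: bexI[of _ "{}"])
next
  case (Compl a)
  then obtain a' where a': "a' \<in> sets (F t)" "AE \<omega> in M. \<omega> \<in> a \<longleftrightarrow> \<omega> \<in> a'" "a \<in> sets M" by blast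
  then have "AE \<omega> in M. \<omega> \<in> space M - a \<longleftrightarrow> \<omega> \<in> space M - a'" by auto
  moreover have "space M - a' \<in> sets (F t)" using a'(1) assms(2) by (metis sets.compl_sets)
  ultimately show ?case using a'(3) by (intro conjI bexI[of _ "space M - a'"]) auto
next
  case (Union a)
  then have "\<forall>i. \<exists>a'\<in>sets (F t). AE \<omega> in M. \<omega> \<in> a i \<longleftrightarrow> \<omega> \<in> a'" by blast
  then obtain a' where a': "\<And>i. a' i \<in> sets (F t)" "\<And>i. AE \<omega> in M. \<omega> \<in> a i \<longleftrightarrow> \<omega> \<in> a' i" by metis
  have "AE \<omega> in M. \<forall>i. \<omega> \<in> a i \<longleftrightarrow> \<omega> \<in> a' i" unfolding AE_all_countable using a' by blast
  then have "AE \<omega> in M. \<omega> \<in> (\<Union>i. a i) \<longleftrightarrow> \<omega> \<in> (\<Union>i. a' i)" by auto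
  then show ?case using a'(1) Union by (intro conjI bexI[of _ "\<Union>i. a' i"]) auto
qed

locale brownian_motion = prob_space M for M :: "'a measure" +
  fixes B :: "real \<Rightarrow> 'a \<Rightarrow> real"
  assumes standard_bm: "standard_brownian_motion M B"
begin

abbreviation "NF \<equiv> natural_filtration M B"
abbreviation "AF \<equiv> augmented_filtration M NF"

lemma B_random_variable: "0 \<le> t \<Longrightarrow> random_variable borel (B t)"
  using standard_bm by (simp add: standard_brownian_motion_def)

lemma B_zero: "AE \<omega> in M. B 0 \<omega> = 0"
  using standard_bm by (simp add: standard_brownian_motion_def)

lemma B_continuous: "AE \<omega> in M. continuous_on {0..} (\<lambda>t. B t \<omega>)"
  using standard_bm by (simp add: standard_brownian_motion_def)

lemma B_increment_distributed:
  "0 \<le> s \<Longrightarrow> s < t \<Longrightarrow> distributed M lborel (\<lambda>\<omega>. B t \<omega> - B s \<omega>) (normal_density 0 (sqrt (t - s)))"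
  using standard_bm by (simp add: standard_brownian_motion_def)

lemma B_increment_indep:
  "0 \<le> s \<Longrightarrow> s < t \<Longrightarrow>
    indep_set (sets (NF s)) (sets (vimage_algebra (space M) (\<lambda>\<omega>. B t \<omega> - B s \<omega>) borel))"
  using standard_bm by (simp add: standard_brownian_motion_def)

lemma NF_sub: "sets (NF t) \<subseteq> sets M"
  by (rule subalgebra_natural_filtration) (rule B_random_variable)

lemma space_AF: "space (AF t) = space M"
  by (rule space_augmented_filtration[of NF, OF NF_sub])

lemma sets_AF: "sets (AF t) = sigma_sets (space M) (sets (NF t) \<union> null_sets M)"
  by (rule sets_augmented_filtration[of NF, OF NF_sub])

lemma AF_sub: "sets (AF t) \<subseteq> sets M"
  unfolding sets_AF using NF_sub by (intro sets.sigma_sets_subset) (auto simp: null_sets_def)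

lemma AF_mono: "s \<le> t \<Longrightarrow> sets (AF s) \<subseteq> sets (AF t)"
  unfolding sets_AF using natural_filtration_mono[of s t M B] by (intro sigma_sets_mono') auto

lemma measurable_AF_mono: "f \<in> borel_measurable (AF s) \<Longrightarrow> s \<le> t \<Longrightarrow> f \<in> borel_measurable (AF t)"
  using AF_mono[of s t] by (auto simp: measurable_def space_AF)

lemma measurable_AF_M: "f \<in> borel_measurable (AF s) \<Longrightarrow> f \<in> borel_measurable M"
  using AF_sub[of s] by (auto simp: measurable_def space_AF)

lemma B_AF: "0 \<le> s \<Longrightarrow> s \<le> t \<Longrightarrow> B s \<in> borel_measurable (AF t)"
proof -
  assume "0 \<le> s" "s \<le> t"
  from measurable_natural_filtration[OF this, of B M]
  show ?thesis unfolding measurable_def space_AF space_natural_filtration sets_AF by auto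
qed

text \<open>An event of the augmented filtration can be replaced by one of the natural filtration
  without changing the probabilities involved. The solution and the elementary integrands are only
  known to be adapted to the augmented filtration, so independence is wanted there.\<close>

lemma B_increment_indep_AF:
  assumes "0 \<le> s" "s < t"
  shows "indep_set (sets (AF s)) (sets (vimage_algebra (space M) (\<lambda>\<omega>. B t \<omega> - B s \<omega>) borel))"
  unfolding indep_sets2_eq
proof (intro conjI ballI AF_sub)
  note ind = B_increment_indep[OF assms]
  show sub: "sets (vimage_algebra (space M) (\<lambda>\<omega>. B t \<omega> - B s \<omega>) borel) \<subseteq> events"
    using indep_setD_ev2[OF ind] .
  fix a b assume a: "a \<in> sets (AF s)" and b: "b \<in> sets (vimage_algebra (space M) (\<lambda>\<omega>. B t \<omega> - B s \<omega>) borel)"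
  obtain a' where a': "a' \<in> sets (NF s)" "AE \<omega> in M. \<omega> \<in> a \<longleftrightarrow> \<omega> \<in> a'" "a \<in> sets M"
    using sets_augmented_filtration_AE_eq[of NF, OF NF_sub space_natural_filtration a] by blast
  have M: "b \<in> sets M" "a' \<in> sets M" using b sub a'(1) NF_sub by auto
  have "prob (a \<inter> b) = prob (a' \<inter> b)" "prob a = prob a'"
    using a' M by (auto intro!: measure_eq_AE)
  then show "prob (a \<inter> b) = prob a * prob b"
    using indep_setD[OF ind a'(1) b] by simp
qed

text \<open>Every noise in the proof is a function of one Brownian increment. Measurability and
  independence are settled here once for all, so that only moments remain to be checked. The
  function varies with \<open>i\<close> because it may depend on the step length.\<close>

lemma independent_increment_steps:
  fixes f :: "nat \<Rightarrow> real \<Rightarrow> real"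
  assumes "0 \<le> g 0" "\<And>i. i < N \<Longrightarrow> g i < g (Suc i)" "g N \<le> u"
    and [measurable]: "\<And>i. f i \<in> borel_measurable borel"
    and int: "\<And>i. i < N \<Longrightarrow> integrable M (\<lambda>\<omega>. (f i (B (g (Suc i)) \<omega> - B (g i) \<omega>))\<^sup>2)"
    and mean: "\<And>i. i < N \<Longrightarrow> \<bar>expectation (\<lambda>\<omega>. f i (B (g (Suc i)) \<omega> - B (g i) \<omega>))\<bar> \<le> C * (g (Suc i) - g i)"
    and sq: "\<And>i. i < N \<Longrightarrow> expectation (\<lambda>\<omega>. (f i (B (g (Suc i)) \<omega> - B (g i) \<omega>))\<^sup>2) \<le> C * (g (Suc i) - g i)"
  shows "independent_steps M (\<lambda>i. AF (g i)) (\<lambda>i \<omega>. f i (B (g (Suc i)) \<omega> - B (g i) \<omega>)) (\<lambda>i. g (Suc i) - g i) C u N"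
proof
  have mono: "g i \<le> g j" if "i \<le> j" "j \<le> N" for i j
    using that
  proof (induction j)
    case (Suc j)
    then show ?case using assms(2)[of j] by (cases "i = Suc j") auto
  qed auto
  then have pos: "0 \<le> g i" if "i \<le> N" for i using mono[of 0 i] that assms(1) by linarith
  fix i
  show "space (AF (g i)) = space M" by (rule space_AF)
  show "i \<le> N \<Longrightarrow> sets (AF (g i)) \<subseteq> events" by (rule AF_sub)
  show "(\<Sum>i<N. g (Suc i) - g i) \<le> u"
    using assms(1,3) by (simp add: sum_lessThan_telescope)
  assume i: "i < N"
  show "sets (AF (g i)) \<subseteq> sets (AF (g (Suc i)))"
    using assms(2)[OF i] by (intro AF_mono) simp
  have 1: "B (g (Suc i)) \<in> borel_measurable (AF (g (Suc i)))" "B (g i) \<in> borel_measurable (AF (g (Suc i)))"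
    using pos[of i] pos[of "Suc i"] i assms(2)[OF i] by (auto intro!: B_AF)
  then show "(\<lambda>\<omega>. f i (B (g (Suc i)) \<omega> - B (g i) \<omega>)) \<in> borel_measurable (AF (g (Suc i)))"
    by measurable
  let ?W = "\<lambda>\<omega>. B (g (Suc i)) \<omega> - B (g i) \<omega>"
  have W: "(\<lambda>\<omega>. f i (?W \<omega>)) \<in> borel_measurable (vimage_algebra (space M) ?W borel)"
    by (intro measurable_compose[OF measurable_vimage_algebra1]) auto
  have "sets (vimage_algebra (space M) (\<lambda>\<omega>. f i (?W \<omega>)) borel) \<subseteq> sets (vimage_algebra (space M) ?W borel)"
    by (rule sets_image_in_sets) (use W in auto)
  moreover have "indep_set (sets (AF (g i))) (sets (vimage_algebra (space M) ?W borel))"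
    using pos[of i] assms(2)[OF i] i by (intro B_increment_indep_AF) auto
  ultimately show "indep_set (sets (AF (g i))) (sets (vimage_algebra (space M) (\<lambda>\<omega>. f i (?W \<omega>)) borel))"
    by (rule indep_set_mono_right)
  show "integrable M (\<lambda>\<omega>. (f i (?W \<omega>))\<^sup>2)" "\<bar>expectation (\<lambda>\<omega>. f i (?W \<omega>))\<bar> \<le> C * (g (Suc i) - g i)"
    "expectation (\<lambda>\<omega>. (f i (?W \<omega>))\<^sup>2) \<le> C * (g (Suc i) - g i)" "0 < g (Suc i) - g i"
    using int[OF i] mean[OF i] sq[OF i] assms(2)[OF i] by (simp_all only: diff_gt_0_iff_gt)
qed

end

section \<open>Moment bounds uniform in the step length\<close>

definition gbm_inverse_step :: "real \<Rightarrow> real \<Rightarrow> real \<Rightarrow> real \<Rightarrow> real" where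
  "gbm_inverse_step \<sigma> \<mu> d w = exp (- \<sigma> * w - (\<mu> - \<sigma>\<^sup>2 / 2) * d)"

lemma gbm_inverse_step_measurable [measurable]: "gbm_inverse_step \<sigma> \<mu> d \<in> borel_measurable borel"
  unfolding gbm_inverse_step_def[abs_def] by measurable

text \<open>One constant serves all step lengths up to 1. The first two noises have moments of order
  \<open>d\<close>; the third one, the defect of an Euler step, has moments of order
  \<open>d\<^sup>2\<close>, and this surplus power is what later makes its contribution vanish with
  the mesh.\<close>

lemma (in prob_space) gbm_step_moment_bounds:
  fixes \<sigma> \<mu> :: real
  obtains C where "C \<ge> 0"
    and "\<And>d W. 0 < d \<Longrightarrow> d \<le> 1 \<Longrightarrow> distributed M lborel W (normal_density 0 (sqrt d)) \<Longrightarrow>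
       integrable M (\<lambda>\<omega>. (gbm_inverse_step \<sigma> \<mu> d (W \<omega>) * d)\<^sup>2) \<and>
       \<bar>expectation (\<lambda>\<omega>. gbm_inverse_step \<sigma> \<mu> d (W \<omega>) * d)\<bar> \<le> C * d \<and>
       expectation (\<lambda>\<omega>. (gbm_inverse_step \<sigma> \<mu> d (W \<omega>) * d)\<^sup>2) \<le> C * d \<and>
       integrable M (\<lambda>\<omega>. (gbm_inverse_step \<sigma> \<mu> d (W \<omega>) * W \<omega>)\<^sup>2) \<and>
       \<bar>expectation (\<lambda>\<omega>. gbm_inverse_step \<sigma> \<mu> d (W \<omega>) * W \<omega>)\<bar> \<le> C * d \<and>
       expectation (\<lambda>\<omega>. (gbm_inverse_step \<sigma> \<mu> d (W \<omega>) * W \<omega>)\<^sup>2) \<le> C * d \<and>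
       integrable M (\<lambda>\<omega>. ((1 + \<mu> * d + \<sigma> * W \<omega>) * gbm_inverse_step \<sigma> \<mu> d (W \<omega>) - 1)\<^sup>2) \<and>
       \<bar>expectation (\<lambda>\<omega>. (1 + \<mu> * d + \<sigma> * W \<omega>) * gbm_inverse_step \<sigma> \<mu> d (W \<omega>) - 1)\<bar> \<le> C * d\<^sup>2 \<and>
       expectation (\<lambda>\<omega>. ((1 + \<mu> * d + \<sigma> * W \<omega>) * gbm_inverse_step \<sigma> \<mu> d (W \<omega>) - 1)\<^sup>2) \<le> C * d\<^sup>2"
proof -
  define b where "b = \<mu> - \<sigma>\<^sup>2"
  define \<kappa> where "\<kappa> = 3 * \<sigma>\<^sup>2 - 2 * \<mu>"
  define \<theta> where "\<theta> = \<mu>\<^sup>2 - 4 * \<sigma>\<^sup>2 * \<mu> + 4 * \<sigma>\<^sup>2 * \<sigma>\<^sup>2"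
  \<comment> \<open>The remainder constant of \<open>(1 + y) * exp (- y) - 1\<close> at
    \<open>y = x * d\<close>: as \<open>d \<le> 1\<close>, the bound \<open>\<bar>x\<bar>\<close> on
    \<open>y\<close> serves all step lengths, and the factor \<open>d\<^sup>2\<close> splits
    off.\<close>
  define P where "P x = x\<^sup>2 * (1 + (1 + \<bar>x\<bar>) * exp \<bar>x\<bar>)" for x :: real
  define C where "C = (1 + \<bar>\<sigma>\<bar>) * exp \<bar>b\<bar> + (1 + 4 * \<sigma>\<^sup>2) * exp \<bar>\<kappa>\<bar> + 2 * P b + P \<kappa> + \<bar>\<theta>\<bar> * exp \<bar>\<kappa>\<bar>"
  have P0: "P x \<ge> 0" for x unfolding P_def by simp
  have parts: "(1 + \<bar>\<sigma>\<bar>) * exp \<bar>b\<bar> \<ge> 0" "(1 + 4 * \<sigma>\<^sup>2) * exp \<bar>\<kappa>\<bar> \<ge> 0" "\<bar>\<theta>\<bar> * exp \<bar>\<kappa>\<bar> \<ge> 0" by auto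
  have C0: "C \<ge> 0" unfolding C_def using P0[of b] P0[of \<kappa>] parts by linarith
  have nn: "\<bar>\<sigma>\<bar> * exp \<bar>b\<bar> \<ge> 0" "4 * \<sigma>\<^sup>2 * exp \<bar>\<kappa>\<bar> \<ge> 0" "\<bar>\<theta>\<bar> * exp \<bar>\<kappa>\<bar> \<ge> 0" by auto
  have Cge: "exp \<bar>b\<bar> \<le> C" "\<bar>\<sigma>\<bar> * exp \<bar>b\<bar> \<le> C" "exp \<bar>\<kappa>\<bar> \<le> C" "(1 + 4 * \<sigma>\<^sup>2) * exp \<bar>\<kappa>\<bar> \<le> C" "P b \<le> C"
    "P \<kappa> + \<bar>\<theta>\<bar> * exp \<bar>\<kappa>\<bar> + 2 * P b \<le> C"
    using P0[of b] P0[of \<kappa>] nn exp_gt_zero[of "\<bar>b\<bar>"] exp_gt_zero[of "\<bar>\<kappa>\<bar>"]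
    unfolding C_def distrib_right mult_1 by linarith+
  {
    fix d :: real and W :: "'a \<Rightarrow> real"
    assume d: "0 < d" "d \<le> 1" and W: "distributed M lborel W (normal_density 0 (sqrt d))"
    note mom = gbm_step_moments[OF W d(1), where \<sigma>=\<sigma> and \<mu>=\<mu>, folded b_def \<kappa>_def gbm_inverse_step_def \<theta>_def]
    note val = mom[THEN has_bochner_integral_integral_eq] and int = mom[THEN integrable.intros]
    have "x * d \<le> \<bar>x\<bar>" for x
      using mult_right_mono[OF abs_ge_self[of x], of d] mult_left_le[of d "\<bar>x\<bar>"] d by linarith
    from this[of "- b"] this[of \<kappa>]
    have eb: "exp (- b * d) \<le> exp \<bar>b\<bar>" and ek: "exp (\<kappa> * d) \<le> exp \<bar>\<kappa>\<bar>"
      by simp_all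
    have d2: "d\<^sup>2 \<le> d" using d by (simp add: power2_eq_square mult_left_le)
    have rem: "\<bar>(1 + x * d) * exp (- (x * d)) - 1\<bar> \<le> P x * d\<^sup>2" for x
    proof -
      have "\<bar>x * d\<bar> \<le> \<bar>x\<bar>" using d by (simp add: abs_mult mult_left_le)
      from abs_one_plus_times_exp_minus_le[OF this] show ?thesis
        by (simp add: P_def power_mult_distrib mult_ac)
    qed
    have "integrable M (\<lambda>\<omega>. (gbm_inverse_step \<sigma> \<mu> d (W \<omega>) * d)\<^sup>2) \<and>
       \<bar>expectation (\<lambda>\<omega>. gbm_inverse_step \<sigma> \<mu> d (W \<omega>) * d)\<bar> \<le> C * d \<and>
       expectation (\<lambda>\<omega>. (gbm_inverse_step \<sigma> \<mu> d (W \<omega>) * d)\<^sup>2) \<le> C * d \<and>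
       integrable M (\<lambda>\<omega>. (gbm_inverse_step \<sigma> \<mu> d (W \<omega>) * W \<omega>)\<^sup>2) \<and>
       \<bar>expectation (\<lambda>\<omega>. gbm_inverse_step \<sigma> \<mu> d (W \<omega>) * W \<omega>)\<bar> \<le> C * d \<and>
       expectation (\<lambda>\<omega>. (gbm_inverse_step \<sigma> \<mu> d (W \<omega>) * W \<omega>)\<^sup>2) \<le> C * d \<and>
       integrable M (\<lambda>\<omega>. ((1 + \<mu> * d + \<sigma> * W \<omega>) * gbm_inverse_step \<sigma> \<mu> d (W \<omega>) - 1)\<^sup>2) \<and>
       \<bar>expectation (\<lambda>\<omega>. (1 + \<mu> * d + \<sigma> * W \<omega>) * gbm_inverse_step \<sigma> \<mu> d (W \<omega>) - 1)\<bar> \<le> C * d\<^sup>2 \<and>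
       expectation (\<lambda>\<omega>. ((1 + \<mu> * d + \<sigma> * W \<omega>) * gbm_inverse_step \<sigma> \<mu> d (W \<omega>) - 1)\<^sup>2) \<le> C * d\<^sup>2"
    proof (intro conjI)
      show "integrable M (\<lambda>\<omega>. (gbm_inverse_step \<sigma> \<mu> d (W \<omega>) * d)\<^sup>2)"
        unfolding power_mult_distrib using int(2) by simp
      show "\<bar>expectation (\<lambda>\<omega>. gbm_inverse_step \<sigma> \<mu> d (W \<omega>) * d)\<bar> \<le> C * d"
        using val(1) d order.trans[OF eb Cge(1)] by (simp add: abs_mult)
      have "exp (\<kappa> * d) * d\<^sup>2 \<le> C * d"
        using d2 order.trans[OF ek Cge(3)] C0 by (intro mult_mono) auto
      then show "expectation (\<lambda>\<omega>. (gbm_inverse_step \<sigma> \<mu> d (W \<omega>) * d)\<^sup>2) \<le> C * d"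
        unfolding power_mult_distrib using val(2) by simp
      show "integrable M (\<lambda>\<omega>. (gbm_inverse_step \<sigma> \<mu> d (W \<omega>) * W \<omega>)\<^sup>2)"
        by (rule int(4))
      have "\<bar>\<sigma>\<bar> * exp (- b * d) * d \<le> C * d"
        using order.trans[OF mult_left_mono[OF eb abs_ge_zero] Cge(2)] d by (intro mult_right_mono) auto
      then show "\<bar>expectation (\<lambda>\<omega>. gbm_inverse_step \<sigma> \<mu> d (W \<omega>) * W \<omega>)\<bar> \<le> C * d"
        unfolding val(3) using d by (simp add: abs_mult mult_ac)
      have "(d + 4 * \<sigma>\<^sup>2 * d\<^sup>2) * exp (\<kappa> * d) \<le> (d + 4 * \<sigma>\<^sup>2 * d) * exp \<bar>\<kappa>\<bar>"
        using d d2 ek by (intro mult_mono add_left_mono mult_left_mono) auto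
      also have "\<dots> \<le> C * d" using Cge(4) d mult_right_mono[OF Cge(4), of d] by (simp add: algebra_simps)
      finally show "expectation (\<lambda>\<omega>. (gbm_inverse_step \<sigma> \<mu> d (W \<omega>) * W \<omega>)\<^sup>2) \<le> C * d"
        unfolding val(4) .
      show "integrable M (\<lambda>\<omega>. ((1 + \<mu> * d + \<sigma> * W \<omega>) * gbm_inverse_step \<sigma> \<mu> d (W \<omega>) - 1)\<^sup>2)"
        by (rule int(6))
      show "\<bar>expectation (\<lambda>\<omega>. (1 + \<mu> * d + \<sigma> * W \<omega>) * gbm_inverse_step \<sigma> \<mu> d (W \<omega>) - 1)\<bar> \<le> C * d\<^sup>2"
        unfolding val(5) by (rule order.trans[OF rem mult_right_mono[OF Cge(5)]]) simp
      have "\<theta> * d\<^sup>2 * exp (\<kappa> * d) \<le> \<bar>\<theta>\<bar> * d\<^sup>2 * exp \<bar>\<kappa>\<bar>"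
        using ek by (intro mult_mono) auto
      moreover have "P (- \<kappa>) = P \<kappa>" by (simp add: P_def)
      moreover note rem[of "- \<kappa>"] rem[of b] mult_right_mono[OF Cge(6), of "d\<^sup>2"]
      ultimately show "expectation (\<lambda>\<omega>. ((1 + \<mu> * d + \<sigma> * W \<omega>) * gbm_inverse_step \<sigma> \<mu> d (W \<omega>) - 1)\<^sup>2) \<le> C * d\<^sup>2"
        unfolding val(6) by (simp add: distrib_right distrib_left mult_ac abs_le_iff)
    qed
  }
  note bounds = this
  show ?thesis by (rule that[OF C0 bounds])
qed

section \<open>Elementary integrals\<close>

lemma finite_grid:
  fixes u :: real
  assumes "finite G" "0 \<in> G" "u \<in> G" "G \<subseteq> {0..u}"
  obtains g N where "g 0 = 0" "g N = u" "\<And>i. i < N \<Longrightarrow> g i < g (Suc i)" "g ` {..N} = G"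
proof -
  define xs where "xs = sorted_list_of_set G"
  have xs: "set xs = G" "sorted xs" "distinct xs" "length xs = card G"
    using assms(1) by (auto simp: xs_def)
  define N where "N = length xs - 1"
  have len: "length xs = Suc N"
    unfolding N_def using xs(1) assms(2) by (cases xs) auto
  have img: "(\<lambda>i. xs ! i) ` {..N} = G"
    unfolding xs(1)[symmetric] set_conv_nth len by (auto simp: less_Suc_eq_le)
  have "sorted_wrt (<) xs" unfolding xs_def by (rule strict_sorted_list_of_set)
  then have step: "xs ! i < xs ! Suc i" if "i < N" for i
    using sorted_wrt_nth_less[of "(<)" xs i "Suc i"] that len by simp
  have mono: "xs ! i \<le> xs ! j" if "i \<le> j" "j \<le> N" for i j
    using xs(2) that len by (simp add: sorted_iff_nth_mono)
  have "xs ! 0 = 0"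
  proof -
    obtain i where "i \<le> N" "xs ! i = 0" using img assms(2) by (auto simp: image_iff)
    moreover have "xs ! 0 \<in> G" using img by auto
    ultimately show ?thesis using mono[of 0 i] assms(4) by (auto intro: antisym)
  qed
  moreover have "xs ! N = u"
  proof -
    obtain i where "i \<le> N" "xs ! i = u" using img assms(3) by (auto simp: image_iff)
    moreover have "xs ! N \<in> G" using img by auto
    ultimately show ?thesis using mono[of i N] assms(4) by (auto intro: antisym)
  qed
  ultimately show ?thesis using that[of "\<lambda>i. xs ! i" N] step img by blast
qed

lemma grid_mono:
  fixes g :: "nat \<Rightarrow> real"
  assumes "\<And>i. i < N \<Longrightarrow> g i < g (Suc i)" "i \<le> j" "j \<le> N"
  shows "g i \<le> g j"
  using assms(2,3)
proof (induction j)
  case (Suc j)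
  then show ?case using assms(1)[of j] by (cases "i = Suc j") auto
qed auto

lemma grid_less_iff:
  fixes g :: "nat \<Rightarrow> real"
  assumes "\<And>i. i < N \<Longrightarrow> g i < g (Suc i)" "i \<le> N" "j \<le> N"
  shows "g i < g j \<longleftrightarrow> i < j"
proof
  assume "i < j"
  then have "g i < g (Suc i)" "g (Suc i) \<le> g j"
    using assms(1)[of i] assms(3) grid_mono[of N g "Suc i" j, OF assms(1)] by auto
  then show "g i < g j" by simp
next
  assume "g i < g j"
  then show "i < j"
    using grid_mono[of N g j i, OF assms(1)] assms(2) by (metis not_le)
qed

text \<open>
  Truncating the grid at \<open>s\<close> makes the value independent of the grid that represents the process.
\<close>

definition running_integral ::
  "(real \<Rightarrow> 'a \<Rightarrow> real) \<Rightarrow> nat \<Rightarrow> (nat \<Rightarrow> real) \<Rightarrow> (nat \<Rightarrow> 'a \<Rightarrow> real) \<Rightarrow> real \<Rightarrow> 'a \<Rightarrow> real" where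
  "running_integral B n p \<xi> s \<omega> =
     (\<Sum>j<n. \<xi> j \<omega> * (B (min (p (Suc j)) s) \<omega> - B (min (p j) s) \<omega>))"

lemma telescope_between:
  fixes x :: "nat \<Rightarrow> real"
  assumes "b \<le> c"
  shows "(\<Sum>i<a. if b \<le> i \<and> i < c then x (Suc i) - x i else 0) = x (min c a) - x (min b a)"
proof (induction a)
  case (Suc a)
  show ?case
    unfolding sum.lessThan_Suc Suc.IH
    using assms by (auto simp: min_def not_le less_Suc_eq_le intro: arg_cong[where f=x])
qed simp

text \<open>After interchanging the sums, the increments of \<open>B\<close> over those cells of
  \<open>g\<close> that lie between \<open>p j\<close> and \<open>p (Suc j)\<close> telescope for
  each \<open>j\<close>. Two elementary processes with different partitions can thus be compared as
  transforms of the same increments.\<close>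

lemma elementary_integral_on_refinement:
  fixes g :: "nat \<Rightarrow> real"
  assumes g: "\<And>i. i < N \<Longrightarrow> g i < g (Suc i)" and "a \<le> N"
    and p: "\<And>j. j < n \<Longrightarrow> p j \<le> p (Suc j)" "\<And>j. j \<le> n \<Longrightarrow> p j \<in> g ` {..N}"
  shows "(\<Sum>i<a. elementary_process n p \<xi> (g i) \<omega> * (B (g (Suc i)) \<omega> - B (g i) \<omega>)) =
    running_integral B n p \<xi> (g a) \<omega>"
proof -
  define x where "x i = B (g i) \<omega>" for i
  have inner: "(\<Sum>i<a. indicator {p j..<p (Suc j)} (g i) * (x (Suc i) - x i)) =
      B (min (p (Suc j)) (g a)) \<omega> - B (min (p j) (g a)) \<omega>" if "j < n" for j
  proof -
    obtain b c where bc: "p j = g b" "b \<le> N" "p (Suc j) = g c" "c \<le> N"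
      using p(2)[of j] p(2)[of "Suc j"] \<open>j < n\<close> by auto
    have less: "g i < g k \<longleftrightarrow> i < k" if "i \<le> N" "k \<le> N" for i k
      using grid_less_iff[of N g i k, OF g] that by blast
    then have le: "g i \<le> g k \<longleftrightarrow> i \<le> k" if "i \<le> N" "k \<le> N" for i k
      using that by (metis not_le)
    have "b \<le> c" using p(1)[OF \<open>j < n\<close>] bc le by simp
    have min_g: "min (g i) (g a) = g (min i a)" if "i \<le> N" for i
      using le[OF that \<open>a \<le> N\<close>] by (auto simp: min_def)
    have "(\<Sum>i<a. indicator {p j..<p (Suc j)} (g i) * (x (Suc i) - x i)) =
        (\<Sum>i<a. if b \<le> i \<and> i < c then x (Suc i) - x i else 0)"
      using bc less le \<open>a \<le> N\<close> by (intro sum.cong) (auto simp: indicator_def)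
    then show ?thesis
      unfolding telescope_between[OF \<open>b \<le> c\<close>] bc using bc min_g by (simp add: x_def)
  qed
  have "(\<Sum>i<a. elementary_process n p \<xi> (g i) \<omega> * (x (Suc i) - x i)) =
      (\<Sum>i<a. \<Sum>j<n. \<xi> j \<omega> * (indicator {p j..<p (Suc j)} (g i) * (x (Suc i) - x i)))"
    unfolding elementary_process_def sum_distrib_right by (simp add: mult.assoc)
  also have "\<dots> = (\<Sum>j<n. \<xi> j \<omega> * (\<Sum>i<a. indicator {p j..<p (Suc j)} (g i) * (x (Suc i) - x i)))"
    unfolding sum_distrib_left by (rule sum.swap)
  also have "\<dots> = running_integral B n p \<xi> (g a) \<omega>"
    unfolding running_integral_def by (intro sum.cong refl) (simp only: inner lessThan_iff)
  finally show ?thesis by (simp add: x_def)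
qed

lemma elementary_process_constant_on_refinement:
  fixes g :: "nat \<Rightarrow> real"
  assumes g: "\<And>i. i < N \<Longrightarrow> g i < g (Suc i)" and i: "i < N" and s: "s \<in> {g i..<g (Suc i)}"
    and p: "\<And>j. j \<le> n \<Longrightarrow> p j \<in> g ` {..N}"
  shows "elementary_process n p \<xi> s \<omega> = elementary_process n p \<xi> (g i) \<omega>"
proof -
  have *: "p j \<le> s \<longleftrightarrow> p j \<le> g i" if j: "j \<le> n" for j
  proof -
    obtain b where b: "p j = g b" "b \<le> N" using p[OF j] by auto
    show ?thesis
    proof (cases "b \<le> i")
      case True
      then show ?thesis using grid_mono[of N g b i, OF g] i s b by auto
    next
      case False
      then have "g (Suc i) \<le> g b" using grid_mono[of N g "Suc i" b, OF g] b by auto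
      then show ?thesis using s b g[OF i] by auto
    qed
  qed
  show ?thesis
    unfolding elementary_process_def
  proof (intro sum.cong refl)
    fix j assume "j \<in> {..<n}"
    then show "\<xi> j \<omega> * indicator {p j..<p (Suc j)} s = \<xi> j \<omega> * indicator {p j..<p (Suc j)} (g i)"
      using *[of j] *[of "Suc j"] by (auto simp: indicator_def not_le[symmetric])
  qed
qed

text \<open>Turns a distance in mean square over time into the quadratic sum of the maximal
  inequality: the cells are disjoint, and the step function with values \<open>c i\<close> lies
  below \<open>f\<close>.\<close>

lemma step_sum_le_nn_integral:
  fixes g c :: "nat \<Rightarrow> real"
  assumes g: "\<And>i. i < N \<Longrightarrow> g i < g (Suc i)" and "0 \<le> g 0" "g N \<le> u"
    and le: "\<And>i s. i < N \<Longrightarrow> s \<in> {g i..<g (Suc i)} \<Longrightarrow> ennreal (c i) \<le> f s"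
    and c: "\<And>i. i < N \<Longrightarrow> 0 \<le> c i"
  shows "ennreal (\<Sum>i<N. c i * (g (Suc i) - g i)) \<le> (\<integral>\<^sup>+s\<in>{0..u}. f s \<partial>lborel)"
proof -
  have "ennreal (\<Sum>i<N. c i * (g (Suc i) - g i)) = (\<Sum>i<N. ennreal (c i * (g (Suc i) - g i)))"
    using c g by (intro sum_ennreal[symmetric]) (auto simp: less_imp_le)
  also have "\<dots> = (\<Sum>i<N. \<integral>\<^sup>+s. ennreal (c i) * indicator {g i..<g (Suc i)} s \<partial>lborel)"
    using g c by (intro sum.cong refl) (auto simp: nn_integral_cmult_indicator ennreal_mult less_imp_le)
  also have "\<dots> = (\<integral>\<^sup>+s. (\<Sum>i<N. ennreal (c i) * indicator {g i..<g (Suc i)} s) \<partial>lborel)"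
    by (intro nn_integral_sum[symmetric]) auto
  also have "\<dots> \<le> (\<integral>\<^sup>+s. f s * indicator {0..u} s \<partial>lborel)"
  proof (intro nn_integral_mono)
    fix s
    show "(\<Sum>i<N. ennreal (c i) * indicator {g i..<g (Suc i)} s) \<le> f s * indicator {0..u} s"
    proof (cases "\<exists>i<N. s \<in> {g i..<g (Suc i)}")
      case True
      then obtain i where i: "i < N" "s \<in> {g i..<g (Suc i)}" by blast
      have uniq: "j = i" if "j < N" "s \<in> {g j..<g (Suc j)}" for j
      proof (rule ccontr)
        assume "j \<noteq> i"
        then consider "Suc j \<le> i" | "Suc i \<le> j" by linarith
        then show False
          using grid_mono[of N g "Suc j" i, OF g] grid_mono[of N g "Suc i" j, OF g] i that by cases auto
      qed
      have "\<forall>j\<in>{..<N} - {i}. ennreal (c j) * indicator {g j..<g (Suc j)} s = 0"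
        using uniq by (auto simp: indicator_def simp del: atLeastLessThan_iff)
      then have "(\<Sum>j<N. ennreal (c j) * indicator {g j..<g (Suc j)} s) = (\<Sum>j\<in>{i}. ennreal (c j) * indicator {g j..<g (Suc j)} s)"
        using i(1) by (intro sum.mono_neutral_right) auto
      also have "\<dots> \<le> f s" using i le[OF i] by simp
      also have "f s = f s * indicator {0..u} s"
        using i grid_mono[of N g 0 i, OF g] grid_mono[of N g "Suc i" N, OF g] assms(2,3) by (auto simp: indicator_def)
      finally show ?thesis .
    next
      case False
      then have "(\<Sum>i<N. ennreal (c i) * indicator {g i..<g (Suc i)} s) = 0"
        by (intro sum.neutral) (auto simp: indicator_def)
      then show ?thesis by simp
    qed
  qed
  finally show ?thesis .
qed

text \<open>The integrand is jointly measurable only over the time interval up to \<open>t\<close>.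
  Composing it with the projection of the line onto this interval gives a process on the whole line
  that agrees with it on the interval and can be integrated against \<open>lborel\<close>.\<close>

lemma measurable_adapted_clamp:
  assumes "measurable_adapted M F t H" "0 \<le> t"
  shows "(\<lambda>(s, \<omega>). H (max 0 (min t s)) \<omega>) \<in> borel_measurable (borel \<Otimes>\<^sub>M M)"
proof -
  have "(\<lambda>s::real. max 0 (min t s)) \<in> measurable borel (restrict_space borel {0..t})"
    using assms(2) by (intro measurable_restrict_space2) auto
  then have "(\<lambda>z. (max 0 (min t (fst z)), snd z)) \<in> measurable (borel \<Otimes>\<^sub>M M) (restrict_space borel {0..t} \<Otimes>\<^sub>M M)"
    by (intro measurable_Pair) (auto intro: measurable_compose[OF measurable_fst])
  from measurable_compose[OF this, of "\<lambda>(s, \<omega>). H s \<omega>" borel] assms(1) show ?thesis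
    by (simp add: measurable_adapted_def split_beta)
qed

lemma clamp_section_measurable:
  assumes "(\<lambda>(s, \<omega>). H (max 0 (min t s)) \<omega>) \<in> borel_measurable (borel \<Otimes>\<^sub>M M)" "\<omega> \<in> space M"
  shows "(\<lambda>s. H (max 0 (min t s)) \<omega>) \<in> borel_measurable borel"
  using measurable_compose[OF measurable_Pair2'[OF assms(2)] assms(1)] by simp

lemma elementary_process_measurable [measurable]:
  "(\<lambda>s. elementary_process n p \<xi> s \<omega>) \<in> borel_measurable borel"
  unfolding elementary_process_def by measurable

lemma elementary_dataD:
  assumes "elementary_data M F t n p \<xi>"
  shows "p 0 = 0" "p n = t" "\<And>i. i < n \<Longrightarrow> p i \<le> p (Suc i)"
    "\<And>i. i < n \<Longrightarrow> \<xi> i \<in> borel_measurable (F (p i))" "\<And>i. i \<le> n \<Longrightarrow> p i \<in> {0..t}"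
proof -
  show *: "p 0 = 0" "p n = t" "\<And>i. i < n \<Longrightarrow> p i \<le> p (Suc i)"
    "\<And>i. i < n \<Longrightarrow> \<xi> i \<in> borel_measurable (F (p i))"
    using assms by (auto simp: elementary_data_def)
  have mono: "p i \<le> p j" if "i \<le> j" "j \<le> n" for i j
    using that
  proof (induction j)
    case (Suc j)
    then show ?case using *(3)[of j] by (cases "i = Suc j") auto
  qed auto
  show "i \<le> n \<Longrightarrow> p i \<in> {0..t}" for i
    using mono[of 0 i] mono[of i n] *(1,2) by auto
qed

lemma running_integral_final:
  assumes "elementary_data M F t n p \<xi>"
  shows "running_integral B n p \<xi> t \<omega> = elementary_integral B n p \<xi> \<omega>"
proof -
  have "min (p i) t = p i" if "i \<le> n" for i
    using elementary_dataD(5)[OF assms that] by simp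
  then show ?thesis
    unfolding running_integral_def elementary_integral_def by (intro sum.cong) auto
qed

context brownian_motion
begin

lemma elementary_process_AF:
  assumes "elementary_data M AF t n p \<xi>"
  shows "elementary_process n p \<xi> s \<in> borel_measurable (AF s)"
  unfolding elementary_process_def[abs_def]
proof (intro borel_measurable_sum)
  fix i assume "i \<in> {..<n}"
  then have "\<xi> i \<in> borel_measurable (AF s)" if "p i \<le> s"
    using elementary_dataD(4)[OF assms, of i] that measurable_AF_mono by auto
  then show "(\<lambda>\<omega>. \<xi> i \<omega> * indicator {p i..<p (Suc i)} s) \<in> borel_measurable (AF s)"
    by (cases "p i \<le> s") (auto simp: indicator_def)
qed

lemma increments_independent_steps:
  assumes "0 \<le> g 0" "\<And>i. i < N \<Longrightarrow> g i < g (Suc i)" "g N \<le> u"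
  shows "independent_steps M (\<lambda>i. AF (g i)) (\<lambda>i \<omega>. B (g (Suc i)) \<omega> - B (g i) \<omega>) (\<lambda>i. g (Suc i) - g i) 1 u N"
proof (rule independent_increment_steps[where f="\<lambda>i x. x", OF assms])
  fix i assume i: "i < N"
  have "0 \<le> g i" using grid_mono[of N g 0 i, OF assms(2)] assms(1) i by simp
  note W = B_increment_distributed[OF this assms(2)[OF i]]
  have d: "g (Suc i) - g i > 0" using assms(2)[OF i] by simp
  \<comment> \<open>With exponent 0 these are the plain moments of the increment: mean zero and
    variance equal to the step length.\<close>
  note m = normal_exp_moments[OF W d, of 0]
  show "integrable M (\<lambda>\<omega>. (B (g (Suc i)) \<omega> - B (g i) \<omega>)\<^sup>2)"
    using m(3) by (simp add: has_bochner_integral_iff)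
  show "\<bar>expectation (\<lambda>\<omega>. B (g (Suc i)) \<omega> - B (g i) \<omega>)\<bar> \<le> 1 * (g (Suc i) - g i)"
    using m(2) d by (simp add: has_bochner_integral_iff)
  show "expectation (\<lambda>\<omega>. (B (g (Suc i)) \<omega> - B (g i) \<omega>)\<^sup>2) \<le> 1 * (g (Suc i) - g i)"
    using m(3) by (simp add: has_bochner_integral_iff)
qed auto

text \<open>On a common refinement of both partitions the difference of the running integrals is the
  transform of the difference of the integrands. Passing through \<open>Q\<close> bounds its
  quadratic sum by \<open>4 * \<delta>\<close>, and the maximal inequality with constant
  \<open>2 + 2 * u\<close> yields \<open>8 + 8 * u\<close>. The points of \<open>G\<close> only
  enlarge the refinement, so they do not enter the bound.\<close>

lemma running_integral_close:
  assumes ed1: "elementary_data M AF u n p \<xi>" and ed2: "elementary_data M AF s n' p' \<xi>'"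
    and "0 \<le> s" "s \<le> u" and G: "finite G" "G \<subseteq> {0..s}"
    and meas: "\<And>\<omega>. \<omega> \<in> space M \<Longrightarrow> (\<lambda>x. Q (max 0 (min u x)) \<omega>) \<in> borel_measurable borel"
    and q1: "probably M q1 (\<lambda>\<omega>. (\<integral>\<^sup>+x\<in>{0..u}. ennreal ((elementary_process n p \<xi> x \<omega> - Q x \<omega>)\<^sup>2) \<partial>lborel) \<le> ennreal \<delta>)"
    and q2: "probably M q2 (\<lambda>\<omega>. (\<integral>\<^sup>+x\<in>{0..s}. ennreal ((elementary_process n' p' \<xi>' x \<omega> - Q x \<omega>)\<^sup>2) \<partial>lborel) \<le> ennreal \<delta>)"
    and "0 \<le> \<delta>" "0 < \<epsilon>"
  shows "probably M (q1 + q2 + (8 + 8 * u) * \<delta> / \<epsilon>\<^sup>2)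
    (\<lambda>\<omega>. \<forall>x\<in>G. \<bar>running_integral B n p \<xi> x \<omega> - running_integral B n' p' \<xi>' x \<omega>\<bar> \<le> \<epsilon>)"
proof -
  define E where "E = elementary_process n p \<xi>"
  define E' where "E' = elementary_process n' p' \<xi>'"
  note D1 = elementary_dataD[OF ed1] and D2 = elementary_dataD[OF ed2]
  define G' where "G' = G \<union> p ` {..n} \<union> p' ` {..n'} \<union> {0, s, u}"
  have "G' \<subseteq> {0..u}" using D1(5) D2(5) G(2) \<open>0 \<le> s\<close> \<open>s \<le> u\<close> unfolding G'_def by force
  moreover have "finite G'" "0 \<in> G'" "u \<in> G'" using G(1) by (auto simp: G'_def)
  ultimately obtain g N where g: "g 0 = 0" "g N = u" "\<And>i. i < N \<Longrightarrow> g i < g (Suc i)" "g ` {..N} = G'"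
    using finite_grid[of G' u] by metis
  have pG: "\<And>j. j \<le> n \<Longrightarrow> p j \<in> g ` {..N}" "\<And>j. j \<le> n' \<Longrightarrow> p' j \<in> g ` {..N}" "s \<in> g ` {..N}"
    unfolding g(4) G'_def by auto
  then obtain a where a: "a \<le> N" "g a = s" by auto
  have ga: "\<And>i. i < a \<Longrightarrow> g i < g (Suc i)" using g(3) a by auto
  interpret independent_steps M "\<lambda>i. AF (g i)" "\<lambda>i \<omega>. B (g (Suc i)) \<omega> - B (g i) \<omega>" "\<lambda>i. g (Suc i) - g i" 1 u a
    by (rule increments_independent_steps) (simp_all add: g(1) ga a \<open>s \<le> u\<close>)
  define h where "h i \<omega> = E (g i) \<omega> - E' (g i) \<omega>" for i \<omega>
  have h: "h i \<in> borel_measurable (AF (g i))" for i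
    unfolding h_def[abs_def] E_def E'_def
    using elementary_process_AF[OF ed1, of "g i"] elementary_process_AF[OF ed2, of "g i"] by measurable
  have "probably M (q1 + q2) (\<lambda>\<omega>. (\<Sum>i<a. (h i \<omega>)\<^sup>2 * (g (Suc i) - g i)) \<le> 4 * \<delta>)"
  proof (rule probably_mono[OF probably_conj[OF q1 q2]])
    fix \<omega> assume \<omega>: "\<omega> \<in> space M"
    define Q' where "Q' x = Q (max 0 (min u x)) \<omega>" for x
    have [measurable]: "Q' \<in> borel_measurable borel" using meas[OF \<omega>] by (simp add: Q'_def[abs_def])
    have [measurable]: "(\<lambda>x. E x \<omega>) \<in> borel_measurable borel" "(\<lambda>x. E' x \<omega>) \<in> borel_measurable borel"
      by (auto simp: E_def E'_def)
    assume *: "(\<integral>\<^sup>+x\<in>{0..u}. ennreal ((elementary_process n p \<xi> x \<omega> - Q x \<omega>)\<^sup>2) \<partial>lborel) \<le> ennreal \<delta> \<and>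
      (\<integral>\<^sup>+x\<in>{0..s}. ennreal ((elementary_process n' p' \<xi>' x \<omega> - Q x \<omega>)\<^sup>2) \<partial>lborel) \<le> ennreal \<delta>"
    have 1: "(\<integral>\<^sup>+x\<in>{0..s}. ennreal ((E x \<omega> - Q' x)\<^sup>2) \<partial>lborel) \<le> ennreal \<delta>"
      by (rule order.trans[OF nn_integral_mono conjunct1[OF *]])
         (use \<open>s \<le> u\<close> in \<open>auto simp: Q'_def E_def indicator_def\<close>)
    have 2: "(\<integral>\<^sup>+x\<in>{0..s}. ennreal ((E' x \<omega> - Q' x)\<^sup>2) \<partial>lborel) \<le> ennreal \<delta>"
      by (rule order.trans[OF nn_integral_mono conjunct2[OF *]])
         (use \<open>s \<le> u\<close> in \<open>auto simp: Q'_def E'_def indicator_def\<close>)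
    have "ennreal (\<Sum>i<a. (h i \<omega>)\<^sup>2 * (g (Suc i) - g i)) \<le>
        (\<integral>\<^sup>+x\<in>{0..s}. (2 * ennreal ((E x \<omega> - Q' x)\<^sup>2) + 2 * ennreal ((E' x \<omega> - Q' x)\<^sup>2)) \<partial>lborel)"
    proof (rule step_sum_le_nn_integral)
      fix i x assume i: "i < a" and x: "x \<in> {g i..<g (Suc i)}"
      have "E x \<omega> = E (g i) \<omega>" "E' x \<omega> = E' (g i) \<omega>"
        unfolding E_def E'_def using i x a(1) g(3) pG(1,2)
        by (auto intro!: elementary_process_constant_on_refinement[of N g])
      then have eq: "h i \<omega> = (E x \<omega> - Q' x) - (E' x \<omega> - Q' x)" by (simp add: h_def)
      have "(y - z)\<^sup>2 \<le> 2 * y\<^sup>2 + 2 * z\<^sup>2" for y z :: real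
        using zero_le_power2[of "y + z"] by (simp add: power2_eq_square algebra_simps)
      then have "(h i \<omega>)\<^sup>2 \<le> 2 * (E x \<omega> - Q' x)\<^sup>2 + 2 * (E' x \<omega> - Q' x)\<^sup>2"
        unfolding eq .
      then have "ennreal ((h i \<omega>)\<^sup>2) \<le> ennreal (2 * (E x \<omega> - Q' x)\<^sup>2 + 2 * (E' x \<omega> - Q' x)\<^sup>2)"
        by (rule ennreal_leI)
      then show "ennreal ((h i \<omega>)\<^sup>2) \<le> 2 * ennreal ((E x \<omega> - Q' x)\<^sup>2) + 2 * ennreal ((E' x \<omega> - Q' x)\<^sup>2)"
        by (simp add: ennreal_mult)
    qed (use ga g(1) a in auto)
    also have "\<dots> = (\<integral>\<^sup>+x. 2 * (ennreal ((E x \<omega> - Q' x)\<^sup>2) * indicator {0..s} x) +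
        2 * (ennreal ((E' x \<omega> - Q' x)\<^sup>2) * indicator {0..s} x) \<partial>lborel)"
      by (simp add: distrib_right mult.assoc)
    also have "\<dots> = 2 * (\<integral>\<^sup>+x\<in>{0..s}. ennreal ((E x \<omega> - Q' x)\<^sup>2) \<partial>lborel) +
        2 * (\<integral>\<^sup>+x\<in>{0..s}. ennreal ((E' x \<omega> - Q' x)\<^sup>2) \<partial>lborel)"
      by (simp add: nn_integral_add nn_integral_cmult)
    also have "\<dots> \<le> 2 * ennreal \<delta> + 2 * ennreal \<delta>"
      using 1 2 by (intro add_mono mult_left_mono) auto
    also have "\<dots> = ennreal (4 * \<delta>)"
      using \<open>0 \<le> \<delta>\<close> by (simp add: ennreal_mult flip: distrib_right)
    finally show "(\<Sum>i<a. (h i \<omega>)\<^sup>2 * (g (Suc i) - g i)) \<le> 4 * \<delta>"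
      using \<open>0 \<le> \<delta>\<close> by simp
  qed simp
  from transform_maximal_inequality[OF h this _ _ \<open>0 < \<epsilon>\<close>] \<open>0 \<le> \<delta>\<close>
  have "probably M (q1 + q2 + (2 + 2 * u) * (4 * \<delta>) / \<epsilon>\<^sup>2)
      (\<lambda>\<omega>. \<forall>k\<le>a. \<bar>\<Sum>i<k. h i \<omega> * (B (g (Suc i)) \<omega> - B (g i) \<omega>)\<bar> \<le> \<epsilon>)"
    by simp
  then show ?thesis
  proof (rule probably_mono)
    fix \<omega> assume *: "\<forall>k\<le>a. \<bar>\<Sum>i<k. h i \<omega> * (B (g (Suc i)) \<omega> - B (g i) \<omega>)\<bar> \<le> \<epsilon>"
    show "\<forall>x\<in>G. \<bar>running_integral B n p \<xi> x \<omega> - running_integral B n' p' \<xi>' x \<omega>\<bar> \<le> \<epsilon>"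
    proof
      fix x assume "x \<in> G"
      then have "x \<in> g ` {..N}" "x \<le> s" unfolding g(4) using G(2) by (auto simp: G'_def)
      then obtain k where k: "k \<le> N" "g k = x" by auto
      have "k \<le> a"
        using grid_less_iff[of N g a k, OF g(3)] a k \<open>x \<le> s\<close> by (metis not_le)
      have "(\<Sum>i<k. h i \<omega> * (B (g (Suc i)) \<omega> - B (g i) \<omega>)) =
          running_integral B n p \<xi> (g k) \<omega> - running_integral B n' p' \<xi>' (g k) \<omega>"
        using elementary_integral_on_refinement[where g=g and N=N and a=k and n=n and p=p and \<xi>=\<xi> and B=B and \<omega>=\<omega>, OF g(3) k(1) D1(3) pG(1)]
          elementary_integral_on_refinement[where g=g and N=N and a=k and n=n' and p=p' and \<xi>=\<xi>' and B=B and \<omega>=\<omega>, OF g(3) k(1) D2(3) pG(2)]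
        by (simp add: h_def E_def E'_def left_diff_distrib sum_subtractf)
      then show "\<bar>running_integral B n p \<xi> x \<omega> - running_integral B n' p' \<xi>' x \<omega>\<bar> \<le> \<epsilon>"
        using * \<open>k \<le> a\<close> k(2) by metis
    qed
  qed (simp add: algebra_simps)
qed

end

section \<open>Approximation of the Ito integral\<close>

context brownian_motion
begin

lemma elementary_process_joint_measurable:
  assumes "elementary_data M AF t n p \<xi>"
  shows "(\<lambda>(s, \<omega>). elementary_process n p \<xi> s \<omega>) \<in> borel_measurable (borel \<Otimes>\<^sub>M M)"
proof -
  have [measurable]: "\<xi> i \<in> borel_measurable M" if "i < n" for i
    using measurable_AF_M[OF elementary_dataD(4)[OF assms that]] .
  show ?thesis
    unfolding elementary_process_def split_beta
    by (intro borel_measurable_sum borel_measurable_times) auto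
qed

lemma ito_approximant:
  assumes "has_ito_integral M AF B t H J" "0 \<le> t" "0 < \<delta>" "0 < \<epsilon>" "0 < q"
  obtains n p \<xi> where "elementary_data M AF t n p \<xi>"
    and "probably M q (\<lambda>\<omega>. (\<integral>\<^sup>+s\<in>{0..t}. ennreal ((elementary_process n p \<xi> s \<omega> - H s \<omega>)\<^sup>2) \<partial>lborel) \<le> ennreal \<delta>)"
    and "probably M q (\<lambda>\<omega>. \<bar>running_integral B n p \<xi> t \<omega> - J \<omega>\<bar> \<le> \<epsilon>)"
proof -
  have ad: "measurable_adapted M AF t H"
    using assms(1) unfolding has_ito_integral_def by blast
  from assms(1) obtain n p \<xi> where ed: "\<And>k. elementary_data M AF t (n k) (p k) (\<xi> k)"
    and L2: "\<And>\<epsilon>. \<epsilon> > 0 \<Longrightarrow> (\<lambda>k. measure M {\<omega> \<in> space M.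
           (\<integral>\<^sup>+s\<in>{0..t}. ennreal ((elementary_process (n k) (p k) (\<xi> k) s \<omega> - H s \<omega>)\<^sup>2) \<partial>lborel)
             > ennreal \<epsilon>}) \<longlonglongrightarrow> 0"
    and conv: "converges_in_probability M (\<lambda>k. elementary_integral B (n k) (p k) (\<xi> k)) J"
    unfolding has_ito_integral_def by blast
  have [measurable]: "J \<in> borel_measurable M" "\<And>k. elementary_integral B (n k) (p k) (\<xi> k) \<in> borel_measurable M"
    using conv by (auto simp: converges_in_probability_def)
  have "(\<lambda>k. measure M {\<omega> \<in> space M. \<bar>elementary_integral B (n k) (p k) (\<xi> k) \<omega> - J \<omega>\<bar> > \<epsilon>}) \<longlonglongrightarrow> 0"
    using conv \<open>0 < \<epsilon>\<close> by (auto simp: converges_in_probability_def)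
  then have "\<forall>\<^sub>F k in sequentially. measure M {\<omega> \<in> space M. \<bar>elementary_integral B (n k) (p k) (\<xi> k) \<omega> - J \<omega>\<bar> > \<epsilon>} < q"
    by (rule order_tendstoD(2)) (rule \<open>0 < q\<close>)
  moreover have "\<forall>\<^sub>F k in sequentially. measure M {\<omega> \<in> space M.
           (\<integral>\<^sup>+s\<in>{0..t}. ennreal ((elementary_process (n k) (p k) (\<xi> k) s \<omega> - H s \<omega>)\<^sup>2) \<partial>lborel) > ennreal \<delta>} < q"
    by (rule order_tendstoD(2)[OF L2[OF \<open>0 < \<delta>\<close>]]) (rule \<open>0 < q\<close>)
  ultimately have "\<forall>\<^sub>F k in sequentially. measure M {\<omega> \<in> space M. \<bar>elementary_integral B (n k) (p k) (\<xi> k) \<omega> - J \<omega>\<bar> > \<epsilon>} < q \<and>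
       measure M {\<omega> \<in> space M. (\<integral>\<^sup>+s\<in>{0..t}. ennreal ((elementary_process (n k) (p k) (\<xi> k) s \<omega> - H s \<omega>)\<^sup>2) \<partial>lborel) > ennreal \<delta>} < q"
    by (rule eventually_conj)
  then obtain k where k: "measure M {\<omega> \<in> space M. \<bar>elementary_integral B (n k) (p k) (\<xi> k) \<omega> - J \<omega>\<bar> > \<epsilon>} < q"
     "measure M {\<omega> \<in> space M. (\<integral>\<^sup>+s\<in>{0..t}. ennreal ((elementary_process (n k) (p k) (\<xi> k) s \<omega> - H s \<omega>)\<^sup>2) \<partial>lborel) > ennreal \<delta>} < q"
    unfolding eventually_sequentially by blast
  define E where "E = elementary_process (n k) (p k) (\<xi> k)"
  have [measurable]: "(\<lambda>(s, \<omega>). E s \<omega>) \<in> borel_measurable (borel \<Otimes>\<^sub>M M)"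
    unfolding E_def by (rule elementary_process_joint_measurable[OF ed])
  have [measurable]: "(\<lambda>(s, \<omega>). H (max 0 (min t s)) \<omega>) \<in> borel_measurable (borel \<Otimes>\<^sub>M M)"
    by (rule measurable_adapted_clamp[OF ad \<open>0 \<le> t\<close>])
  \<comment> \<open>A non-measurable set has measure 0 by convention. The assumed convergence of the
    distances therefore says something only once the distance is known to be a random
    variable.\<close>
  have "(\<lambda>\<omega>. \<integral>\<^sup>+s\<in>{0..t}. ennreal ((E s \<omega> - H (max 0 (min t s)) \<omega>)\<^sup>2) \<partial>lborel) \<in> borel_measurable M"
    by measurable
  also have "(\<lambda>\<omega>. \<integral>\<^sup>+s\<in>{0..t}. ennreal ((E s \<omega> - H (max 0 (min t s)) \<omega>)\<^sup>2) \<partial>lborel) =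
      (\<lambda>\<omega>. \<integral>\<^sup>+s\<in>{0..t}. ennreal ((E s \<omega> - H s \<omega>)\<^sup>2) \<partial>lborel)"
    by (intro ext nn_integral_cong) (auto simp: indicator_def)
  finally have [measurable]: "(\<lambda>\<omega>. \<integral>\<^sup>+s\<in>{0..t}. ennreal ((E s \<omega> - H s \<omega>)\<^sup>2) \<partial>lborel) \<in> borel_measurable M" .
  show thesis
  proof (rule that[OF ed[of k]])
    show "probably M q (\<lambda>\<omega>. (\<integral>\<^sup>+s\<in>{0..t}. ennreal ((elementary_process (n k) (p k) (\<xi> k) s \<omega> - H s \<omega>)\<^sup>2) \<partial>lborel) \<le> ennreal \<delta>)"
      using k(2) unfolding E_def[symmetric] by (intro probably_measurable) (auto simp: not_le)
    show "probably M q (\<lambda>\<omega>. \<bar>running_integral B (n k) (p k) (\<xi> k) t \<omega> - J \<omega>\<bar> \<le> \<epsilon>)"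
      using k(1) unfolding running_integral_final[OF ed] by (intro probably_measurable) (auto simp: not_le)
  qed
qed

text \<open>
  The hypothesis provides a separate approximating sequence for every time \<open>x\<close>. The maximal
  inequality shows that one approximant serves all times of a finite set at once, with error
  bounds that do not depend on the set.
\<close>

lemma ito_uniform_approximant:
  assumes ito: "\<And>x. x \<in> {0..u} \<Longrightarrow> has_ito_integral M AF B x H (J x)"
    and "0 \<le> u" "0 < \<delta>" "0 < \<epsilon>" "0 < q"
  obtains n p \<xi> where "elementary_data M AF u n p \<xi>"
    and "probably M q (\<lambda>\<omega>. (\<integral>\<^sup>+s\<in>{0..u}. ennreal ((elementary_process n p \<xi> s \<omega> - H s \<omega>)\<^sup>2) \<partial>lborel) \<le> ennreal \<delta>)"
    and "\<forall>G. finite G \<longrightarrow> G \<subseteq> {0..u} \<longrightarrow>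
      probably M q (\<lambda>\<omega>. \<forall>x\<in>G. \<bar>running_integral B n p \<xi> x \<omega> - J x \<omega>\<bar> \<le> \<epsilon>)"
proof -
  define c where "c = 8 + 8 * u"
  have c: "c > 0" using \<open>0 \<le> u\<close> by (simp add: c_def)
  \<comment> \<open>The mean square distance at which two approximants differ by more than
    \<open>a\<close> with probability at most \<eta>, apart from the probabilities that the distance
    bounds fail; \<open>c\<close> is the constant of that comparison.\<close>
  define tol where "tol \<eta> a = min \<delta> (\<eta> * a\<^sup>2 / c)" for \<eta> a :: real
  have tol: "0 < tol \<eta> a" "tol \<eta> a \<le> \<delta>" "c * tol \<eta> a / a\<^sup>2 \<le> \<eta>" if "0 < \<eta>" "0 < a" for \<eta> a
  proof -
    show "0 < tol \<eta> a" "tol \<eta> a \<le> \<delta>" using that c \<open>0 < \<delta>\<close> by (auto simp: tol_def)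
    have "tol \<eta> a \<le> \<eta> * a\<^sup>2 / c" by (simp add: tol_def)
    then show "c * tol \<eta> a / a\<^sup>2 \<le> \<eta>" using that c by (simp add: field_simps)
  qed
  have ad: "measurable_adapted M AF u H"
    using ito[of u] \<open>0 \<le> u\<close> unfolding has_ito_integral_def by auto
  note meas = clamp_section_measurable[OF measurable_adapted_clamp[OF ad \<open>0 \<le> u\<close>]]
  define d1 where "d1 = tol (q / 4) (\<epsilon> / 2)"
  have d1: "0 < d1" "d1 \<le> \<delta>" "c * d1 / (\<epsilon> / 2)\<^sup>2 \<le> q / 4"
    using tol[of "q / 4" "\<epsilon> / 2"] \<open>0 < \<epsilon>\<close> \<open>0 < q\<close> by (auto simp: d1_def)
  have u: "u \<in> {0..u}" and q8: "0 < q / 8" using \<open>0 \<le> u\<close> \<open>0 < q\<close> by auto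
  obtain n p \<xi> where ed: "elementary_data M AF u n p \<xi>"
    and L2: "probably M (q / 8) (\<lambda>\<omega>. (\<integral>\<^sup>+s\<in>{0..u}. ennreal ((elementary_process n p \<xi> s \<omega> - H s \<omega>)\<^sup>2) \<partial>lborel) \<le> ennreal d1)"
    and "probably M (q / 8) (\<lambda>\<omega>. \<bar>running_integral B n p \<xi> u \<omega> - J u \<omega>\<bar> \<le> \<epsilon>)"
    by (rule ito_approximant[OF ito[OF u] \<open>0 \<le> u\<close> d1(1) \<open>0 < \<epsilon>\<close> q8])
  show thesis
  proof (rule that[OF ed])
    show "probably M q (\<lambda>\<omega>. (\<integral>\<^sup>+s\<in>{0..u}. ennreal ((elementary_process n p \<xi> s \<omega> - H s \<omega>)\<^sup>2) \<partial>lborel) \<le> ennreal \<delta>)"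
      by (rule probably_mono[OF L2]) (use d1(2) \<open>0 < q\<close> in \<open>auto intro: order.trans ennreal_leI\<close>)
    show "\<forall>G. finite G \<longrightarrow> G \<subseteq> {0..u} \<longrightarrow>
      probably M q (\<lambda>\<omega>. \<forall>x\<in>G. \<bar>running_integral B n p \<xi> x \<omega> - J x \<omega>\<bar> \<le> \<epsilon>)"
    proof (intro allI impI)
    fix G :: "real set" assume G: "finite G" "G \<subseteq> {0..u}"
    \<comment> \<open>Budget: each time in \<open>G\<close> costs \<open>4 * \<eta>\<close>, three
      for the comparison and one for the limit, hence at most \<open>q / 2\<close> in total. The
      comparison with the fixed approximant costs at most \<open>q / 8 + q / 8 + q / 4\<close>.
      Adding 1 to the cardinality covers empty \<open>G\<close>.\<close>
    define m where "m = real (card G) + 1"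
    have m: "m > 0" "real (card G) \<le> m" by (auto simp: m_def)
    define \<eta> where "\<eta> = q / (8 * m)"
    have \<eta>: "0 < \<eta>" "\<eta> \<le> q / 8" "real (card G) * (4 * \<eta>) \<le> q / 2"
      using \<open>0 < q\<close> m unfolding \<eta>_def by (auto simp: field_simps m_def)
    define d2 where "d2 = min d1 (tol \<eta> (\<epsilon> / 4))"
    have d2: "0 < d2" "d2 \<le> d1" "c * d2 / (\<epsilon> / 4)\<^sup>2 \<le> \<eta>"
    proof -
      show "0 < d2" "d2 \<le> d1" using tol[of \<eta> "\<epsilon> / 4"] \<open>0 < \<epsilon>\<close> \<eta>(1) d1 by (auto simp: d2_def)
      have "c * d2 / (\<epsilon> / 4)\<^sup>2 \<le> c * tol \<eta> (\<epsilon> / 4) / (\<epsilon> / 4)\<^sup>2"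
        using c by (intro divide_right_mono mult_left_mono) (auto simp: d2_def)
      then show "c * d2 / (\<epsilon> / 4)\<^sup>2 \<le> \<eta>"
        using tol(3)[of \<eta> "\<epsilon> / 4"] \<open>0 < \<epsilon>\<close> \<eta>(1) by simp
    qed
    \<comment> \<open>A mediator that may depend on \<open>G\<close>: it is close enough to the
      integrand for a union bound over \<open>G\<close>, while its comparison with the fixed
      approximant is a single use of the maximal inequality.\<close>
    obtain n' p' \<xi>' where ed': "elementary_data M AF u n' p' \<xi>'"
      and L2': "probably M \<eta> (\<lambda>\<omega>. (\<integral>\<^sup>+s\<in>{0..u}. ennreal ((elementary_process n' p' \<xi>' s \<omega> - H s \<omega>)\<^sup>2) \<partial>lborel) \<le> ennreal d2)"
      and "probably M \<eta> (\<lambda>\<omega>. \<bar>running_integral B n' p' \<xi>' u \<omega> - J u \<omega>\<bar> \<le> \<epsilon>)"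
      by (rule ito_approximant[OF ito[OF u] \<open>0 \<le> u\<close> d2(1) \<open>0 < \<epsilon>\<close> \<eta>(1)])
    have pointwise: "probably M (4 * \<eta>) (\<lambda>\<omega>. \<bar>running_integral B n' p' \<xi>' x \<omega> - J x \<omega>\<bar> \<le> \<epsilon> / 2)" if "x \<in> G" for x
    proof -
      have x: "x \<in> {0..u}" and x0: "0 \<le> x" and \<epsilon>4: "0 < \<epsilon> / 4" using that G(2) \<open>0 < \<epsilon>\<close> by auto
      obtain n'' p'' \<xi>'' where ed'': "elementary_data M AF x n'' p'' \<xi>''"
        and L2'': "probably M \<eta> (\<lambda>\<omega>. (\<integral>\<^sup>+s\<in>{0..x}. ennreal ((elementary_process n'' p'' \<xi>'' s \<omega> - H s \<omega>)\<^sup>2) \<partial>lborel) \<le> ennreal d2)"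
        and J: "probably M \<eta> (\<lambda>\<omega>. \<bar>running_integral B n'' p'' \<xi>'' x \<omega> - J x \<omega>\<bar> \<le> \<epsilon> / 4)"
        by (rule ito_approximant[OF ito[OF x] x0 d2(1) \<epsilon>4 \<eta>(1)])
      have "probably M (\<eta> + \<eta> + c * d2 / (\<epsilon> / 4)\<^sup>2)
         (\<lambda>\<omega>. \<forall>y\<in>{x}. \<bar>running_integral B n' p' \<xi>' y \<omega> - running_integral B n'' p'' \<xi>'' y \<omega>\<bar> \<le> \<epsilon> / 4)"
        unfolding c_def
        by (rule running_integral_close[OF ed' ed'' _ _ _ _ meas L2' L2'']) (use x d2(1) \<open>0 < \<epsilon>\<close> in auto)
      from probably_conj[OF this J] show ?thesis
      proof (rule probably_mono)
        fix \<omega>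
        assume "(\<forall>y\<in>{x}. \<bar>running_integral B n' p' \<xi>' y \<omega> - running_integral B n'' p'' \<xi>'' y \<omega>\<bar> \<le> \<epsilon> / 4) \<and>
          \<bar>running_integral B n'' p'' \<xi>'' x \<omega> - J x \<omega>\<bar> \<le> \<epsilon> / 4"
        then have "\<bar>running_integral B n' p' \<xi>' x \<omega> - running_integral B n'' p'' \<xi>'' x \<omega>\<bar> \<le> \<epsilon> / 4"
          "\<bar>running_integral B n'' p'' \<xi>'' x \<omega> - J x \<omega>\<bar> \<le> \<epsilon> / 4" by auto
        then show "\<bar>running_integral B n' p' \<xi>' x \<omega> - J x \<omega>\<bar> \<le> \<epsilon> / 2" by linarith
      qed (use d2(3) in linarith)
    qed
    have A: "probably M (real (card G) * (4 * \<eta>)) (\<lambda>\<omega>. \<forall>x\<in>G. \<bar>running_integral B n' p' \<xi>' x \<omega> - J x \<omega>\<bar> \<le> \<epsilon> / 2)"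
      by (rule probably_ball[OF G(1) pointwise])
    have L2'_weak: "probably M \<eta> (\<lambda>\<omega>. (\<integral>\<^sup>+s\<in>{0..u}. ennreal ((elementary_process n' p' \<xi>' s \<omega> - H s \<omega>)\<^sup>2) \<partial>lborel) \<le> ennreal d1)"
      by (rule probably_mono[OF L2']) (use d2(2) in \<open>auto intro: order.trans ennreal_leI\<close>)
    have "probably M (q / 8 + \<eta> + c * d1 / (\<epsilon> / 2)\<^sup>2)
       (\<lambda>\<omega>. \<forall>x\<in>G. \<bar>running_integral B n p \<xi> x \<omega> - running_integral B n' p' \<xi>' x \<omega>\<bar> \<le> \<epsilon> / 2)"
      unfolding c_def
      by (rule running_integral_close[OF ed ed' _ _ _ _ meas L2 L2'_weak])
         (use \<open>0 \<le> u\<close> G d1(1) \<open>0 < \<epsilon>\<close> in auto)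
    from probably_conj[OF this A]
    show "probably M q (\<lambda>\<omega>. \<forall>x\<in>G. \<bar>running_integral B n p \<xi> x \<omega> - J x \<omega>\<bar> \<le> \<epsilon>)"
    proof (rule probably_mono)
      fix \<omega>
      assume *: "(\<forall>x\<in>G. \<bar>running_integral B n p \<xi> x \<omega> - running_integral B n' p' \<xi>' x \<omega>\<bar> \<le> \<epsilon> / 2) \<and>
         (\<forall>x\<in>G. \<bar>running_integral B n' p' \<xi>' x \<omega> - J x \<omega>\<bar> \<le> \<epsilon> / 2)"
      show "\<forall>x\<in>G. \<bar>running_integral B n p \<xi> x \<omega> - J x \<omega>\<bar> \<le> \<epsilon>"
      proof
        fix x assume "x \<in> G"
        with * have "\<bar>running_integral B n p \<xi> x \<omega> - running_integral B n' p' \<xi>' x \<omega>\<bar> \<le> \<epsilon> / 2"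
          "\<bar>running_integral B n' p' \<xi>' x \<omega> - J x \<omega>\<bar> \<le> \<epsilon> / 2" by auto
        then show "\<bar>running_integral B n p \<xi> x \<omega> - J x \<omega>\<bar> \<le> \<epsilon>" by linarith
      qed
    qed (use \<eta> d1(3) in linarith)
    qed
  qed
qed

end

section \<open>Path bounds that hold with high probability\<close>

lemma le_if_le_on_rats:
  fixes f :: "real \<Rightarrow> real"
  assumes "continuous_on UNIV f" "\<And>q::rat. f (of_rat q) \<le> c"
  shows "f x \<le> c"
proof -
  have "closed {x. f x \<le> c}"
    using assms(1) by (intro closed_Collect_le) auto
  moreover have "\<rat> \<subseteq> {x. f x \<le> c}" using assms(2) by (auto elim: Rats_cases)
  ultimately have "closure \<rat> \<subseteq> {x. f x \<le> c}" by (rule closure_minimal[rotated])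
  then show ?thesis by (auto simp: Rats_closure_real)
qed

context prob_space
begin

text \<open>A continuous path is bounded on a compact interval. Testing the bound at rational times
  makes it a measurable event, to which continuity of the measure applies; density then restores all
  times.\<close>

lemma probably_bounded_paths:
  fixes X :: "real \<Rightarrow> 'a \<Rightarrow> real"
  assumes X: "\<And>s. s \<in> {0..u} \<Longrightarrow> X s \<in> borel_measurable M"
    and cont: "AE \<omega> in M. continuous_on {0..u} (\<lambda>s. X s \<omega>)" and "0 \<le> u" "0 < q"
  shows "\<exists>n::nat. probably M q (\<lambda>\<omega>. \<forall>s\<in>{0..u}. \<bar>X s \<omega>\<bar> \<le> real n)"
proof -
  define cl where "cl x = max 0 (min u x)" for x
  have cl: "cl x \<in> {0..u}" "x \<in> {0..u} \<Longrightarrow> cl x = x" for x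
    using \<open>0 \<le> u\<close> by (auto simp: cl_def)
  have [measurable]: "X (cl x) \<in> borel_measurable M" for x
    using X cl(1) by auto
  have cl_cont: "continuous_on UNIV cl" unfolding cl_def[abs_def] by (intro continuous_intros)
  have "\<exists>n::nat. probably M (q / 2) (\<lambda>\<omega>. \<forall>r::rat. \<bar>X (cl (of_rat r)) \<omega>\<bar> \<le> real n)"
  proof (rule probably_eventually)
    show "AE \<omega> in M. \<exists>n::nat. \<forall>r::rat. \<bar>X (cl (of_rat r)) \<omega>\<bar> \<le> real n"
      using cont
    proof eventually_elim
      case (elim \<omega>)
      have "compact ((\<lambda>s. X s \<omega>) ` {0..u})"
        using elim by (intro compact_continuous_image) auto
      then obtain c where "\<forall>x\<in>(\<lambda>s. X s \<omega>) ` {0..u}. norm x \<le> c"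
        using compact_imp_bounded bounded_iff by metis
      moreover obtain n :: nat where "c \<le> real n" using real_arch_simple by blast
      ultimately have "\<bar>X (cl (of_rat r)) \<omega>\<bar> \<le> real n" for r :: rat
        using cl(1)[of "of_rat r"] by force
      then show ?case by blast
    qed
    show "(\<forall>r::rat. \<bar>X (cl (of_rat r)) \<omega>\<bar> \<le> real n)" if "m \<le> n" "\<forall>r::rat. \<bar>X (cl (of_rat r)) \<omega>\<bar> \<le> real m" for m n \<omega>
      using that by (meson of_nat_mono order.trans)
    show "{\<omega> \<in> space M. \<forall>r::rat. \<bar>X (cl (of_rat r)) \<omega>\<bar> \<le> real n} \<in> sets M" for n :: nat
      by measurable
  qed (use \<open>0 < q\<close> in simp)
  then obtain n :: nat where "probably M (q / 2) (\<lambda>\<omega>. \<forall>r::rat. \<bar>X (cl (of_rat r)) \<omega>\<bar> \<le> real n)" by blast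
  from probably_conj[OF this AE_imp_probably[OF cont]]
  show ?thesis
  proof (intro exI, rule probably_mono)
    fix \<omega>
    assume *: "(\<forall>r::rat. \<bar>X (cl (of_rat r)) \<omega>\<bar> \<le> real n) \<and> continuous_on {0..u} (\<lambda>s. X s \<omega>)"
    have "continuous_on UNIV (\<lambda>x. X (cl x) \<omega>)"
      using * cl(1) by (intro continuous_on_compose2[OF _ cl_cont]) auto
    then have "continuous_on UNIV (\<lambda>x. \<bar>X (cl x) \<omega>\<bar>)" by (rule continuous_on_rabs)
    then have "\<bar>X (cl x) \<omega>\<bar> \<le> real n" for x
      by (rule le_if_le_on_rats) (use * in blast)
    then show "\<forall>s\<in>{0..u}. \<bar>X s \<omega>\<bar> \<le> real n" using cl(2) by metis
  qed (use \<open>0 < q\<close> in simp)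
qed

text \<open>
  Uniform continuity in the form \<open>\<bar>X s - X t\<bar> \<le> \<epsilon> + n \<bar>s - t\<bar>\<close> is a closed condition
  on \<open>(s, t)\<close>, so that it can be tested on countably many pairs.
\<close>

lemma probably_uniformly_continuous_paths:
  fixes X :: "real \<Rightarrow> 'a \<Rightarrow> real"
  assumes X: "\<And>s. s \<in> {0..u} \<Longrightarrow> X s \<in> borel_measurable M"
    and cont: "AE \<omega> in M. continuous_on {0..u} (\<lambda>s. X s \<omega>)" and "0 \<le> u" "0 < q" "0 < \<epsilon>"
  shows "\<exists>n::nat. probably M q (\<lambda>\<omega>. \<forall>s\<in>{0..u}. \<forall>t\<in>{0..u}. \<bar>X s \<omega> - X t \<omega>\<bar> \<le> \<epsilon> + real n * \<bar>s - t\<bar>)"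
proof -
  define cl where "cl x = max 0 (min u x)" for x
  have cl: "cl x \<in> {0..u}" "x \<in> {0..u} \<Longrightarrow> cl x = x" for x
    using \<open>0 \<le> u\<close> by (auto simp: cl_def)
  have [measurable]: "X (cl x) \<in> borel_measurable M" for x
    using X cl(1) by auto
  have cl_cont: "continuous_on UNIV cl" unfolding cl_def[abs_def] by (intro continuous_intros)
  define P where "P n x y \<omega> \<longleftrightarrow> \<bar>X (cl x) \<omega> - X (cl y) \<omega>\<bar> \<le> \<epsilon> + real n * \<bar>cl x - cl y\<bar>" for n x y \<omega>
  have "\<exists>n. probably M (q / 2) (\<lambda>\<omega>. \<forall>r r'::rat. P n (of_rat r) (of_rat r') \<omega>)"
  proof (rule probably_eventually)
    show "AE \<omega> in M. \<exists>n. \<forall>r r'::rat. P n (of_rat r) (of_rat r') \<omega>"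
      using cont
    proof eventually_elim
      case (elim \<omega>)
      have "compact ((\<lambda>s. X s \<omega>) ` {0..u})"
        using elim by (intro compact_continuous_image) auto
      then obtain c where c: "\<forall>x\<in>(\<lambda>s. X s \<omega>) ` {0..u}. norm x \<le> c"
        using compact_imp_bounded bounded_iff by metis
      have "uniformly_continuous_on {0..u} (\<lambda>s. X s \<omega>)"
        using elim by (intro compact_uniformly_continuous) auto
      then obtain d where d: "d > 0" "\<And>s t. s \<in> {0..u} \<Longrightarrow> t \<in> {0..u} \<Longrightarrow> \<bar>t - s\<bar> < d \<Longrightarrow> \<bar>X t \<omega> - X s \<omega>\<bar> < \<epsilon>"
        unfolding uniformly_continuous_on_def dist_real_def using \<open>0 < \<epsilon>\<close> by metis
      \<comment> \<open>This slope takes care of pairs at distance at least \<open>d\<close>, where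
        only the bound \<open>2 * c\<close> on the difference is available; closer pairs are covered
        by \<epsilon>.\<close>
      obtain n :: nat where n: "2 * c / d \<le> real n" using real_arch_simple by blast
      have "P n x y \<omega>" for x y
      proof (cases "\<bar>cl x - cl y\<bar> < d")
        case True
        then have "\<bar>X (cl x) \<omega> - X (cl y) \<omega>\<bar> < \<epsilon>" using d(2)[OF cl(1) cl(1)] by blast
        moreover have "0 \<le> real n * \<bar>cl x - cl y\<bar>" by simp
        ultimately show ?thesis unfolding P_def by linarith
      next
        case False
        have "\<bar>X (cl x) \<omega>\<bar> \<le> c" "\<bar>X (cl y) \<omega>\<bar> \<le> c" using c cl(1) by auto
        moreover have "2 * c \<le> real n * d" using n d(1) by (simp add: field_simps)
        moreover have "real n * d \<le> real n * \<bar>cl x - cl y\<bar>" using False by (intro mult_left_mono) auto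
        ultimately show ?thesis unfolding P_def using \<open>0 < \<epsilon>\<close> by linarith
      qed
      then show ?case by blast
    qed
    show "\<forall>r r'::rat. P n (of_rat r) (of_rat r') \<omega>" if "m \<le> n" "\<forall>r r'::rat. P m (of_rat r) (of_rat r') \<omega>" for m n \<omega>
    proof -
      have "real m * \<bar>x\<bar> \<le> real n * \<bar>x\<bar>" for x using that(1) by (intro mult_right_mono) auto
      then show ?thesis using that(2) unfolding P_def by (meson add_left_mono order.trans)
    qed
    show "{\<omega> \<in> space M. \<forall>r r'::rat. P n (of_rat r) (of_rat r') \<omega>} \<in> sets M" for n
      unfolding P_def by measurable
  qed (use \<open>0 < q\<close> in simp)
  then obtain n where "probably M (q / 2) (\<lambda>\<omega>. \<forall>r r'::rat. P n (of_rat r) (of_rat r') \<omega>)" by blast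
  from probably_conj[OF this AE_imp_probably[OF cont]]
  show ?thesis
  proof (intro exI, rule probably_mono)
    fix \<omega>
    assume *: "(\<forall>r r'::rat. P n (of_rat r) (of_rat r') \<omega>) \<and> continuous_on {0..u} (\<lambda>s. X s \<omega>)"
    have XC: "continuous_on UNIV (\<lambda>x. X (cl x) \<omega>)"
      using * cl(1) by (intro continuous_on_compose2[OF _ cl_cont]) auto
    define f where "f x y = \<bar>X (cl x) \<omega> - X (cl y) \<omega>\<bar> - real n * \<bar>cl x - cl y\<bar>" for x y
    have fP: "f x y \<le> \<epsilon> \<longleftrightarrow> P n x y \<omega>" for x y unfolding f_def P_def by linarith
    have cf: "continuous_on UNIV (\<lambda>x. f x y)" "continuous_on UNIV (\<lambda>y. f x y)" for x y
      unfolding f_def using XC cl_cont by (intro continuous_intros; simp)+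
    have "f x (of_rat r) \<le> \<epsilon>" for x and r :: rat
      by (rule le_if_le_on_rats[OF cf(1)]) (use * fP in blast)
    then have "f x y \<le> \<epsilon>" for x y
      by (rule le_if_le_on_rats[OF cf(2)])
    then have "P n x y \<omega>" for x y by (simp add: fP)
    then show "\<forall>s\<in>{0..u}. \<forall>t\<in>{0..u}. \<bar>X s \<omega> - X t \<omega>\<bar> \<le> \<epsilon> + real n * \<bar>s - t\<bar>"
      unfolding P_def using cl(2) by metis
  qed (use \<open>0 < q\<close> in simp)
qed

end

section \<open>Uniqueness for geometric Brownian motion\<close>

text \<open>The given points are joined to the multiples of a step \<open>h \<le> D\<close> that
  divides \<open>u\<close>. The first multiple of \<open>h\<close> beyond \<open>g i\<close> belongs
  to the grid and is at most \<open>h\<close> away, so the next grid point is no farther.\<close>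

lemma fine_grid:
  fixes u :: real
  assumes "finite P" "P \<subseteq> {0..u}" "0 < u" "0 < D"
  obtains g N where "g 0 = 0" "g N = u" "\<And>i. i < N \<Longrightarrow> g i < g (Suc i)" "P \<subseteq> g ` {..N}"
    "\<And>i. i < N \<Longrightarrow> g (Suc i) - g i \<le> D"
proof -
  obtain K :: nat where K: "u / D < real K" using reals_Archimedean2 by blast
  have "0 < u / D" using assms by simp
  then have K0: "0 < real K" using K by linarith
  define h where "h = u / real K"
  have h: "0 < h" "h \<le> D" "real K * h = u"
    using assms K K0 by (auto simp: h_def field_simps)
  define G where "G = P \<union> (\<lambda>i. real i * h) ` {..K} \<union> {0, u}"
  have "real i * h \<le> u" if "i \<le> K" for i
    using that h by (metis h(3) less_imp_le mult_right_mono of_nat_mono)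
  then have "G \<subseteq> {0..u}" using assms h(1) by (auto simp: G_def)
  moreover have "finite G" "0 \<in> G" "u \<in> G" using assms by (auto simp: G_def)
  ultimately obtain g N where g: "g 0 = 0" "g N = u" "\<And>i. i < N \<Longrightarrow> g i < g (Suc i)" "g ` {..N} = G"
    using finite_grid[of G u] by metis
  have "g (Suc i) - g i \<le> D" if i: "i < N" for i
  proof -
    have gi: "0 \<le> g i" "g i < u"
      using grid_mono[of N g 0 i, OF g(3)] grid_mono[of N g "Suc i" N, OF g(3)] g(1,2) g(3)[OF i] i by auto
    define k where "k = nat \<lfloor>g i / h\<rfloor>"
    have "0 \<le> g i / h" using gi h(1) by simp
    then have "real k \<le> g i / h" "g i / h < real k + 1"
      unfolding k_def by linarith+
    then have k: "real k * h \<le> g i" "g i < real (Suc k) * h"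
      using h(1) by (auto simp: field_simps)
    have "real k * h < real K * h" using k(1) gi(2) h(3) by linarith
    then have "Suc k \<le> K" using h(1) by simp
    then have "real (Suc k) * h \<in> g ` {..N}" unfolding g(4) G_def by blast
    then obtain l where l: "l \<le> N" "real (Suc k) * h = g l" by auto
    have "i < l" using grid_less_iff[of N g i l, OF g(3)] i l k(2) by auto
    then have "g (Suc i) \<le> g l" using grid_mono[of N g "Suc i" l, OF g(3)] l(1) by auto
    also have "g l = real k * h + h" using l(2) by (simp add: algebra_simps)
    finally show ?thesis using k(1) h(2) by linarith
  qed
  then show ?thesis using that[of g N] g by (auto simp: G_def)
qed

text \<open>On each cell the left endpoint rule errs by at most \<rho> times the length of the cell,
  and these errors add up. The induction uses the Henstock-Kurzweil integral to combine adjacent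
  intervals; the set integral is recovered at the end.\<close>

lemma riemann_sum_error:
  fixes f :: "real \<Rightarrow> real"
  assumes g: "\<And>i. i < N \<Longrightarrow> g i < g (Suc i)" and g0: "g 0 = 0" and "a \<le> N"
    and cont: "continuous_on {0..g N} f"
    and close: "\<And>i s. i < N \<Longrightarrow> s \<in> {g i..g (Suc i)} \<Longrightarrow> \<bar>f s - f (g i)\<bar> \<le> \<rho>"
  shows "\<bar>(LINT s:{0..g a}|lborel. f s) - (\<Sum>j<a. f (g j) * (g (Suc j) - g j))\<bar> \<le> \<rho> * g a"
proof -
  have cont': "continuous_on {x..y} f" if "0 \<le> x" "y \<le> g N" for x y
    by (rule continuous_on_subset[OF cont]) (use that in auto)
  have mono: "g i \<le> g j" if "i \<le> j" "j \<le> N" for i j by (rule grid_mono[of N g i j, OF g that])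
  have pos: "0 \<le> g i" if "i \<le> N" for i using mono[of 0 i] that g0 by simp
  have "\<bar>integral {0..g a} f - (\<Sum>j<a. f (g j) * (g (Suc j) - g j))\<bar> \<le> \<rho> * g a"
    using \<open>a \<le> N\<close>
  proof (induction a)
    case 0
    then show ?case by (simp add: g0)
  next
    case (Suc a)
    then have a: "a < N" by simp
    have split: "integral {0..g (Suc a)} f = integral {0..g a} f + integral {g a..g (Suc a)} f"
      using pos[of a] g[OF a] mono[of "Suc a" N] a
      by (intro Henstock_Kurzweil_Integration.integral_combine[symmetric] integrable_continuous_real cont') auto
    have ci: "continuous_on {g a..g (Suc a)} f"
      using pos[of a] mono[of "Suc a" N] a by (intro cont') auto
    have "norm (integral {g a..g (Suc a)} (\<lambda>s. f s - f (g a))) \<le> \<rho> * (g (Suc a) - g a)"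
      using g[OF a] close[OF a] by (intro integral_bound continuous_intros ci) auto
    also have "integral {g a..g (Suc a)} (\<lambda>s. f s - f (g a)) =
        integral {g a..g (Suc a)} f - f (g a) * (g (Suc a) - g a)"
      using g[OF a] by (subst Henstock_Kurzweil_Integration.integral_diff) (auto intro!: integrable_continuous_real ci)
    finally show ?case using Suc.IH a unfolding split by (simp add: algebra_simps)
  qed
  also have "integral {0..g a} f = (LINT s:{0..g a}|lborel. f s)"
    using mono[of a N] \<open>a \<le> N\<close>
    by (intro set_borel_integral_eq_integral(2)[symmetric] borel_integrable_atLeastAtMost' cont') auto
  finally show ?thesis .
qed

text \<open>
  The bracketing matters: the first factor of each summand is known at the beginning of the step,
  the second one has moments of the order of its length.
\<close>

lemma discrete_product_rule:
  fixes z x y e w m d :: "nat \<Rightarrow> real"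
  assumes "\<And>i. i < N \<Longrightarrow> z (Suc i) = z i * m i"
    and "\<And>i. i < N \<Longrightarrow> x (Suc i) = x i + \<mu> * y i * d i + e i * w i"
  shows "z N * x N - z 0 * x 0 =
    (\<Sum>i<N. z i * x i * ((1 + \<mu> * d i + \<sigma> * w i) * m i - 1)) +
    (\<Sum>i<N. \<mu> * z i * (y i - x i) * (m i * d i)) +
    (\<Sum>i<N. z i * (e i - \<sigma> * x i) * (m i * w i))"
proof -
  have "z N * x N - z 0 * x 0 = (\<Sum>i<N. z (Suc i) * x (Suc i) - z i * x i)"
    by (simp only: sum_lessThan_telescope[of "\<lambda>i. z i * x i"])
  also have "\<dots> = (\<Sum>i<N. z i * x i * ((1 + \<mu> * d i + \<sigma> * w i) * m i - 1) +
      \<mu> * z i * (y i - x i) * (m i * d i) + z i * (e i - \<sigma> * x i) * (m i * w i))"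
    by (intro sum.cong refl) (simp add: assms algebra_simps)
  finally show ?thesis by (simp add: sum.distrib)
qed

lemma sum_squares_le:
  fixes h d :: "nat \<Rightarrow> real"
  assumes "\<And>i. i < N \<Longrightarrow> \<bar>h i\<bar> \<le> b" "\<And>i. i < N \<Longrightarrow> 0 \<le> d i" "(\<Sum>i<N. d i) \<le> u"
  shows "(\<Sum>i<N. (h i)\<^sup>2 * d i) \<le> b\<^sup>2 * u"
proof -
  have "(h i)\<^sup>2 \<le> b\<^sup>2" if "i < N" for i
    using power_mono[OF assms(1)[OF that] abs_ge_zero, of 2] by simp
  then have "(\<Sum>i<N. (h i)\<^sup>2 * d i) \<le> (\<Sum>i<N. b\<^sup>2 * d i)"
    using assms(2) by (intro sum_mono mult_right_mono) auto
  also have "\<dots> = b\<^sup>2 * (\<Sum>i<N. d i)" by (simp add: sum_distrib_left)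
  also have "\<dots> \<le> b\<^sup>2 * u" by (intro mult_left_mono assms(3)) auto
  finally show ?thesis .
qed

text \<open>Inserting \<open>f s\<close> between the value \<open>e i\<close> of the elementary
  integrand and the number \<open>X i\<close> splits the square into the mean square distance of
  \<open>E\<close> from \<open>f\<close> and the oscillation bound \<open>b\<close>. It is applied
  with \<open>X i\<close> equal to \<sigma> times the discrete process.\<close>

lemma sampled_square_error:
  fixes g e X :: "nat \<Rightarrow> real" and E f :: "real \<Rightarrow> real"
  assumes g: "\<And>i. i < N \<Longrightarrow> g i < g (Suc i)" "g 0 = 0" "g N = u"
    and E: "E \<in> borel_measurable borel" and f: "(\<lambda>x. f (max 0 (min u x))) \<in> borel_measurable borel"
    and step: "\<And>i s. i < N \<Longrightarrow> s \<in> {g i..<g (Suc i)} \<Longrightarrow> E s = e i"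
    and close: "\<And>i s. i < N \<Longrightarrow> s \<in> {g i..<g (Suc i)} \<Longrightarrow> \<bar>f s - X i\<bar> \<le> b"
    and L2: "(\<integral>\<^sup>+s\<in>{0..u}. ennreal ((E s - f s)\<^sup>2) \<partial>lborel) \<le> ennreal \<rho>" and "0 \<le> \<rho>"
  shows "(\<Sum>i<N. (e i - X i)\<^sup>2 * (g (Suc i) - g i)) \<le> 2 * \<rho> + 2 * b\<^sup>2 * u"
proof -
  define f' where "f' x = f (max 0 (min u x))" for x
  have [measurable]: "f' \<in> borel_measurable borel" "E \<in> borel_measurable borel"
    using E f by (auto simp: f'_def[abs_def])
  have u: "0 \<le> u" using grid_mono[of N g 0 N, OF g(1)] g by auto
  have ff': "f' s = f s" if "s \<in> {0..u}" for s using that by (simp add: f'_def)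
  have L2': "(\<integral>\<^sup>+s\<in>{0..u}. ennreal ((E s - f' s)\<^sup>2) \<partial>lborel) \<le> ennreal \<rho>"
    by (rule order.trans[OF nn_integral_mono L2]) (auto simp: ff' indicator_def)
  have "ennreal (\<Sum>i<N. (e i - X i)\<^sup>2 * (g (Suc i) - g i)) \<le>
      (\<integral>\<^sup>+s\<in>{0..u}. (2 * ennreal ((E s - f' s)\<^sup>2) + ennreal (2 * b\<^sup>2)) \<partial>lborel)"
  proof (rule step_sum_le_nn_integral)
    fix i s assume i: "i < N" and s: "s \<in> {g i..<g (Suc i)}"
    have "s \<in> {0..u}"
      using grid_mono[of N g 0 i, OF g(1)] grid_mono[of N g "Suc i" N, OF g(1)] g(2,3) i s by auto
    then have "\<bar>f' s - X i\<bar> \<le> b" using close[OF i s] ff' by simp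
    then have b: "(f' s - X i)\<^sup>2 \<le> b\<^sup>2" by (metis abs_ge_zero power2_abs power_mono)
    have "(y + z)\<^sup>2 \<le> 2 * y\<^sup>2 + 2 * z\<^sup>2" for y z :: real
      using zero_le_power2[of "y - z"] by (simp add: power2_eq_square algebra_simps)
    from this[of "E s - f' s" "f' s - X i"]
    have "(e i - X i)\<^sup>2 \<le> 2 * (E s - f' s)\<^sup>2 + 2 * b\<^sup>2" using b step[OF i s] by simp
    then have "ennreal ((e i - X i)\<^sup>2) \<le> ennreal (2 * (E s - f' s)\<^sup>2 + 2 * b\<^sup>2)" by (rule ennreal_leI)
    then show "ennreal ((e i - X i)\<^sup>2) \<le> 2 * ennreal ((E s - f' s)\<^sup>2) + ennreal (2 * b\<^sup>2)"
      by (simp add: ennreal_mult)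
  qed (simp_all add: g)
  also have "\<dots> = (\<integral>\<^sup>+s. 2 * (ennreal ((E s - f' s)\<^sup>2) * indicator {0..u} s) + ennreal (2 * b\<^sup>2) * indicator {0..u} s \<partial>lborel)"
    by (simp add: distrib_right mult.assoc)
  also have "\<dots> = 2 * (\<integral>\<^sup>+s\<in>{0..u}. ennreal ((E s - f' s)\<^sup>2) \<partial>lborel) + ennreal (2 * b\<^sup>2) * ennreal u"
    using u by (simp add: nn_integral_add nn_integral_cmult nn_integral_cmult_indicator)
  also have "\<dots> \<le> 2 * ennreal \<rho> + ennreal (2 * b\<^sup>2) * ennreal u"
    using L2' by (intro add_mono mult_left_mono) auto
  also have "\<dots> = ennreal (2 * \<rho> + 2 * b\<^sup>2 * u)"
    using \<open>0 \<le> \<rho>\<close> u by (simp add: ennreal_mult)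
  finally show ?thesis
    using \<open>0 \<le> \<rho>\<close> u by (subst (asm) ennreal_le_iff) auto
qed

context brownian_motion
begin

text \<open>
  The process \<open>Z\<close> below satisfies \<open>dZ = (\<sigma>\<^sup>2 - \<mu>) Z dt - \<sigma> Z dB\<close>, so that the product rule gives
  \<open>d(Z X) = 0\<close>. In the discrete version every term of \<open>Z X\<close> is controlled by the maximal
  inequality, with a quadratic sum of the order of the accuracy \<open>\<rho>\<close> of the approximation.
\<close>

lemma gbm_times_inverse:
  assumes sde: "sde_solution M B T (\<lambda>s x. \<mu> * x) (\<lambda>s x. \<sigma> * x) X" and "0 < u" "u \<le> T"
  shows "AE \<omega> in M. exp (- \<sigma> * B u \<omega> - (\<mu> - \<sigma>\<^sup>2 / 2) * u) * X u \<omega> = exp (- \<sigma> * B 0 \<omega>) * X 0 \<omega>"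
proof -
  define Z where "Z s \<omega> = exp (- \<sigma> * B s \<omega> - (\<mu> - \<sigma>\<^sup>2 / 2) * s)" for s \<omega>
  have Z_step: "Z t \<omega> = Z s \<omega> * gbm_inverse_step \<sigma> \<mu> (t - s) (B t \<omega> - B s \<omega>)" for s t \<omega>
    by (simp add: Z_def gbm_inverse_step_def exp_add[symmetric] field_simps)
  have Z_AF: "Z s \<in> borel_measurable (AF t)" if "0 \<le> s" "s \<le> t" for s t
    using B_AF[OF that] unfolding Z_def[abs_def] by measurable
  have adapted: "measurable_adapted M AF T X"
    and X_cont_T: "AE \<omega> in M. continuous_on {0..T} (\<lambda>t. X t \<omega>)"
    using sde by (auto simp: sde_solution_def Let_def)
  obtain J where J: "\<And>t. t \<in> {0..T} \<Longrightarrow> has_ito_integral M AF B t (\<lambda>s \<omega>. \<sigma> * X s \<omega>) (J t)"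
    "\<And>t. t \<in> {0..T} \<Longrightarrow> AE \<omega> in M. X t \<omega> = X 0 \<omega> + (LINT s:{0..t}|lborel. \<mu> * X s \<omega>) + J t \<omega>"
    using sde unfolding sde_solution_def Let_def by blast
  have X_AF: "X s \<in> borel_measurable (AF t)" if "0 \<le> s" "s \<le> t" "s \<le> T" for s t
    using adapted that measurable_AF_mono[of "X s" s t] by (auto simp: measurable_adapted_def)
  have X_M: "X s \<in> borel_measurable M" if "s \<in> {0..u}" for s
    using X_AF[of s s] that \<open>u \<le> T\<close> measurable_AF_M by auto
  have Z_M: "Z s \<in> borel_measurable M" if "s \<in> {0..u}" for s
    using Z_AF[of s s] that measurable_AF_M by auto
  have X_cont: "AE \<omega> in M. continuous_on {0..u} (\<lambda>t. X t \<omega>)"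
    using X_cont_T
  proof eventually_elim
    case (elim \<omega>)
    then show ?case by (rule continuous_on_subset) (use \<open>u \<le> T\<close> in auto)
  qed
  have Z_cont: "AE \<omega> in M. continuous_on {0..u} (\<lambda>t. Z t \<omega>)"
    using B_continuous
  proof eventually_elim
    case (elim \<omega>)
    have "continuous_on {0..u} (\<lambda>t. B t \<omega>)" by (rule continuous_on_subset[OF elim]) auto
    then show ?case unfolding Z_def by (intro continuous_intros)
  qed
  have u0: "0 \<le> u" using \<open>0 < u\<close> by simp

  have "AE \<omega> in M. Z u \<omega> * X u \<omega> = Z 0 \<omega> * X 0 \<omega>"
  proof (rule AE_eq_if_probably_close)
    fix q0 \<epsilon> :: real assume "0 < q0" and \<epsilon>: "0 < \<epsilon>"
    \<comment> \<open>The failures add up to \<open>23 * q\<close>: five for the good event, and six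
      for each of the three sums, whose estimates use the good event again.\<close>
    define q where "q = q0 / 32"
    have q: "0 < q" using \<open>0 < q0\<close> by (simp add: q_def)
    obtain C where C: "C \<ge> 0"
      and bounds: "\<And>d W. 0 < d \<Longrightarrow> d \<le> 1 \<Longrightarrow> distributed M lborel W (normal_density 0 (sqrt d)) \<Longrightarrow>
       integrable M (\<lambda>\<omega>. (gbm_inverse_step \<sigma> \<mu> d (W \<omega>) * d)\<^sup>2) \<and>
       \<bar>expectation (\<lambda>\<omega>. gbm_inverse_step \<sigma> \<mu> d (W \<omega>) * d)\<bar> \<le> C * d \<and>
       expectation (\<lambda>\<omega>. (gbm_inverse_step \<sigma> \<mu> d (W \<omega>) * d)\<^sup>2) \<le> C * d \<and>
       integrable M (\<lambda>\<omega>. (gbm_inverse_step \<sigma> \<mu> d (W \<omega>) * W \<omega>)\<^sup>2) \<and>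
       \<bar>expectation (\<lambda>\<omega>. gbm_inverse_step \<sigma> \<mu> d (W \<omega>) * W \<omega>)\<bar> \<le> C * d \<and>
       expectation (\<lambda>\<omega>. (gbm_inverse_step \<sigma> \<mu> d (W \<omega>) * W \<omega>)\<^sup>2) \<le> C * d \<and>
       integrable M (\<lambda>\<omega>. ((1 + \<mu> * d + \<sigma> * W \<omega>) * gbm_inverse_step \<sigma> \<mu> d (W \<omega>) - 1)\<^sup>2) \<and>
       \<bar>expectation (\<lambda>\<omega>. (1 + \<mu> * d + \<sigma> * W \<omega>) * gbm_inverse_step \<sigma> \<mu> d (W \<omega>) - 1)\<bar> \<le> C * d\<^sup>2 \<and>
       expectation (\<lambda>\<omega>. ((1 + \<mu> * d + \<sigma> * W \<omega>) * gbm_inverse_step \<sigma> \<mu> d (W \<omega>) - 1)\<^sup>2) \<le> C * d\<^sup>2"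
      by (rule gbm_step_moment_bounds[where \<sigma>=\<sigma> and \<mu>=\<mu>]) blast
    define K where "K = 2 * C + 2 * C\<^sup>2 * u"
    have K: "0 \<le> K" using C u0 by (simp add: K_def)
    obtain nz where nz: "probably M q (\<lambda>\<omega>. \<forall>s\<in>{0..u}. \<bar>Z s \<omega>\<bar> \<le> real nz)"
      using probably_bounded_paths[OF Z_M Z_cont u0 q] by blast
    obtain nx where nx: "probably M q (\<lambda>\<omega>. \<forall>s\<in>{0..u}. \<bar>X s \<omega>\<bar> \<le> real nx)"
      using probably_bounded_paths[OF X_M X_cont u0 q] by blast
    \<comment> \<open>\<open>c\<close>, \<open>C1\<close> and \<open>C2\<close> come from data
      available before any discretisation, so \<rho> can still be chosen small compared with
      them.\<close>
    define c where "c = real nz + real nx + 1"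
    have c: "1 \<le> c" "real nz \<le> c" "real nx \<le> c" by (auto simp: c_def)
    \<comment> \<open>\<open>C1 * \<rho>\<close> will bound the distance of the discrete process
      from \<open>X\<close> at grid times: \<open>\<bar>\<mu>\<bar> * u\<close> stems from the
      Riemann sum of the drift, 1 from the approximation of the Ito integral.\<close>
    define C1 where "C1 = \<bar>\<mu>\<bar> * u + 1"
    have C1: "1 \<le> C1" using u0 by (simp add: C1_def)
    \<comment> \<open>One summand for each of the quadratic sums of \<open>h1\<close>,
      \<open>h2\<close> and \<open>h3\<close>; all three will be at most \<open>C2 * \<rho>\<close>
      on the good event.\<close>
    define C2 where "C2 = (c * (c + C1))\<^sup>2 * u + (\<bar>\<mu>\<bar> * c * C1)\<^sup>2 * u + c\<^sup>2 * (2 + 2 * (\<bar>\<sigma>\<bar> * (1 + C1))\<^sup>2 * u)"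
    have C2_parts: "0 \<le> (c * (c + C1))\<^sup>2 * u" "0 \<le> (\<bar>\<mu>\<bar> * c * C1)\<^sup>2 * u"
        "0 \<le> c\<^sup>2 * (2 + 2 * (\<bar>\<sigma>\<bar> * (1 + C1))\<^sup>2 * u)"
      using u0 by auto
    have C2: "0 \<le> C2" using C2_parts by (simp add: C2_def)
    have cC1: "0 < c * C1" using c C1 by (intro mult_pos_pos) auto
    \<comment> \<open>Three demands: \<open>\<rho> \<le> 1\<close> gives
      \<open>\<rho>\<^sup>2 \<le> \<rho>\<close> and steps shorter than the moment bounds allow; the
      second bound makes each use of the maximal inequality at level \<open>\<epsilon> / 4\<close>
      cost at most \<open>q\<close>; the third makes the replacement of \<open>x N\<close> by
      \<open>X u\<close> cost at most \<open>\<epsilon> / 4\<close>.\<close>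
    define \<rho> where "\<rho> = min 1 (min (q * (\<epsilon> / 4)\<^sup>2 / (K * C2 + 1)) (\<epsilon> / 4 / (c * C1)))"
    have KC2: "0 < K * C2 + 1" using mult_nonneg_nonneg[OF K C2] by linarith
    have \<rho>: "0 < \<rho>" "\<rho> \<le> 1" using q \<epsilon> KC2 cC1 by (auto simp: \<rho>_def)
    have \<rho>_C1: "c * (C1 * \<rho>) \<le> \<epsilon> / 4"
    proof -
      have "\<rho> \<le> \<epsilon> / 4 / (c * C1)" by (simp add: \<rho>_def)
      then have "\<rho> * (c * C1) \<le> \<epsilon> / 4" using cC1 by (simp only: pos_le_divide_eq)
      then show ?thesis by (simp add: mult_ac)
    qed
    have \<rho>_K: "K * (C2 * \<rho>) / (\<epsilon> / 4)\<^sup>2 \<le> q"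
    proof -
      have "\<rho> \<le> q * (\<epsilon> / 4)\<^sup>2 / (K * C2 + 1)" by (simp add: \<rho>_def)
      then have "\<rho> * (K * C2 + 1) \<le> q * (\<epsilon> / 4)\<^sup>2" using KC2 by (simp only: pos_le_divide_eq)
      then have "K * (C2 * \<rho>) \<le> q * (\<epsilon> / 4)\<^sup>2" using \<rho>(1) by (simp add: algebra_simps)
      then show ?thesis using \<epsilon> by (simp add: pos_divide_le_eq)
    qed
    obtain n where n: "probably M q (\<lambda>\<omega>. \<forall>s\<in>{0..u}. \<forall>t\<in>{0..u}. \<bar>X s \<omega> - X t \<omega>\<bar> \<le> \<rho> / 2 + real n * \<bar>s - t\<bar>)"
      using probably_uniformly_continuous_paths[OF X_M X_cont u0 q, of "\<rho> / 2"] \<rho>(1) by auto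
    have ito: "has_ito_integral M AF B x (\<lambda>s \<omega>. \<sigma> * X s \<omega>) (J x)" if "x \<in> {0..u}" for x
      using J(1)[of x] that \<open>u \<le> T\<close> by auto
    obtain m p \<xi> where ed: "elementary_data M AF u m p \<xi>"
      and L2: "probably M q (\<lambda>\<omega>. (\<integral>\<^sup>+s\<in>{0..u}. ennreal ((elementary_process m p \<xi> s \<omega> - \<sigma> * X s \<omega>)\<^sup>2) \<partial>lborel) \<le> ennreal \<rho>)"
      and unif: "\<forall>G. finite G \<longrightarrow> G \<subseteq> {0..u} \<longrightarrow>
        probably M q (\<lambda>\<omega>. \<forall>x\<in>G. \<bar>running_integral B m p \<xi> x \<omega> - J x \<omega>\<bar> \<le> \<rho>)"
      by (rule ito_uniform_approximant[OF ito u0 \<rho>(1) \<rho>(1) q])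
    \<comment> \<open>With this mesh the modulus
      \<open>\<rho> / 2 + real n * \<bar>s - t\<bar>\<close> stays below \<rho> within each
      cell.\<close>
    define D where "D = \<rho> / (2 * (real n + 1))"
    have D: "0 < D" "D \<le> \<rho>" "real n * D \<le> \<rho> / 2"
      using \<rho>(1) by (auto simp: D_def field_simps)
    have "p ` {..m} \<subseteq> {0..u}" using elementary_dataD(5)[OF ed] by auto
    \<comment> \<open>The approximant is fixed by now. Since the grid contains its partition points,
      it is constant on every cell and its sums over the grid are its running integrals.\<close>
    then obtain g N where g: "g 0 = 0" "g N = u" "\<And>i. i < N \<Longrightarrow> g i < g (Suc i)" "p ` {..m} \<subseteq> g ` {..N}"
      "\<And>i. i < N \<Longrightarrow> g (Suc i) - g i \<le> D"
      using fine_grid[of "p ` {..m}" u D] \<open>0 < u\<close> D(1) by auto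
    have g_in: "g i \<in> {0..u}" if "i \<le> N" for i
      using grid_mono[of N g 0 i, OF g(3)] grid_mono[of N g i N, OF g(3)] that g(1,2) by auto
    define E where "E = elementary_process m p \<xi>"
    define d where "d i = g (Suc i) - g i" for i
    define W where "W i \<omega> = B (g (Suc i)) \<omega> - B (g i) \<omega>" for i \<omega>
    have d: "0 < d i" "d i \<le> \<rho>" "d i \<le> 1" if "i < N" for i
      using g(3)[OF that] g(5)[OF that] D \<rho> by (auto simp: d_def)
    have d_sum: "(\<Sum>i<N. d i) \<le> u"
      unfolding d_def using g by (simp add: sum_lessThan_telescope)
    have W_dist: "distributed M lborel (W i) (normal_density 0 (sqrt (d i)))" if "i < N" for i
      unfolding W_def[abs_def] d_def
      using g_in[of i] g(3)[OF that] that by (intro B_increment_distributed) auto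
    \<comment> \<open>The discrete process: the drift is a left endpoint sum along \<open>X\<close>,
      and the Ito term is replaced by the transform of the elementary integrand.\<close>
    define x where "x i \<omega> = X 0 \<omega> + \<mu> * (\<Sum>j<i. X (g j) \<omega> * d j) + (\<Sum>j<i. E (g j) \<omega> * W j \<omega>)" for i \<omega>

    \<comment> \<open>The good event, on which the remaining estimates of coefficients are pathwise.
      The equation enters at grid times only, so finitely many null sets are discarded.\<close>
    define Ev where "Ev \<omega> \<longleftrightarrow> (\<forall>s\<in>{0..u}. \<bar>Z s \<omega>\<bar> \<le> real nz) \<and> (\<forall>s\<in>{0..u}. \<bar>X s \<omega>\<bar> \<le> real nx) \<and>
      (\<forall>s\<in>{0..u}. \<forall>t\<in>{0..u}. \<bar>X s \<omega> - X t \<omega>\<bar> \<le> \<rho> / 2 + real n * \<bar>s - t\<bar>) \<and>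
      (\<integral>\<^sup>+s\<in>{0..u}. ennreal ((elementary_process m p \<xi> s \<omega> - \<sigma> * X s \<omega>)\<^sup>2) \<partial>lborel) \<le> ennreal \<rho> \<and>
      (\<forall>x\<in>g ` {..N}. \<bar>running_integral B m p \<xi> x \<omega> - J x \<omega>\<bar> \<le> \<rho>) \<and>
      continuous_on {0..u} (\<lambda>t. X t \<omega>) \<and>
      (\<forall>t\<in>g ` {..N}. X t \<omega> = X 0 \<omega> + (LINT s:{0..t}|lborel. \<mu> * X s \<omega>) + J t \<omega>)" for \<omega>
    have Ev_prob: "probably M (5 * q) Ev"
    proof -
      have eqs: "AE \<omega> in M. \<forall>t\<in>g ` {..N}. X t \<omega> = X 0 \<omega> + (LINT s:{0..t}|lborel. \<mu> * X s \<omega>) + J t \<omega>"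
        using g_in \<open>u \<le> T\<close> by (intro AE_finite_allI J(2)) force+
      have "g ` {..N} \<subseteq> {0..u}" using g_in by auto
      then have un: "probably M q (\<lambda>\<omega>. \<forall>x\<in>g ` {..N}. \<bar>running_integral B m p \<xi> x \<omega> - J x \<omega>\<bar> \<le> \<rho>)"
        using unif by blast
      show ?thesis
        by (rule probably_mono[OF probably_conj[OF nz probably_conj[OF nx probably_conj[OF n probably_conj[OF L2
            probably_conj[OF un probably_conj[OF AE_imp_probably[OF X_cont] AE_imp_probably[OF eqs]]]]]]]])
          (simp_all add: Ev_def)
    qed

    have x_close: "\<bar>x i \<omega> - X (g i) \<omega>\<bar> \<le> C1 * \<rho>" and X_cell: "\<And>i s. i < N \<Longrightarrow> s \<in> {g i..g (Suc i)} \<Longrightarrow> \<bar>X s \<omega> - X (g i) \<omega>\<bar> \<le> \<rho>"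
      if Ev: "Ev \<omega>" and i: "i \<le> N" for i \<omega>
    proof -
      show cell: "\<bar>X s \<omega> - X (g i) \<omega>\<bar> \<le> \<rho>" if i: "i < N" and s: "s \<in> {g i..g (Suc i)}" for i s
      proof -
        have "s \<in> {0..u}" "g i \<in> {0..u}" using s g_in[of i] g_in[of "Suc i"] i by auto
        then have "\<bar>X s \<omega> - X (g i) \<omega>\<bar> \<le> \<rho> / 2 + real n * \<bar>s - g i\<bar>" using Ev unfolding Ev_def by blast
        moreover have "real n * \<bar>s - g i\<bar> \<le> real n * D"
          using s g(5)[OF i] by (intro mult_left_mono) auto
        ultimately show ?thesis using D(3) by linarith
      qed
      have R: "\<bar>(LINT s:{0..g i}|lborel. X s \<omega>) - (\<Sum>j<i. X (g j) \<omega> * d j)\<bar> \<le> \<rho> * g i"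
        unfolding d_def by (rule riemann_sum_error[of N g]) (use g i cell Ev in \<open>auto simp: Ev_def\<close>)
      also have "\<rho> * g i \<le> \<rho> * u" using g_in[OF i] \<rho>(1) by simp
      finally have R: "\<bar>\<mu> * ((LINT s:{0..g i}|lborel. X s \<omega>) - (\<Sum>j<i. X (g j) \<omega> * d j))\<bar> \<le> \<bar>\<mu>\<bar> * (\<rho> * u)"
        unfolding abs_mult by (rule mult_left_mono) simp
      have I: "(\<Sum>j<i. E (g j) \<omega> * W j \<omega>) = running_integral B m p \<xi> (g i) \<omega>"
        unfolding E_def W_def
        by (rule elementary_integral_on_refinement[where N=N]) (use g(3,4) i elementary_dataD(3)[OF ed] in auto)
      have "\<bar>running_integral B m p \<xi> (g i) \<omega> - J (g i) \<omega>\<bar> \<le> \<rho>" using Ev i unfolding Ev_def by blast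
      moreover have "X (g i) \<omega> = X 0 \<omega> + (LINT s:{0..g i}|lborel. \<mu> * X s \<omega>) + J (g i) \<omega>"
        using Ev i unfolding Ev_def by blast
      then have "X (g i) \<omega> = X 0 \<omega> + \<mu> * (LINT s:{0..g i}|lborel. X s \<omega>) + J (g i) \<omega>" by simp
      then have "x i \<omega> - X (g i) \<omega> = - (\<mu> * ((LINT s:{0..g i}|lborel. X s \<omega>) - (\<Sum>j<i. X (g j) \<omega> * d j)))
          + (running_integral B m p \<xi> (g i) \<omega> - J (g i) \<omega>)"
        unfolding x_def I by (simp add: algebra_simps)
      ultimately have "\<bar>x i \<omega> - X (g i) \<omega>\<bar> \<le> \<bar>\<mu>\<bar> * (\<rho> * u) + \<rho>" using R by linarith
      then show "\<bar>x i \<omega> - X (g i) \<omega>\<bar> \<le> C1 * \<rho>" by (simp add: C1_def algebra_simps)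
    qed

    \<comment> \<open>The factor \<open>sqrt \<rho>\<close> is moved from the noise to the
      coefficient. The moments of the Euler defect are of order \<open>d\<^sup>2\<close> with
      \<open>d \<le> \<rho>\<close>, so after division by \<open>sqrt \<rho>\<close> they are still
      of order \<open>d\<close>, while the quadratic sum of \<open>h1\<close> gains the factor
      \<rho> that its other factors, merely bounded, do not supply.\<close>
    define h1 where "h1 i \<omega> = Z (g i) \<omega> * x i \<omega> * sqrt \<rho>" for i \<omega>
    define h2 where "h2 i \<omega> = \<mu> * Z (g i) \<omega> * (X (g i) \<omega> - x i \<omega>)" for i \<omega>
    define h3 where "h3 i \<omega> = Z (g i) \<omega> * (E (g i) \<omega> - \<sigma> * x i \<omega>)" for i \<omega>
    define v1 where "v1 i w = ((1 + \<mu> * d i + \<sigma> * w) * gbm_inverse_step \<sigma> \<mu> (d i) w - 1) / sqrt \<rho>" for i w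
    define v2 where "v2 i w = gbm_inverse_step \<sigma> \<mu> (d i) w * d i" for i w
    define v3 where "v3 i w = gbm_inverse_step \<sigma> \<mu> (d i) w * w" for i w

    have x_AF: "x i \<in> borel_measurable (AF (g i))" if "i < N" for i
    proof -
      have gj: "0 \<le> g j" "g j \<le> g i" "g j \<le> T" "0 \<le> g (Suc j)" "g (Suc j) \<le> g i" if "j < i" for j
        using g_in[of j] g_in[of "Suc j"] \<open>u \<le> T\<close> grid_mono[of N g j i, OF g(3)] grid_mono[of N g "Suc j" i, OF g(3)] that \<open>i < N\<close> by auto
      have "X 0 \<in> borel_measurable (AF (g i))" using X_AF[of 0 "g i"] g_in[of i] that \<open>u \<le> T\<close> by auto
      moreover have "X (g j) \<in> borel_measurable (AF (g i))" "W j \<in> borel_measurable (AF (g i))"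
        "E (g j) \<in> borel_measurable (AF (g i))" if "j < i" for j
      proof -
        show "X (g j) \<in> borel_measurable (AF (g i))" using gj[OF that] by (intro X_AF)
        show "W j \<in> borel_measurable (AF (g i))" unfolding W_def[abs_def]
          using gj[OF that] by (intro borel_measurable_diff B_AF)
        show "E (g j) \<in> borel_measurable (AF (g i))" unfolding E_def
          using measurable_AF_mono[OF elementary_process_AF[OF ed] gj(2)[OF that]] .
      qed
      ultimately show ?thesis
        unfolding x_def[abs_def]
        by (intro borel_measurable_add borel_measurable_times borel_measurable_sum borel_measurable_const) auto
    qed
    have at_i: "Z (g i) \<in> borel_measurable (AF (g i))" "X (g i) \<in> borel_measurable (AF (g i))"
      "E (g i) \<in> borel_measurable (AF (g i))" if "i < N" for i
      using g_in[of i] that \<open>u \<le> T\<close> elementary_process_AF[OF ed, of "g i"] unfolding E_def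
      by (auto intro!: Z_AF X_AF)
    have h_AF: "h1 i \<in> borel_measurable (AF (g i))" "h2 i \<in> borel_measurable (AF (g i))"
      "h3 i \<in> borel_measurable (AF (g i))" if "i < N" for i
      unfolding h1_def[abs_def] h2_def[abs_def] h3_def[abs_def]
      using at_i[OF that] x_AF[OF that] by measurable

    have g0: "0 \<le> g 0" "g N \<le> u" using g by auto
    note steps = independent_increment_steps[where g=g and N=N and u=u and C=C, OF g0(1) g(3) g0(2), folded W_def d_def]
    have steps2: "independent_steps M (\<lambda>i. AF (g i)) (\<lambda>i \<omega>. v2 i (W i \<omega>)) d C u N"
      by (rule steps) (use bounds[OF d(1) d(3) W_dist] in \<open>auto simp: v2_def[abs_def]\<close>)
    have steps3: "independent_steps M (\<lambda>i. AF (g i)) (\<lambda>i \<omega>. v3 i (W i \<omega>)) d C u N"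
      by (rule steps) (use bounds[OF d(1) d(3) W_dist] in \<open>auto simp: v3_def[abs_def]\<close>)
    have steps1: "independent_steps M (\<lambda>i. AF (g i)) (\<lambda>i \<omega>. v1 i (W i \<omega>)) d C u N"
    proof (rule steps)
      show "v1 i \<in> borel_measurable borel" for i unfolding v1_def[abs_def] by measurable
      fix i assume i: "i < N"
      note b = bounds[OF d(1)[OF i] d(3)[OF i] W_dist[OF i]]
      have sq: "(v1 i (W i \<omega>))\<^sup>2 = ((1 + \<mu> * d i + \<sigma> * W i \<omega>) * gbm_inverse_step \<sigma> \<mu> (d i) (W i \<omega>) - 1)\<^sup>2 / \<rho>" for \<omega>
        using \<rho>(1) by (simp add: v1_def power_divide)
      show "integrable M (\<lambda>\<omega>. (v1 i (W i \<omega>))\<^sup>2)" unfolding sq using b by auto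
      have dd: "C * (d i)\<^sup>2 / \<rho> \<le> C * d i"
      proof -
        have "(d i)\<^sup>2 \<le> d i * \<rho>" using d[OF i] by (simp add: power2_eq_square)
        then have "C * (d i)\<^sup>2 \<le> C * (d i * \<rho>)" using C by (intro mult_left_mono) auto
        then show ?thesis using \<rho>(1) by (simp add: pos_divide_le_eq mult_ac)
      qed
      have "expectation (\<lambda>\<omega>. (v1 i (W i \<omega>))\<^sup>2) \<le> C * (d i)\<^sup>2 / \<rho>"
        unfolding sq using b \<rho>(1) by (auto intro: divide_right_mono)
      then show "expectation (\<lambda>\<omega>. (v1 i (W i \<omega>))\<^sup>2) \<le> C * d i" using dd by linarith
      have "\<rho> \<le> sqrt \<rho>" using \<rho> by (intro real_le_rsqrt) (simp add: power2_eq_square mult_left_le)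
      then have "C * (d i)\<^sup>2 / sqrt \<rho> \<le> C * (d i)\<^sup>2 / \<rho>"
        using \<rho>(1) C by (intro divide_left_mono) auto
      moreover have "\<bar>expectation (\<lambda>\<omega>. v1 i (W i \<omega>))\<bar> \<le> C * (d i)\<^sup>2 / sqrt \<rho>"
        unfolding v1_def using b \<rho>(1) by (simp add: divide_right_mono)
      ultimately show "\<bar>expectation (\<lambda>\<omega>. v1 i (W i \<omega>))\<bar> \<le> C * d i" using dd by linarith
    qed

    have sums: "(\<Sum>i<N. (h1 i \<omega>)\<^sup>2 * d i) \<le> C2 * \<rho>" "(\<Sum>i<N. (h2 i \<omega>)\<^sup>2 * d i) \<le> C2 * \<rho>"
      "(\<Sum>i<N. (h3 i \<omega>)\<^sup>2 * d i) \<le> C2 * \<rho>" if Ev: "Ev \<omega>" and \<omega>: "\<omega> \<in> space M" for \<omega>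
    proof -
      have Ev_bounds: "\<forall>s\<in>{0..u}. \<bar>Z s \<omega>\<bar> \<le> real nz" "\<forall>s\<in>{0..u}. \<bar>X s \<omega>\<bar> \<le> real nx"
        using Ev unfolding Ev_def by blast+
      have Zc: "\<bar>Z (g i) \<omega>\<bar> \<le> c" and Xc: "\<bar>X (g i) \<omega>\<bar> \<le> c" if "i < N" for i
        using bspec[OF Ev_bounds(1) g_in[of i]] bspec[OF Ev_bounds(2) g_in[of i]] that c by linarith+
      have xc: "\<bar>x i \<omega>\<bar> \<le> c + C1" if "i < N" for i
      proof -
        have "C1 * \<rho> \<le> C1" using C1 \<rho> by (simp add: mult_left_le)
        then show ?thesis using x_close[OF Ev, of i] Xc[OF that] that by linarith
      qed
      have \<rho>2: "\<rho>\<^sup>2 \<le> \<rho>" using \<rho> by (simp add: power2_eq_square mult_left_le)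
      have "(\<Sum>i<N. (h1 i \<omega>)\<^sup>2 * d i) \<le> (c * (c + C1) * sqrt \<rho>)\<^sup>2 * u"
      proof (rule sum_squares_le[OF _ _ d_sum])
        fix i assume i: "i < N"
        show "\<bar>h1 i \<omega>\<bar> \<le> c * (c + C1) * sqrt \<rho>"
          unfolding h1_def abs_mult using Zc[OF i] xc[OF i] \<rho>(1) c by (intro mult_mono) auto
      qed (use d(1) less_imp_le in blast)
      also have "\<dots> = (c * (c + C1))\<^sup>2 * u * \<rho>" using \<rho>(1) by (simp add: power_mult_distrib mult_ac)
      also have "\<dots> \<le> C2 * \<rho>" using C2_parts \<rho>(1) by (intro mult_right_mono) (auto simp: C2_def)
      finally show "(\<Sum>i<N. (h1 i \<omega>)\<^sup>2 * d i) \<le> C2 * \<rho>" .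
      have "(\<Sum>i<N. (h2 i \<omega>)\<^sup>2 * d i) \<le> (\<bar>\<mu>\<bar> * c * (C1 * \<rho>))\<^sup>2 * u"
      proof (rule sum_squares_le[OF _ _ d_sum])
        fix i assume i: "i < N"
        show "\<bar>h2 i \<omega>\<bar> \<le> \<bar>\<mu>\<bar> * c * (C1 * \<rho>)"
          unfolding h2_def abs_mult using Zc[OF i] x_close[OF Ev, of i] i c
          by (intro mult_mono) (auto simp: abs_minus_commute)
      qed (use d(1) less_imp_le in blast)
      also have "\<dots> = (\<bar>\<mu>\<bar> * c * C1)\<^sup>2 * u * \<rho>\<^sup>2" by (simp add: power_mult_distrib mult_ac)
      also have "\<dots> \<le> (\<bar>\<mu>\<bar> * c * C1)\<^sup>2 * u * \<rho>" using \<rho>2 C2_parts by (intro mult_left_mono)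
      also have "\<dots> \<le> C2 * \<rho>" using C2_parts \<rho>(1) by (intro mult_right_mono) (auto simp: C2_def)
      finally show "(\<Sum>i<N. (h2 i \<omega>)\<^sup>2 * d i) \<le> C2 * \<rho>" .
      have "(\<Sum>i<N. (E (g i) \<omega> - \<sigma> * x i \<omega>)\<^sup>2 * d i) \<le> 2 * \<rho> + 2 * (\<bar>\<sigma>\<bar> * ((1 + C1) * \<rho>))\<^sup>2 * u"
        unfolding d_def
      proof (rule sampled_square_error[where E="\<lambda>s. E s \<omega>" and f="\<lambda>s. \<sigma> * X s \<omega>"])
        have "measurable_adapted M AF u (\<lambda>s \<omega>. \<sigma> * X s \<omega>)"
          using ito[of u] u0 unfolding has_ito_integral_def by auto
        from clamp_section_measurable[OF measurable_adapted_clamp[OF this u0] \<omega>]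
        show "(\<lambda>s. \<sigma> * X (max 0 (min u s)) \<omega>) \<in> borel_measurable borel" .
        fix i s assume i: "i < N" and s: "s \<in> {g i..<g (Suc i)}"
        show "E s \<omega> = E (g i) \<omega>"
          unfolding E_def by (rule elementary_process_constant_on_refinement[of N g]) (use g(3,4) i s in auto)
        have "\<bar>X s \<omega> - X (g i) \<omega>\<bar> \<le> \<rho>" using X_cell[OF Ev, of 0 i s] i s by auto
        then have "\<bar>X s \<omega> - x i \<omega>\<bar> \<le> (1 + C1) * \<rho>"
          using x_close[OF Ev, of i] i by (simp add: algebra_simps)
        then show "\<bar>\<sigma> * X s \<omega> - \<sigma> * x i \<omega>\<bar> \<le> \<bar>\<sigma>\<bar> * ((1 + C1) * \<rho>)"
          unfolding right_diff_distrib[symmetric] abs_mult by (intro mult_left_mono) auto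
      next
        show "(\<integral>\<^sup>+s\<in>{0..u}. ennreal ((E s \<omega> - \<sigma> * X s \<omega>)\<^sup>2) \<partial>lborel) \<le> ennreal \<rho>"
          using Ev unfolding Ev_def E_def by blast
      qed (use g(1,2,3) \<rho>(1) in \<open>auto simp: E_def\<close>)
      also have "\<dots> = 2 * \<rho> + 2 * (\<bar>\<sigma>\<bar> * (1 + C1))\<^sup>2 * u * \<rho>\<^sup>2" by (simp add: power_mult_distrib mult_ac)
      also have "\<dots> \<le> 2 * \<rho> + 2 * (\<bar>\<sigma>\<bar> * (1 + C1))\<^sup>2 * u * \<rho>" using \<rho>2 u0 by (intro add_left_mono mult_left_mono) auto
      finally have 3: "(\<Sum>i<N. (E (g i) \<omega> - \<sigma> * x i \<omega>)\<^sup>2 * d i) \<le> (2 + 2 * (\<bar>\<sigma>\<bar> * (1 + C1))\<^sup>2 * u) * \<rho>"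
        by (simp add: algebra_simps)
      have "(\<Sum>i<N. (h3 i \<omega>)\<^sup>2 * d i) \<le> (\<Sum>i<N. c\<^sup>2 * ((E (g i) \<omega> - \<sigma> * x i \<omega>)\<^sup>2 * d i))"
      proof (rule sum_mono)
        fix i assume "i \<in> {..<N}"
        then have i: "i < N" by simp
        have "(Z (g i) \<omega>)\<^sup>2 \<le> c\<^sup>2" using Zc[OF i] c(1) by (simp add: abs_le_square_iff[symmetric])
        then show "(h3 i \<omega>)\<^sup>2 * d i \<le> c\<^sup>2 * ((E (g i) \<omega> - \<sigma> * x i \<omega>)\<^sup>2 * d i)"
          unfolding h3_def power_mult_distrib mult.assoc using d(1)[OF i] by (intro mult_right_mono) auto
      qed
      also have "\<dots> \<le> c\<^sup>2 * ((2 + 2 * (\<bar>\<sigma>\<bar> * (1 + C1))\<^sup>2 * u) * \<rho>)"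
        unfolding sum_distrib_left[symmetric] using 3 by (intro mult_left_mono) auto
      also have "\<dots> = c\<^sup>2 * (2 + 2 * (\<bar>\<sigma>\<bar> * (1 + C1))\<^sup>2 * u) * \<rho>" by (simp only: mult.assoc)
      also have "\<dots> \<le> C2 * \<rho>" using C2_parts \<rho>(1) by (intro mult_right_mono) (auto simp: C2_def)
      finally show "(\<Sum>i<N. (h3 i \<omega>)\<^sup>2 * d i) \<le> C2 * \<rho>" .
    qed

    have C2\<rho>: "0 \<le> C2 * \<rho>" using C2 \<rho>(1) by simp
    have \<epsilon>4: "0 < \<epsilon> / 4" using \<epsilon> by simp
    have max: "probably M (6 * q) (\<lambda>\<omega>. \<bar>\<Sum>i<N. h i \<omega> * v i (W i \<omega>)\<bar> \<le> \<epsilon> / 4)"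
      if steps: "independent_steps M (\<lambda>i. AF (g i)) (\<lambda>i \<omega>. v i (W i \<omega>)) d C u N"
        and h: "\<And>i. i < N \<Longrightarrow> h i \<in> borel_measurable (AF (g i))"
        and sq: "\<And>\<omega>. Ev \<omega> \<Longrightarrow> \<omega> \<in> space M \<Longrightarrow> (\<Sum>i<N. (h i \<omega>)\<^sup>2 * d i) \<le> C2 * \<rho>" for h v
    proof -
      have "probably M (5 * q) (\<lambda>\<omega>. (\<Sum>i<N. (h i \<omega>)\<^sup>2 * d i) \<le> C2 * \<rho>)"
        by (rule probably_mono[OF Ev_prob]) (use sq in auto)
      from independent_steps.transform_maximal_inequality[OF steps h this C C2\<rho> \<epsilon>4, folded K_def]
      show ?thesis
        by (rule probably_mono) (use \<rho>_K in auto)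
    qed
    have "probably M (5 * q + (6 * q + (6 * q + 6 * q)))
      (\<lambda>\<omega>. Ev \<omega> \<and> \<bar>\<Sum>i<N. h1 i \<omega> * v1 i (W i \<omega>)\<bar> \<le> \<epsilon> / 4 \<and>
        \<bar>\<Sum>i<N. h2 i \<omega> * v2 i (W i \<omega>)\<bar> \<le> \<epsilon> / 4 \<and> \<bar>\<Sum>i<N. h3 i \<omega> * v3 i (W i \<omega>)\<bar> \<le> \<epsilon> / 4)"
      by (intro probably_conj Ev_prob max steps1 steps2 steps3 h_AF sums)
    then show "probably M q0 (\<lambda>\<omega>. \<bar>Z u \<omega> * X u \<omega> - Z 0 \<omega> * X 0 \<omega>\<bar> \<le> \<epsilon>)"
    proof (rule probably_mono)
      fix \<omega>
      assume *: "Ev \<omega> \<and> \<bar>\<Sum>i<N. h1 i \<omega> * v1 i (W i \<omega>)\<bar> \<le> \<epsilon> / 4 \<and>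
        \<bar>\<Sum>i<N. h2 i \<omega> * v2 i (W i \<omega>)\<bar> \<le> \<epsilon> / 4 \<and> \<bar>\<Sum>i<N. h3 i \<omega> * v3 i (W i \<omega>)\<bar> \<le> \<epsilon> / 4"
      have "Z (g N) \<omega> * x N \<omega> - Z (g 0) \<omega> * x 0 \<omega> =
        (\<Sum>i<N. Z (g i) \<omega> * x i \<omega> * ((1 + \<mu> * d i + \<sigma> * W i \<omega>) * gbm_inverse_step \<sigma> \<mu> (d i) (W i \<omega>) - 1)) +
        (\<Sum>i<N. \<mu> * Z (g i) \<omega> * (X (g i) \<omega> - x i \<omega>) * (gbm_inverse_step \<sigma> \<mu> (d i) (W i \<omega>) * d i)) +
        (\<Sum>i<N. Z (g i) \<omega> * (E (g i) \<omega> - \<sigma> * x i \<omega>) * (gbm_inverse_step \<sigma> \<mu> (d i) (W i \<omega>) * W i \<omega>))"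
      proof (rule discrete_product_rule)
        fix i assume "i < N"
        show "Z (g (Suc i)) \<omega> = Z (g i) \<omega> * gbm_inverse_step \<sigma> \<mu> (d i) (W i \<omega>)"
          unfolding d_def W_def by (rule Z_step)
        show "x (Suc i) \<omega> = x i \<omega> + \<mu> * X (g i) \<omega> * d i + E (g i) \<omega> * W i \<omega>"
          unfolding x_def by (simp add: algebra_simps)
      qed
      also have "\<dots> = (\<Sum>i<N. h1 i \<omega> * v1 i (W i \<omega>)) + (\<Sum>i<N. h2 i \<omega> * v2 i (W i \<omega>)) + (\<Sum>i<N. h3 i \<omega> * v3 i (W i \<omega>))"
        using \<rho>(1) by (simp add: h1_def h2_def h3_def v1_def v2_def v3_def mult.assoc)
      finally have eq: "Z (g N) \<omega> * x N \<omega> - Z (g 0) \<omega> * x 0 \<omega> = (\<Sum>i<N. h1 i \<omega> * v1 i (W i \<omega>)) +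
        (\<Sum>i<N. h2 i \<omega> * v2 i (W i \<omega>)) + (\<Sum>i<N. h3 i \<omega> * v3 i (W i \<omega>))" .
      have 1: "\<bar>Z u \<omega> * x N \<omega> - Z 0 \<omega> * X 0 \<omega>\<bar> \<le> 3 * (\<epsilon> / 4)"
      proof -
        have x0: "x 0 \<omega> = X 0 \<omega>" by (simp add: x_def)
        have "\<bar>a + b + c\<bar> \<le> 3 * (\<epsilon> / 4)"
          if "\<bar>a\<bar> \<le> \<epsilon> / 4 \<and> \<bar>b\<bar> \<le> \<epsilon> / 4 \<and> \<bar>c\<bar> \<le> \<epsilon> / 4" for a b c :: real
          using that by linarith
        from this[OF conjunct2[OF *]] have "\<bar>Z (g N) \<omega> * x N \<omega> - Z (g 0) \<omega> * x 0 \<omega>\<bar> \<le> 3 * (\<epsilon> / 4)"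
          unfolding eq .
        then show ?thesis unfolding g(1,2) x0 .
      qed
      have "\<forall>s\<in>{0..u}. \<bar>Z s \<omega>\<bar> \<le> real nz" using * unfolding Ev_def by blast
      then have "\<bar>Z u \<omega>\<bar> \<le> c" using u0 c(2) by force
      moreover have "\<bar>X u \<omega> - x N \<omega>\<bar> \<le> C1 * \<rho>"
        using x_close[of \<omega> N] * g(2) by (simp add: abs_minus_commute)
      ultimately have "\<bar>Z u \<omega> * (X u \<omega> - x N \<omega>)\<bar> \<le> c * (C1 * \<rho>)"
        unfolding abs_mult using c by (intro mult_mono) auto
      then show "\<bar>Z u \<omega> * X u \<omega> - Z 0 \<omega> * X 0 \<omega>\<bar> \<le> \<epsilon>"
        using 1 \<rho>_C1 unfolding right_diff_distrib by linarith
    qed (use \<open>0 < q0\<close> in \<open>simp add: q_def\<close>)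
  qed
  then show ?thesis by (simp add: Z_def)
qed

end

section \<open>The price of the call\<close>

text \<open>The product of \<open>X\<close> with the inverse of geometric Brownian motion stays at
  its initial value, which is \<open>x0\<close> because \<open>B 0\<close> vanishes almost surely;
  multiplying by the exponential solves for \<open>X\<close>.\<close>

lemma (in brownian_motion) sde_solution_gbm:
  assumes sde: "sde_solution M B T (\<lambda>s x. \<mu> * x) (\<lambda>s x. \<sigma> * x) X"
    and init: "AE \<omega> in M. X 0 \<omega> = x0" and u: "u \<in> {0..T}"
  shows "AE \<omega> in M. X u \<omega> = x0 * exp (\<sigma> * B u \<omega> + (\<mu> - \<sigma>\<^sup>2 / 2) * u)"
proof (cases "u = 0")
  case True
  show ?thesis using B_zero init by eventually_elim (simp add: True)
next
  case False
  then have "AE \<omega> in M. exp (- \<sigma> * B u \<omega> - (\<mu> - \<sigma>\<^sup>2 / 2) * u) * X u \<omega> = exp (- \<sigma> * B 0 \<omega>) * X 0 \<omega>"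
    using u by (intro gbm_times_inverse[OF sde]) auto
  then show ?thesis
    using B_zero init
  proof eventually_elim
    case (elim \<omega>)
    define e where "e = \<sigma> * B u \<omega> + (\<mu> - \<sigma>\<^sup>2 / 2) * u"
    have "exp e * exp (- e) = 1" by (simp flip: exp_add)
    moreover have "exp (- e) * X u \<omega> = x0"
      using elim by (simp add: e_def)
    ultimately have "X u \<omega> = exp e * x0"
      by (metis mult.assoc mult_1)
    then show ?case by (simp add: e_def mult.commute)
  qed
qed

text \<open>The known variable may be frozen while the independent one is averaged. To test this on
  \<open>A\<close>, the indicator of \<open>A\<close> is joined to \<open>Y\<close>; the pair is
  still \<open>F\<close>-measurable, hence independent of \<open>W\<close>, and integrating out
  \<open>W\<close> first under the product law gives the claim.\<close>

lemma (in prob_space) real_cond_exp_independent: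
  fixes Y W :: "'a \<Rightarrow> real" and g :: "real \<Rightarrow> real \<Rightarrow> real"
  assumes F: "subalgebra M F" and Y: "Y \<in> borel_measurable F"
    and W: "W \<in> borel_measurable M"
    and ind: "indep_set (sets F) (sets (vimage_algebra (space M) W borel))"
    and g: "(\<lambda>(y, w). g y w) \<in> borel_measurable (borel \<Otimes>\<^sub>M borel)" and nonneg: "\<And>y w. 0 \<le> g y w"
    and int: "integrable M (\<lambda>\<omega>. g (Y \<omega>) (W \<omega>))"
    and int_w: "\<And>y. integrable M (\<lambda>\<omega>. g y (W \<omega>))"
  shows "AE \<omega> in M. real_cond_exp M F (\<lambda>\<omega>. g (Y \<omega>) (W \<omega>)) \<omega> = expectation (\<lambda>\<omega>'. g (Y \<omega>) (W \<omega>'))"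
proof -
  interpret finite_measure_subalgebra M F by standard (rule F)
  interpret PW: prob_space "distr M borel W" by (rule prob_space_distr[OF W])
  note [measurable] = W g
  have sp: "space F = space M" and sub: "sets F \<subseteq> sets M" using F by (auto simp: subalgebra_def)
  have YM[measurable]: "Y \<in> borel_measurable M" by (rule measurable_from_subalg[OF F Y])
  define \<phi> where "\<phi> y = expectation (\<lambda>\<omega>'. g y (W \<omega>'))" for y
  have \<phi>_distr: "\<phi> y = (\<integral>w. g y w \<partial>distr M borel W)" for y
    unfolding \<phi>_def by (subst integral_distr) auto
  have [measurable]: "\<phi> \<in> borel_measurable borel"
    unfolding \<phi>_distr[abs_def] by measurable
  have \<phi>0: "0 \<le> \<phi> y" for y unfolding \<phi>_def using nonneg by simp
  have \<phi>_nn: "(\<integral>\<^sup>+\<omega>'. ennreal (g y (W \<omega>')) \<partial>M) = ennreal (\<phi> y)" for y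
    unfolding \<phi>_def using int_w nonneg by (intro nn_integral_eq_integral) auto
  have key: "(\<integral>\<^sup>+\<omega>. ennreal (indicator A \<omega> * g (Y \<omega>) (W \<omega>)) \<partial>M) = (\<integral>\<^sup>+\<omega>. ennreal (indicator A \<omega> * \<phi> (Y \<omega>)) \<partial>M)"
    if A: "A \<in> sets F" for A
  proof -
    have AM[measurable]: "A \<in> sets M" using A sub by auto
    define U where "U \<omega> = (Y \<omega>, indicator A \<omega> :: real)" for \<omega>
    have U_F: "U \<in> measurable F (borel \<Otimes>\<^sub>M borel)"
      unfolding U_def[abs_def] using Y A by measurable
    have U: "U \<in> measurable M (borel \<Otimes>\<^sub>M borel)"
      unfolding U_def[abs_def] by measurable
    \<comment> \<open>The zero component only gives \<open>V\<close> the type of \<open>U\<close>,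
      as \<open>indep_var\<close> relates variables with values in the same type.\<close>
    define V where "V \<omega> = (W \<omega>, 0 :: real)" for \<omega>
    have V: "V \<in> measurable M (borel \<Otimes>\<^sub>M borel)"
      unfolding V_def[abs_def] by measurable
    interpret PV: prob_space "distr M (borel \<Otimes>\<^sub>M borel) V" by (rule prob_space_distr[OF V])
    have iv: "indep_var (borel \<Otimes>\<^sub>M borel) U (borel \<Otimes>\<^sub>M borel) V"
      using indep_var_if_indep_set[OF ind U_F sp W, of "\<lambda>x. (x, 0)" "borel \<Otimes>\<^sub>M borel"]
      by (simp add: V_def[abs_def])
    have eq: "distr M (borel \<Otimes>\<^sub>M borel) U \<Otimes>\<^sub>M distr M (borel \<Otimes>\<^sub>M borel) V =
        distr M ((borel \<Otimes>\<^sub>M borel) \<Otimes>\<^sub>M (borel \<Otimes>\<^sub>M borel)) (\<lambda>\<omega>. (U \<omega>, V \<omega>))"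
      using iv by (simp add: indep_var_distribution_eq)
    define G where "G z = ennreal (snd (fst z) * g (fst (fst z)) (fst (snd z)))"
      for z :: "(real \<times> real) \<times> (real \<times> real)"
    have G[measurable]: "G \<in> borel_measurable ((borel \<Otimes>\<^sub>M borel) \<Otimes>\<^sub>M (borel \<Otimes>\<^sub>M borel))"
      unfolding G_def[abs_def] by measurable
    have "(\<integral>\<^sup>+\<omega>. ennreal (indicator A \<omega> * g (Y \<omega>) (W \<omega>)) \<partial>M) = (\<integral>\<^sup>+\<omega>. G (U \<omega>, V \<omega>) \<partial>M)"
      by (simp add: G_def U_def V_def)
    also have "\<dots> = (\<integral>\<^sup>+z. G z \<partial>distr M ((borel \<Otimes>\<^sub>M borel) \<Otimes>\<^sub>M (borel \<Otimes>\<^sub>M borel)) (\<lambda>\<omega>. (U \<omega>, V \<omega>)))"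
      using U V by (subst nn_integral_distr) auto
    also have "\<dots> = (\<integral>\<^sup>+z. G z \<partial>(distr M (borel \<Otimes>\<^sub>M borel) U \<Otimes>\<^sub>M distr M (borel \<Otimes>\<^sub>M borel) V))"
      by (simp only: eq)
    also have "\<dots> = (\<integral>\<^sup>+z. \<integral>\<^sup>+w. G (z, w) \<partial>distr M (borel \<Otimes>\<^sub>M borel) V \<partial>distr M (borel \<Otimes>\<^sub>M borel) U)"
      by (rule PV.nn_integral_fst[symmetric]) (use G in \<open>simp add: eq\<close>)
    also have "\<dots> = (\<integral>\<^sup>+\<omega>. \<integral>\<^sup>+w. G (U \<omega>, w) \<partial>distr M (borel \<Otimes>\<^sub>M borel) V \<partial>M)"
      by (rule nn_integral_distr[OF U]) measurable
    also have "\<dots> = (\<integral>\<^sup>+\<omega>. ennreal (indicator A \<omega> * \<phi> (Y \<omega>)) \<partial>M)"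
    proof (rule nn_integral_cong)
      fix \<omega>
      have "(\<integral>\<^sup>+w. G (U \<omega>, w) \<partial>distr M (borel \<Otimes>\<^sub>M borel) V) = (\<integral>\<^sup>+\<omega>'. G (U \<omega>, V \<omega>') \<partial>M)"
        using measurable_compose[OF measurable_Pair1'[of "U \<omega>" "borel \<Otimes>\<^sub>M borel" "borel \<Otimes>\<^sub>M borel"] G]
        by (intro nn_integral_distr[OF V]) (simp add: space_pair_measure)
      also have "\<dots> = (\<integral>\<^sup>+\<omega>'. ennreal (indicator A \<omega>) * ennreal (g (Y \<omega>) (W \<omega>')) \<partial>M)"
        using nonneg by (simp add: G_def U_def V_def ennreal_mult)
      also have "\<dots> = ennreal (indicator A \<omega>) * ennreal (\<phi> (Y \<omega>))"
        by (subst nn_integral_cmult) (auto simp: \<phi>_nn)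
      finally show "(\<integral>\<^sup>+w. G (U \<omega>, w) \<partial>distr M (borel \<Otimes>\<^sub>M borel) V) = ennreal (indicator A \<omega> * \<phi> (Y \<omega>))"
        using \<phi>0 by (simp add: ennreal_mult)
    qed
    finally show ?thesis .
  qed
  \<comment> \<open>The case of the whole space carries integrability over to the candidate for the
    conditional expectation.\<close>
  have "(\<integral>\<^sup>+\<omega>. ennreal (\<phi> (Y \<omega>)) \<partial>M) = (\<integral>\<^sup>+\<omega>. ennreal (g (Y \<omega>) (W \<omega>)) \<partial>M)"
    using key[of "space M"] sets.top[of F] sp by (simp cong: nn_integral_cong)
  also have "\<dots> < \<infinity>"
    using int nonneg by (simp add: integrable_iff_bounded)
  finally have int_\<phi>: "integrable M (\<lambda>\<omega>. \<phi> (Y \<omega>))"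
    using \<phi>0 by (simp add: integrable_iff_bounded)
  have "AE \<omega> in M. real_cond_exp M F (\<lambda>\<omega>. g (Y \<omega>) (W \<omega>)) \<omega> = \<phi> (Y \<omega>)"
  proof (rule real_cond_exp_charact[OF _ int int_\<phi>])
    show "(\<lambda>\<omega>. \<phi> (Y \<omega>)) \<in> borel_measurable F" using Y by measurable
    fix A assume A: "A \<in> sets F"
    then have [measurable]: "A \<in> sets M" using sub by auto
    show "(LINT \<omega>:A|M. g (Y \<omega>) (W \<omega>)) = (LINT \<omega>:A|M. \<phi> (Y \<omega>))"
      unfolding set_lebesgue_integral_def real_scaleR_def
      using key[OF A] nonneg \<phi>0 by (simp add: integral_eq_nn_integral)
  qed
  then show ?thesis by (simp add: \<phi>_def)
qed

section \<open>Gaussian integrals of the call payoff\<close>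

lemma std_normal_cdf_eq_integral:
  "std_normal_cdf a = (\<integral>x. std_normal_density x * indicator {..a} x \<partial>lborel)"
proof -
  have "std_normal_cdf a = (\<integral>x. indicator {..a} x \<partial>std_normal_distribution)"
    by (simp add: cdf_def)
  also have "\<dots> = (\<integral>x. std_normal_density x * indicator {..a} x \<partial>lborel)"
    by (subst integral_density) auto
  finally show ?thesis .
qed

text \<open>The reflection of \<open>x\<close> to \<open>m - x\<close> turns the upper tail of the
  law with mean \<open>m\<close> into a lower tail of the standard law.\<close>

lemma shifted_normal_tail:
  "has_bochner_integral lborel (\<lambda>x. normal_density m 1 x * indicator {a..} x) (std_normal_cdf (m - a))"
proof -
  have "integrable lborel (\<lambda>x. normal_density m 1 x * indicator {a..} x)"
    using integrable_real_mult_indicator[of "{a..}" lborel "normal_density m 1"] by simp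
  moreover have "(\<integral>x. normal_density m 1 x * indicator {a..} x \<partial>lborel) = std_normal_cdf (m - a)"
  proof -
    have "(\<integral>x. normal_density m 1 x * indicator {a..} x \<partial>lborel) =
      \<bar>-1\<bar> *\<^sub>R (\<integral>x. normal_density m 1 (m + (-1) * x) * indicator {a..} (m + (-1) * x) \<partial>lborel)"
      by (rule lborel_integral_real_affine) simp
    also have "\<dots> = (\<integral>x. std_normal_density x * indicator {..m - a} x \<partial>lborel)"
      by (auto intro!: Bochner_Integration.integral_cong simp: normal_density_def indicator_def)
    finally show ?thesis by (simp only: std_normal_cdf_eq_integral)
  qed
  ultimately show ?thesis by (simp add: has_bochner_integral_iff)
qed

text \<open>The payoff is positive only for \<open>x\<close> beyond \<open>- d2\<close>. On this
  half-line the strike contributes a standard normal tail; the stock contributes a tail of the law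
  shifted by \<open>s\<close>, because the factor \<open>exp (s * x)\<close> moves the mean. This
  shift is the difference between the two arguments of the distribution function.\<close>

lemma lognormal_call_expectation:
  fixes y K s c :: real
  assumes "y > 0" "K > 0" "s > 0"
  defines "d2 \<equiv> (ln (y / K) + c) / s"
  shows "(\<integral>x. std_normal_density x * max 0 (y * exp (c + s * x) - K) \<partial>lborel) =
    y * exp (c + s\<^sup>2 / 2) * std_normal_cdf (d2 + s) - K * std_normal_cdf d2"
proof -
  have iff: "K \<le> y * exp (c + s * x) \<longleftrightarrow> - d2 \<le> x" for x
  proof -
    have "K \<le> y * exp (c + s * x) \<longleftrightarrow> ln K \<le> ln (y * exp (c + s * x))"
      using assms by (subst ln_le_cancel_iff) auto
    also have "\<dots> \<longleftrightarrow> ln K \<le> ln y + (c + s * x)"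
      using assms by (simp add: ln_mult)
    also have "\<dots> \<longleftrightarrow> - d2 \<le> x"
      using assms by (simp add: d2_def ln_div field_simps)
    finally show ?thesis .
  qed
  have shift: "std_normal_density x * exp (s * x) = exp (s\<^sup>2 / 2) * normal_density s 1 x" for x
    using normal_density_exp_shift[of 1 x s] by simp
  have split: "std_normal_density x * max 0 (y * exp (c + s * x) - K) =
      (y * exp (c + s\<^sup>2 / 2)) * (normal_density s 1 x * indicator {- d2..} x)
      - K * (normal_density 0 1 x * indicator {- d2..} x)" for x
  proof (cases "- d2 \<le> x")
    case True
    then have "std_normal_density x * max 0 (y * exp (c + s * x) - K) =
        y * exp c * (std_normal_density x * exp (s * x)) - K * std_normal_density x"
      using iff[of x] by (simp add: exp_add algebra_simps)
    then show ?thesis using True by (simp add: shift exp_add)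
  next
    case False
    then show ?thesis using iff[of x] by simp
  qed
  have "has_bochner_integral lborel (\<lambda>x. std_normal_density x * max 0 (y * exp (c + s * x) - K))
     ((y * exp (c + s\<^sup>2 / 2)) * std_normal_cdf (s - - d2) - K * std_normal_cdf (0 - - d2))"
    unfolding split by (intro has_bochner_integral_diff has_bochner_integral_mult_right shifted_normal_tail)
  then show ?thesis
    by (simp add: has_bochner_integral_iff add.commute)
qed

lemma (in prob_space) normal_call_expectation:
  fixes y K \<sigma> c d :: real
  assumes "y > 0" "K > 0" "\<sigma> > 0" "d > 0" and W: "distributed M lborel W (normal_density 0 (sqrt d))"
  defines "d2 \<equiv> (ln (y / K) + c) / (\<sigma> * sqrt d)"
  shows "expectation (\<lambda>\<omega>. max 0 (y * exp (c + \<sigma> * W \<omega>) - K)) =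
    y * exp (c + \<sigma>\<^sup>2 * d / 2) * std_normal_cdf (d2 + \<sigma> * sqrt d) - K * std_normal_cdf d2"
proof -
  have s: "sqrt d > 0" using \<open>d > 0\<close> by simp
  then have V: "distributed M lborel (\<lambda>\<omega>. (W \<omega> - 0) / sqrt d) std_normal_density"
    using W by (subst normal_standard_normal_convert[symmetric]) auto
  have "expectation (\<lambda>\<omega>. max 0 (y * exp (c + \<sigma> * W \<omega>) - K)) =
      expectation (\<lambda>\<omega>. max 0 (y * exp (c + (\<sigma> * sqrt d) * ((W \<omega> - 0) / sqrt d)) - K))"
    using s by simp
  also have "\<dots> = (\<integral>x. std_normal_density x * max 0 (y * exp (c + (\<sigma> * sqrt d) * x) - K) \<partial>lborel)"
    by (rule distributed_integral[OF V, symmetric]) auto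
  also have "\<dots> = y * exp (c + (\<sigma> * sqrt d)\<^sup>2 / 2) * std_normal_cdf (d2 + \<sigma> * sqrt d) - K * std_normal_cdf d2"
    unfolding d2_def using assms s by (intro lognormal_call_expectation) auto
  finally show ?thesis using \<open>d > 0\<close> by (simp add: power_mult_distrib)
qed

theorem proposition1:
  fixes M :: "'a measure"
    and B S :: "real \<Rightarrow> 'a \<Rightarrow> real"
    and r \<sigma> T K \<tau> C\<^sub>\<tau> I s\<^sub>0 t :: real
  assumes "prob_space M"
    and "standard_brownian_motion M B"
    and "\<sigma> > 0" and "T > 0" and "K > 0" and "C\<^sub>\<tau> \<ge> 0"
    and "I = C\<^sub>\<tau> * \<tau>"
    and "sde_solution M B T (\<lambda>u x. (r - C\<^sub>\<tau> * \<tau>) * x) (\<lambda>u x. \<sigma> * x) S"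
    and "s\<^sub>0 > 0" and "AE \<omega> in M. S 0 \<omega> = s\<^sub>0"
    and "t \<in> {0..<T}"
  shows "AE \<omega> in M.
    european_value M B r T (\<lambda>x. max 0 (x - K)) S t \<omega> =
      (let d\<^sub>1 = (ln (S t \<omega> / K) + (r - I + \<sigma>\<^sup>2 / 2) * (T - t)) / (\<sigma> * sqrt (T - t));
           d\<^sub>2 = d\<^sub>1 - \<sigma> * sqrt (T - t)
       in exp (- I * (T - t)) * S t \<omega> * std_normal_cdf d\<^sub>1
            - K * exp (- r * (T - t)) * std_normal_cdf d\<^sub>2)"
proof -
  interpret prob_space M by fact
  interpret brownian_motion M B by standard fact
  define \<mu> where "\<mu> = r - I"
  define h where "h = T - t"
  have t: "0 \<le> t" "t < T" "0 < h" using assms(11) by (auto simp: h_def)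
  have sde: "sde_solution M B T (\<lambda>u x. \<mu> * x) (\<lambda>u x. \<sigma> * x) S"
    using assms(8) by (simp add: \<mu>_def \<open>I = C\<^sub>\<tau> * \<tau>\<close>)
  \<comment> \<open>A version of \<open>S t\<close> that is measurable for the natural filtration,
    on which the value is conditioned; \<open>S t\<close> itself is only adapted to the augmented
    one.\<close>
  define Y where "Y \<omega> = s\<^sub>0 * exp (\<sigma> * B t \<omega> + (\<mu> - \<sigma>\<^sup>2 / 2) * t)" for \<omega>
  define W where "W \<omega> = B T \<omega> - B t \<omega>" for \<omega>
  define c where "c = (\<mu> - \<sigma>\<^sup>2 / 2) * h"
  define g where "g y w = max 0 (y * exp (c + \<sigma> * w) - K)" for y w
  have Y0: "Y \<omega> > 0" for \<omega> using \<open>s\<^sub>0 > 0\<close> by (simp add: Y_def)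
  have St: "AE \<omega> in M. S t \<omega> = Y \<omega>"
    unfolding Y_def using t by (intro sde_solution_gbm[OF sde assms(10)]) auto
  have ST: "AE \<omega> in M. S T \<omega> = s\<^sub>0 * exp (\<sigma> * B T \<omega> + (\<mu> - \<sigma>\<^sup>2 / 2) * T)"
    using t by (intro sde_solution_gbm[OF sde assms(10)]) auto
  have YT: "Y \<omega> * exp (c + \<sigma> * W \<omega>) = s\<^sub>0 * exp (\<sigma> * B T \<omega> + (\<mu> - \<sigma>\<^sup>2 / 2) * T)" for \<omega>
    unfolding Y_def W_def c_def h_def mult.assoc exp_add[symmetric] by (simp add: field_simps)
  have payoff: "AE \<omega> in M. max 0 (S T \<omega> - K) = g (Y \<omega>) (W \<omega>)"
    using ST by eventually_elim (simp add: g_def YT)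
  have F: "subalgebra M (NF t)"
    using NF_sub by (simp add: subalgebra_def space_natural_filtration)
  have Y_F: "Y \<in> borel_measurable (NF t)"
    using measurable_natural_filtration[of t t B M] t(1) unfolding Y_def[abs_def] by measurable
  have W_dist: "distributed M lborel W (normal_density 0 (sqrt h))"
    unfolding W_def[abs_def] h_def using t by (intro B_increment_distributed) auto
  have W_M[measurable]: "W \<in> borel_measurable M"
    using B_random_variable[OF t(1)] B_random_variable[OF less_imp_le[OF \<open>T > 0\<close>]] unfolding W_def[abs_def] by measurable
  have Y_M[measurable]: "Y \<in> borel_measurable M" by (rule measurable_from_subalg[OF F Y_F])
  have g_meas[measurable]: "(\<lambda>(y, w). g y w) \<in> borel_measurable (borel \<Otimes>\<^sub>M borel)"
    unfolding g_def by measurable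
  \<comment> \<open>Freezing is stated for every real \<open>y\<close>, of either sign; hence the
    absolute value in the dominating function.\<close>
  have int_w: "integrable M (\<lambda>\<omega>. g y (W \<omega>))" for y
  proof (rule Bochner_Integration.integrable_bound)
    show "integrable M (\<lambda>\<omega>. \<bar>y\<bar> * exp c * exp (\<sigma> * W \<omega>) + K)"
      using normal_exp_moments(1)[OF W_dist t(3), of \<sigma>] by (auto simp: has_bochner_integral_iff)
    show "(\<lambda>\<omega>. g y (W \<omega>)) \<in> borel_measurable M" unfolding g_def by measurable
    have le: "\<bar>max 0 (a - K)\<bar> \<le> \<bar>\<bar>a\<bar> + K\<bar>" for a :: real using \<open>K > 0\<close> by linarith
    have "\<bar>y * exp (c + \<sigma> * W \<omega>)\<bar> = \<bar>y\<bar> * exp c * exp (\<sigma> * W \<omega>)" for \<omega>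
      by (simp add: abs_mult exp_add)
    with le[of "y * exp (c + \<sigma> * W \<omega>)" for \<omega>]
    show "AE \<omega> in M. norm (g y (W \<omega>)) \<le> norm (\<bar>y\<bar> * exp c * exp (\<sigma> * W \<omega>) + K)"
      unfolding g_def real_norm_def by (intro AE_I2) (simp only:)
  qed
  have int: "integrable M (\<lambda>\<omega>. g (Y \<omega>) (W \<omega>))"
  proof (rule Bochner_Integration.integrable_bound)
    have "distributed M lborel (\<lambda>\<omega>. B T \<omega> - B 0 \<omega>) (normal_density 0 (sqrt (T - 0)))"
      using \<open>T > 0\<close> by (intro B_increment_distributed) auto
    from normal_exp_moments(1)[OF this, of \<sigma>] \<open>T > 0\<close>
    show "integrable M (\<lambda>\<omega>. s\<^sub>0 * exp ((\<mu> - \<sigma>\<^sup>2 / 2) * T) * exp (\<sigma> * (B T \<omega> - B 0 \<omega>)) + K)"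
      by (auto simp: has_bochner_integral_iff)
    show "(\<lambda>\<omega>. g (Y \<omega>) (W \<omega>)) \<in> borel_measurable M" unfolding g_def by measurable
    have le: "\<bar>max 0 (a - K)\<bar> \<le> \<bar>a + K\<bar>" if "a \<ge> 0" for a :: real using \<open>K > 0\<close> that by linarith
    show "AE \<omega> in M. norm (g (Y \<omega>) (W \<omega>)) \<le>
        norm (s\<^sub>0 * exp ((\<mu> - \<sigma>\<^sup>2 / 2) * T) * exp (\<sigma> * (B T \<omega> - B 0 \<omega>)) + K)"
      using B_zero
    proof eventually_elim
      case (elim \<omega>)
      have eq: "s\<^sub>0 * exp ((\<mu> - \<sigma>\<^sup>2 / 2) * T) * exp (\<sigma> * (B T \<omega> - B 0 \<omega>)) = Y \<omega> * exp (c + \<sigma> * W \<omega>)"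
        unfolding YT using elim by (simp add: exp_add)
      have "0 \<le> Y \<omega> * exp (c + \<sigma> * W \<omega>)" using Y0[of \<omega>] by simp
      from le[OF this] show ?case unfolding eq g_def real_norm_def .
    qed
  qed
  have "AE \<omega> in M. real_cond_exp M (NF t) (\<lambda>\<omega>. g (Y \<omega>) (W \<omega>)) \<omega> = expectation (\<lambda>\<omega>'. g (Y \<omega>) (W \<omega>'))"
  proof (rule real_cond_exp_independent[OF F Y_F W_M _ g_meas _ int int_w])
    show "indep_set (sets (NF t)) (sets (vimage_algebra (space M) W borel))"
      unfolding W_def[abs_def] using t by (intro B_increment_indep) auto
  qed (simp add: g_def)
  moreover have "AE \<omega> in M. real_cond_exp M (NF t) (\<lambda>\<omega>. max 0 (S T \<omega> - K)) \<omega> =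
      real_cond_exp M (NF t) (\<lambda>\<omega>. g (Y \<omega>) (W \<omega>)) \<omega>"
  proof -
    interpret finite_measure_subalgebra M "NF t" by standard (rule F)
    have "S T \<in> borel_measurable (AF T)"
      using sde \<open>T > 0\<close> by (auto simp: sde_solution_def Let_def measurable_adapted_def)
    then have [measurable]: "S T \<in> borel_measurable M" by (rule measurable_AF_M)
    show ?thesis
      by (rule real_cond_exp_cong[OF payoff]) (use int in auto)
  qed
  ultimately show ?thesis
    using St
  proof eventually_elim
    case (elim \<omega>)
    \<comment> \<open>This is the form that the Gaussian integral yields. As \<open>c\<close>
      contains \<open>- \<sigma>\<^sup>2 / 2\<close> where \<open>d1\<close> has
      \<open>+ \<sigma>\<^sup>2 / 2\<close>, the two differ by
      \<open>\<sigma> * sqrt h\<close>.\<close>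
    define d2 where "d2 = (ln (Y \<omega> / K) + c) / (\<sigma> * sqrt h)"
    define d1 where "d1 = (ln (Y \<omega> / K) + (r - I + \<sigma>\<^sup>2 / 2) * h) / (\<sigma> * sqrt h)"
    have "\<sigma> * sqrt h \<noteq> 0" "(\<sigma> * sqrt h) * (\<sigma> * sqrt h) = \<sigma>\<^sup>2 * h" using \<open>\<sigma> > 0\<close> t(3) by (auto simp: power2_eq_square)
    then have d1: "d1 = d2 + \<sigma> * sqrt h"
      unfolding d1_def d2_def c_def \<mu>_def by (simp add: field_simps)
    have "expectation (\<lambda>\<omega>'. g (Y \<omega>) (W \<omega>')) =
        Y \<omega> * exp (c + \<sigma>\<^sup>2 * h / 2) * std_normal_cdf (d2 + \<sigma> * sqrt h) - K * std_normal_cdf d2"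
      unfolding g_def d2_def by (rule normal_call_expectation[OF Y0 \<open>K > 0\<close> \<open>\<sigma> > 0\<close> t(3) W_dist])
    also have "c + \<sigma>\<^sup>2 * h / 2 = (r - I) * h" by (simp add: c_def \<mu>_def field_simps)
    finally have E: "expectation (\<lambda>\<omega>'. g (Y \<omega>) (W \<omega>')) =
        Y \<omega> * exp ((r - I) * h) * std_normal_cdf d1 - K * std_normal_cdf d2"
      by (simp only: d1)
    have disc: "exp (- r * h) * exp ((r - I) * h) = exp (- I * h)"
      unfolding exp_add[symmetric] by (simp add: algebra_simps)
    have "european_value M B r T (\<lambda>x. max 0 (x - K)) S t \<omega> =
        exp (- r * h) * (Y \<omega> * exp ((r - I) * h) * std_normal_cdf d1 - K * std_normal_cdf d2)"
      unfolding european_value_def h_def[symmetric] elim(1,2)[symmetric] using elim(1,2) E by simp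
    also have "\<dots> = (exp (- r * h) * exp ((r - I) * h)) * Y \<omega> * std_normal_cdf d1 - K * exp (- r * h) * std_normal_cdf d2"
      by (simp add: algebra_simps)
    also have "\<dots> = exp (- I * h) * Y \<omega> * std_normal_cdf d1 - K * exp (- r * h) * std_normal_cdf (d1 - \<sigma> * sqrt h)"
      by (simp only: disc) (simp add: d1)
    finally show ?case
      by (simp add: elim(3) Let_def h_def[symmetric] d1_def)
  qed
qed

end
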